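(* Let $\mathscr T=(V,E)$ be a rooted directed tree with root $\mathsf{root}$. For $u,b\in V$, consider a weight system $\lambda_u=\{\lambda_{uv}\}$ of complex numbers and let $W_{f,g}$ be the rank one extension of the weighted join operator $W^{(b)}_{\lambda_u}$ on $\mathscr T$, where $f\in\ell^2(V)\ominus\mathscr H$ is non-zero and $g:U\to\mathbb C$ is given ($U$, $\mathscr H=\ell^2(U)$, $D$, $N$, $W_{f,g}$ and compatibility condition I are defined in the context). Then: (i) The point spectrum of $W_{f,g}$ is given by $$\sigma_p(W_{f,g})=\begin{cases}\{\lambda_{uv}:v\in V\}&\text{if } b=u,\\ \{\lambda_{uv}:v\in\mathsf{Asc}(u)\cup\mathsf{Des}_b[u]\}\cup\{0\}&\text{if } b\in\mathsf{Des}_u(u),\\ \{\lambda_{uv}:v\in\mathsf{Des}(u)\}\cup\{0\}&\text{otherwise.}\end{cases}$$ (ii) The spectrum of $W_{f,g}$ is given by $\sigma(W_{f,g})=\overline{\sigma_p(W_{f,g})}$ if $W_{f,g}$ satisfies the compatibility condition I, and $\sigma(W_{f,g})=\mathbb C$ otherwise. If, in addition, $W_{f,g}$ satisfies the compatibility condition I, then: (iii) For every $\mu\in\mathbb C\setminus\overline{\sigma_p(W_{f,g})}$, the resolvent of $W_{f,g}$ at $\mu$ is given by $$(W_{f,g}-\mu)^{-1}=\begin{bmatrix}(D-\mu)^{-1}&0\\ -(N-\mu)^{-1}L_{\lambda_u,\mu}&(N-\mu)^{-1}\end{bmatrix},$$ where the linear transformation $L_{\lambda_u,\mu}:=(f\oslash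 g)(D-\mu)^{-1}$ defines a Hilbert-Schmidt integral operator from $\mathscr H$ into $\ell^2(V)\ominus\mathscr H$. (iv) The essential spectrum of $W_{f,g}$ is given by $\sigma_e(W_{f,g})=\sigma_e(D)$ if $\dim(\ell^2(V)\ominus\mathscr H)<\infty$, and $\sigma_e(W_{f,g})=\sigma_e(D)\cup\{0\}$ otherwise. Moreover, $\mathrm{ind}_{W_{f,g}}=0$ on $\mathbb C\setminus\sigma_e(W_{f,g})$.
   Context: Trees. A directed tree $\mathscr T=(V,E)$ is a directed graph (no loops, $V$ and $E$ nonempty) which has no circuits, is connected (ignoring orientation), and in which every non-root vertex $v$ has exactly one parent $\mathsf{par}(v)$; it is rooted if there is a unique vertex $\mathsf{root}$ without parent. Throughout $\mathrm{card}(V)=\aleph_0$. $\mathsf{Des}(u)$ is the set of descendants of $u$, including $u$; $\mathsf{Asc}(u)=\{\mathsf{par}^{\langle n\rangle}(u):n\ge1\}$; for $v\in\mathsf{Des}(u)$, $[u,v]$ is the set of vertices of the directed path from $u$ to $v$, $(u,v]=[u,v]\setminus\{u\}$, $\mathsf{Des}_v(u)=\mathsf{Des}(u)\setminus[u,v]$ and $\mathsf{Des}_v[u]=\mathsf{Des}(u)\setminus(u,v]$; so $\mathsf{Des}_u(u)=\mathsf{Des}(u)\setminus\{u\}$. Rank one extension. Let $u,b\in V$ and $\{\lambda_{uv}\}_{v\in V}\subseteq\mathbb C$. Put $U=V\setminus\{u\}$ if $b=u$; $U=\mathsf{Asc}(u)\cup\mathsf{Des}_b(u)$ if $b\in\mathsf{Des}(u)\setminus\{u\}$;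 $U=\mathsf{Des}(u)\setminus\{u\}$ if $b\notin\mathsf{Des}(u)$. Put $A_u=[u,b]$ if $b\in\mathsf{Des}(u)$ and $A_u=\mathsf{Asc}(u)\cup\{b,u\}$ otherwise. $\mathscr H=\mathscr H^{(b)}_u=\ell^2(U)\subseteq\ell^2(V)$. $D=D^{(b)}_{\lambda_u}$ is the maximally defined diagonal operator in $\mathscr H$ with $De_v=\lambda_{uv}e_v$ ($v\in U$), and $N=N^{(b)}_{\lambda_u}=e_u\otimes e_{\lambda_u,A_u}$ on $\ell^2(V)\ominus\mathscr H$, with $e_{\lambda_u,A_u}=\sum_{v\in A_u}\overline{\lambda_{uv}}e_v$ and $(x\otimes y)h=\langle h,y\rangle x$. (The weighted join operator is $W^{(b)}_{\lambda_u}=D\oplus N$.) The operator $f\oslash g$ has domain $\{h\in\mathscr H:\sum_{v\in U}h(v)\overline{g(v)}\text{ is convergent}\}$ and $(f\oslash g)h=\big(\sum_{v\in U}h(v)\overline{g(v)}\big)f$. $W_{f,g}$ is the operator in $\ell^2(V)$ with domain $\{(h,k):h\in\mathscr D(D)\cap\mathscr D(f\oslash g),\ k\in\ell^2(V)\ominus\mathscr H\}$ and $W_{f,g}=\begin{bmatrix}D&0\\ f\oslash g&N\end{bmatrix}$. Compatibility condition I: there is $\mu_0\in\mathbb C$ with $\inf_{v\in U}|\mu_0-\lambda_{uv}|>0$ and $\sum_{v\in U}\frac{|g(v)|^2}{|\lambda_{uv}-\mu_0|^2}<\infty$. Spectral notions for a densely defined (not necessarily closed) operator $S$: $\sigma(S)$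 is the complement of the set of $\lambda$ for which $(S-\lambda)^{-1}$ exists as a bounded linear operator on the whole space; $\sigma_p(S)$ is the set of eigenvalues; $S$ is Fredholm if $\mathrm{ran}\,S$ is closed and $\ker S,\ker S^*$ are finite dimensional; $\sigma_e(S)$ is the complement of $\{\lambda:S-\lambda\text{ Fredholm}\}$; $\mathrm{ind}_S(\lambda)=\dim\ker(S-\lambda)-\dim\ker(S^*-\bar\lambda)$ for $\lambda\notin\sigma_e(S)$. *)

theory Defs
  imports "HOL-Analysis.Analysis" "HOL-Library.Function_Algebras"
begin

section \<open>Directed trees\<close>

text \<open>
  A directed graph is a vertex set \<open>V\<close> with a set \<open>E\<close> of ordered pairs; \<open>(u, v) \<in> E\<close> is an edge
  from \<open>u\<close> to \<open>v\<close>, so that \<open>u\<close> is a parent of \<open>v\<close>.  A circuit is a closed directed walk, so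
  absence of circuits is \<^const>\<open>acyclic\<close>.
\<close>

definition directed_tree :: "'v set \<Rightarrow> 'v rel \<Rightarrow> bool" where
  "directed_tree V E \<longleftrightarrow>
     V \<noteq> {} \<and> E \<noteq> {} \<and> E \<subseteq> V \<times> V \<and> irrefl E \<and> acyclic E \<and>
     (\<forall>v\<in>V. \<forall>w\<in>V. (v, w) \<in> (E \<union> E\<inverse>)\<^sup>*) \<and>
     (\<forall>v\<in>V. (\<exists>w. (w, v) \<in> E) \<longrightarrow> (\<exists>!w. (w, v) \<in> E))"

definition rooted_directed_tree :: "'v set \<Rightarrow> 'v rel \<Rightarrow> bool" where
  "rooted_directed_tree V E \<longleftrightarrow>
     directed_tree V E \<and> (\<exists>!r. r \<in> V \<and> (\<nexists>w. (w, r) \<in> E))"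

definition Des :: "'v rel \<Rightarrow> 'v \<Rightarrow> 'v set" where
  "Des E u = E\<^sup>* `` {u}"

text \<open>
  \<open>(w, u) \<in> E ^^ n\<close> says that the \<open>n\<close>-fold iterate of the partial function \<open>par\<close> is defined
  at \<open>u\<close> with value \<open>w\<close>.
\<close>

definition Asc :: "'v rel \<Rightarrow> 'v \<Rightarrow> 'v set" where
  "Asc E u = {w. \<exists>n\<ge>1. (w, u) \<in> E ^^ n}"

definition dpath :: "'v rel \<Rightarrow> 'v \<Rightarrow> 'v list \<Rightarrow> 'v \<Rightarrow> bool" where
  "dpath E u p v \<longleftrightarrow>
     p \<noteq> [] \<and> hd p = u \<and> last p = v \<and> successively (\<lambda>x y. (x, y) \<in> E) p"

text \<open>
  \<open>[u, v]\<close>; in a directed tree there is exactly one directed path from \<open>u\<close> to a descendant \<open>v\<close>.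
\<close>

definition path_verts :: "'v rel \<Rightarrow> 'v \<Rightarrow> 'v \<Rightarrow> 'v set" where
  "path_verts E u v = {w. \<exists>p. dpath E u p v \<and> w \<in> set p}"

text \<open>\<open>Des_open E v u\<close> is \<open>Des\<^sub>v(u)\<close> and \<open>Des_closed E v u\<close> is \<open>Des\<^sub>v[u]\<close>.\<close>

definition Des_open :: "'v rel \<Rightarrow> 'v \<Rightarrow> 'v \<Rightarrow> 'v set" where
  "Des_open E v u = Des E u - path_verts E u v"

definition Des_closed :: "'v rel \<Rightarrow> 'v \<Rightarrow> 'v \<Rightarrow> 'v set" where
  "Des_closed E v u = Des E u - (path_verts E u v - {u})"


section \<open>The Hilbert spaces \<open>\<ell>\<^sup>2(X)\<close>\<close>

text \<open>
  For \<open>X \<subseteq> V\<close>, \<open>\<ell>\<^sup>2(X)\<close> consists of functions on the whole vertex type that vanish outside \<open>X\<close>,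
  so that \<open>\<ell>\<^sup>2(X) \<subseteq> \<ell>\<^sup>2(V)\<close> holds literally.  Sums of vectors are the pointwise
  sums of \<^theory>\<open>HOL-Library.Function_Algebras\<close>.
\<close>

definition ell2 :: "'v set \<Rightarrow> ('v \<Rightarrow> complex) set" where
  "ell2 X = {h. (\<forall>v. v \<notin> X \<longrightarrow> h v = 0) \<and> (\<lambda>v. (cmod (h v))\<^sup>2) summable_on X}"

definition cinner2 :: "('v \<Rightarrow> complex) \<Rightarrow> ('v \<Rightarrow> complex) \<Rightarrow> complex" where
  "cinner2 h k = (\<Sum>\<^sub>\<infinity>v. h v * cnj (k v))"

definition norm2 :: "('v \<Rightarrow> complex) \<Rightarrow> real" where
  "norm2 h = sqrt (\<Sum>\<^sub>\<infinity>v. (cmod (h v))\<^sup>2)"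

definition cscale :: "complex \<Rightarrow> ('v \<Rightarrow> complex) \<Rightarrow> ('v \<Rightarrow> complex)"  (infixr \<open>*\<^sub>c\<close> 75) where
  "c *\<^sub>c h = (\<lambda>v. c * h v)"

interpretation cfun: vector_space "cscale :: complex \<Rightarrow> ('v \<Rightarrow> complex) \<Rightarrow> 'v \<Rightarrow> complex"
  by unfold_locales (auto simp: cscale_def algebra_simps)

definition finite_dim :: "('v \<Rightarrow> complex) set \<Rightarrow> bool" where
  "finite_dim X \<longleftrightarrow> (\<exists>B. finite B \<and> X \<subseteq> cfun.span B)"

definition basis_vec :: "'v \<Rightarrow> 'v \<Rightarrow> complex" where
  "basis_vec u = (\<lambda>v. if v = u then 1 else 0)"

definition ominus :: "('v \<Rightarrow> complex) set \<Rightarrow> ('v \<Rightarrow> complex) set \<Rightarrow> ('v \<Rightarrow> complex) set"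
    (infixl \<open>\<ominus>\<^sub>2\<close> 65) where
  "K \<ominus>\<^sub>2 H = {k \<in> K. \<forall>h\<in>H. cinner2 k h = 0}"

lemma summable_norm2_ell2:
  assumes "h \<in> ell2 X"
  shows "(\<lambda>v. (cmod (h v))\<^sup>2) summable_on A"
proof -
  have "(\<lambda>v. (cmod (h v))\<^sup>2) summable_on UNIV \<longleftrightarrow> (\<lambda>v. (cmod (h v))\<^sup>2) summable_on X"
    by (rule summable_on_cong_neutral) (use assms in \<open>auto simp: ell2_def\<close>)
  then have "(\<lambda>v. (cmod (h v))\<^sup>2) summable_on UNIV" using assms by (simp add: ell2_def)
  then show ?thesis by (rule summable_on_subset_banach) simp
qed

lemma ell2_ominus_ell2:
  assumes "U \<subseteq> V"
  shows "ell2 V \<ominus>\<^sub>2 ell2 U = ell2 (V - U)"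
proof (intro equalityI subsetI)
  fix k assume k: "k \<in> ell2 V \<ominus>\<^sub>2 ell2 U"
  have "k u = 0" if "u \<in> U" for u
  proof -
    have "(\<lambda>v. (cmod (basis_vec u v))\<^sup>2) summable_on U \<longleftrightarrow>
        (\<lambda>v. (cmod (basis_vec u v))\<^sup>2) summable_on {u}"
      by (rule summable_on_cong_neutral) (use that in \<open>auto simp: basis_vec_def\<close>)
    then have "basis_vec u \<in> ell2 U"
      using that by (auto simp: ell2_def basis_vec_def)
    moreover have "cinner2 k (basis_vec u) = (\<Sum>\<^sub>\<infinity>v\<in>{u}. k v * cnj (basis_vec u v))"
      unfolding cinner2_def by (rule infsum_cong_neutral) (auto simp: basis_vec_def)
    ultimately show ?thesis using k by (simp add: ominus_def basis_vec_def)
  qed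
  moreover have "k \<in> ell2 V" using k by (simp add: ominus_def)
  ultimately show "k \<in> ell2 (V - U)"
    using summable_norm2_ell2[of k V "V - U"] by (auto simp: ell2_def)
next
  fix k assume k: "k \<in> ell2 (V - U)"
  have "cinner2 k h = 0" if "h \<in> ell2 U" for h
  proof -
    have "k v * cnj (h v) = 0" for v using that k by (cases "v \<in> U") (auto simp: ell2_def)
    then show ?thesis unfolding cinner2_def by (intro infsum_0) blast
  qed
  moreover have "k \<in> ell2 V"
    using k summable_norm2_ell2[OF k, of V] by (auto simp: ell2_def)
  ultimately show "k \<in> ell2 V \<ominus>\<^sub>2 ell2 U" by (simp add: ominus_def)
qed

text \<open>The closed subsets of \<open>\<ell>\<^sup>2(X)\<close> are those of the metric \<open>\<parallel>x - y\<parallel>\<close>.\<close>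

definition closed_in2 :: "('v \<Rightarrow> complex) set \<Rightarrow> ('v \<Rightarrow> complex) set \<Rightarrow> bool" where
  "closed_in2 K Y \<longleftrightarrow> closedin (Metric_space.mtopology K (\<lambda>x y. norm2 (x - y))) Y"

lemma norm2_triangle:
  assumes "h \<in> ell2 X" "k \<in> ell2 X"
  shows "h + k \<in> ell2 X" "norm2 (h + k) \<le> norm2 h + norm2 k"
proof -
  have L2: "L2_set (\<lambda>v. cmod (h v)) F \<le> norm2 h" if "finite F" "h \<in> ell2 X" for F h
    unfolding L2_set_def norm2_def
    by (rule real_sqrt_le_mono, rule finite_sum_le_infsum) (use summable_norm2_ell2 that in auto)
  have bound: "(\<Sum>v\<in>F. (cmod ((h + k) v))\<^sup>2) \<le> (norm2 h + norm2 k)\<^sup>2" if F: "finite F" for F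
  proof -
    have "L2_set (\<lambda>v. cmod ((h + k) v)) F \<le> L2_set (\<lambda>v. cmod (h v) + cmod (k v)) F"
      by (rule L2_set_mono) (auto simp: norm_triangle_ineq)
    also have "\<dots> \<le> L2_set (\<lambda>v. cmod (h v)) F + L2_set (\<lambda>v. cmod (k v)) F"
      by (rule L2_set_triangle_ineq)
    also have "\<dots> \<le> norm2 h + norm2 k" using L2[OF F] assms by (intro add_mono) auto
    finally have "(L2_set (\<lambda>v. cmod ((h + k) v)) F)\<^sup>2 \<le> (norm2 h + norm2 k)\<^sup>2"
      by (intro power_mono) auto
    then show ?thesis by (simp add: L2_set_def sum_nonneg)
  qed
  have sm: "(\<lambda>v. (cmod ((h + k) v))\<^sup>2) summable_on A" for A
    by (rule nonneg_bdd_above_summable_on)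
      (use bound in \<open>auto simp: bdd_above_def intro!: exI[of _ "(norm2 h + norm2 k)\<^sup>2"]\<close>)
  show "h + k \<in> ell2 X" using sm assms by (auto simp: ell2_def)
  have "(\<Sum>\<^sub>\<infinity>v. (cmod ((h + k) v))\<^sup>2) \<le> (norm2 h + norm2 k)\<^sup>2"
    using sm bound by (intro infsum_le_finite_sums) auto
  moreover have "0 \<le> norm2 h + norm2 k" by (simp add: norm2_def infsum_nonneg)
  ultimately show "norm2 (h + k) \<le> norm2 h + norm2 k"
    unfolding norm2_def[of "h + k"] using real_le_lsqrt by blast
qed

lemma Metric_space_ell2: "Metric_space (ell2 X) (\<lambda>x y. norm2 (x - y))"
proof
  have neg: "- h \<in> ell2 X" if "h \<in> ell2 X" for h using that by (auto simp: ell2_def)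
  fix x y z :: "'a \<Rightarrow> complex"
  show "0 \<le> norm2 (x - y)" by (simp add: norm2_def infsum_nonneg)
  show "norm2 (x - y) = norm2 (y - x)" by (simp add: norm2_def norm_minus_commute)
  assume x: "x \<in> ell2 X" and y: "y \<in> ell2 X"
  have "x - y \<in> ell2 X" using norm2_triangle(1)[OF x neg[OF y]] by simp
  then have sm: "(\<lambda>v. (cmod ((x - y) v))\<^sup>2) summable_on UNIV"
    by (rule summable_norm2_ell2)
  show "(norm2 (x - y) = 0) = (x = y)"
  proof
    assume "norm2 (x - y) = 0"
    then have "(\<Sum>\<^sub>\<infinity>v. (cmod ((x - y) v))\<^sup>2) = 0" by (simp add: norm2_def)
    then have "(cmod ((x - y) v))\<^sup>2 \<le> 0" for v
      using finite_sum_le_infsum[OF sm, of "{v}"] by simp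
    then show "x = y" by (intro ext) auto
  qed (simp add: norm2_def)
  assume z: "z \<in> ell2 X"
  show "norm2 (x - z) \<le> norm2 (x - y) + norm2 (y - z)"
    using norm2_triangle(2)[of "x - y" X "y - z"]
      norm2_triangle(1)[OF x neg[OF y]] norm2_triangle(1)[OF y neg[OF z]] by simp
qed


section \<open>Unbounded operators\<close>

text \<open>
  A linear operator with arbitrary domain is represented by its graph.  Thus the domain and the
  range are \<^const>\<open>Domain\<close> and \<^const>\<open>Range\<close>, the inverse is \<^const>\<open>converse\<close>, and equality of
  operators includes equality of their domains.
\<close>

type_synonym 'v oper = "(('v \<Rightarrow> complex) \<times> ('v \<Rightarrow> complex)) set"

definition linear_oper :: "('v \<Rightarrow> complex) set \<Rightarrow> ('v \<Rightarrow> complex) set \<Rightarrow> 'v oper \<Rightarrow> bool" where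
  "linear_oper K L S \<longleftrightarrow>
     S \<subseteq> K \<times> L \<and> single_valued S \<and> (0, 0) \<in> S \<and>
     (\<forall>(x, y)\<in>S. \<forall>(x', y')\<in>S. \<forall>c. (c *\<^sub>c x + x', c *\<^sub>c y + y') \<in> S)"

definition bounded_on_whole :: "('v \<Rightarrow> complex) set \<Rightarrow> 'v oper \<Rightarrow> bool" where
  "bounded_on_whole K S \<longleftrightarrow>
     linear_oper K K S \<and> Domain S = K \<and> (\<exists>C. \<forall>(x, y)\<in>S. norm2 y \<le> C * norm2 x)"

definition op_shift :: "'v oper \<Rightarrow> complex \<Rightarrow> 'v oper"  (infixl \<open>-\<^sub>o\<close> 65) where
  "S -\<^sub>o \<mu> = {(x, y - \<mu> *\<^sub>c x) | x y. (x, y) \<in> S}"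

definition op_neg :: "'v oper \<Rightarrow> 'v oper" where
  "op_neg S = {(x, - y) | x y. (x, y) \<in> S}"

text \<open>\<open>S \<circ>\<^sub>o T\<close> applies \<open>T\<close> first, whereas \<^const>\<open>relcomp\<close> applies its left argument first.\<close>

definition op_comp :: "'v oper \<Rightarrow> 'v oper \<Rightarrow> 'v oper"  (infixl \<open>\<circ>\<^sub>o\<close> 70) where
  "S \<circ>\<^sub>o T = T O S"

definition op_ker :: "'v oper \<Rightarrow> ('v \<Rightarrow> complex) set" where
  "op_ker S = {x. (x, 0) \<in> S}"

text \<open>The Hilbert space adjoint in \<open>K\<close> of a densely defined operator.\<close>

definition adjoint_in :: "('v \<Rightarrow> complex) set \<Rightarrow> 'v oper \<Rightarrow> 'v oper" where
  "adjoint_in K S =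
     {(y, z). y \<in> K \<and> z \<in> K \<and> (\<forall>(x, w)\<in>S. cinner2 w y = cinner2 x z)}"

text \<open>
  The lower triangular operator matrix \<open>[[A, 0], [B, C]]\<close>, where a pair \<open>(h, k)\<close> in
  \<open>H \<oplus> (\<ell>\<^sup>2(V) \<ominus> H)\<close> is identified with \<open>h + k\<close>.  The domain consists of the \<open>h + k\<close> with
  \<open>h\<close> in the domains of both \<open>A\<close> and \<open>B\<close>, and \<open>k\<close> in the domain of \<open>C\<close>.
\<close>

definition lower_block :: "'v oper \<Rightarrow> 'v oper \<Rightarrow> 'v oper \<Rightarrow> 'v oper" where
  "lower_block A B C =
     {(h + k, a + (b + c)) | h k a b c. (h, a) \<in> A \<and> (h, b) \<in> B \<and> (k, c) \<in> C}"

definition op_spectrum :: "('v \<Rightarrow> complex) set \<Rightarrow> 'v oper \<Rightarrow> complex set" where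
  "op_spectrum K S = - {\<mu>. bounded_on_whole K ((S -\<^sub>o \<mu>)\<inverse>)}"

definition point_spectrum :: "'v oper \<Rightarrow> complex set" where
  "point_spectrum S = {\<mu>. \<exists>x. x \<noteq> 0 \<and> (x, \<mu> *\<^sub>c x) \<in> S}"

definition fredholm :: "('v \<Rightarrow> complex) set \<Rightarrow> 'v oper \<Rightarrow> bool" where
  "fredholm K S \<longleftrightarrow>
     closed_in2 K (Range S) \<and> finite_dim (op_ker S) \<and> finite_dim (op_ker (adjoint_in K S))"

definition ess_spectrum :: "('v \<Rightarrow> complex) set \<Rightarrow> 'v oper \<Rightarrow> complex set" where
  "ess_spectrum K S = - {\<mu>. fredholm K (S -\<^sub>o \<mu>)}"

text \<open>
  Meaningful only for \<open>\<mu>\<close> outside the essential spectrum, since the dimension function of the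
  library is \<open>0\<close> on infinite dimensional spaces.
\<close>

definition fredholm_index :: "('v \<Rightarrow> complex) set \<Rightarrow> 'v oper \<Rightarrow> complex \<Rightarrow> int" where
  "fredholm_index K S \<mu> =
     int (cfun.dim (op_ker (S -\<^sub>o \<mu>))) - int (cfun.dim (op_ker (adjoint_in K S -\<^sub>o cnj \<mu>)))"

definition hilbert_schmidt_integral_oper :: "'v set \<Rightarrow> 'v set \<Rightarrow> 'v oper \<Rightarrow> bool" where
  "hilbert_schmidt_integral_oper X Y T \<longleftrightarrow>
     (\<exists>k :: 'v \<Rightarrow> 'v \<Rightarrow> complex.
        (\<lambda>(w, v). (cmod (k w v))\<^sup>2) summable_on (Y \<times> X) \<and>
        T = {(h, \<lambda>w. if w \<in> Y then \<Sum>\<^sub>\<infinity>v\<in>X. k w v * h v else 0) | h. h \<in> ell2 X})"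


section \<open>Weighted join operators and their rank one extensions\<close>

text \<open>\<open>lam\<close> is the system \<open>v \<mapsto> \<lambda>\<^sub>u\<^sub>v\<close> for the fixed vertex \<open>u\<close>.\<close>

definition join_U :: "'v set \<Rightarrow> 'v rel \<Rightarrow> 'v \<Rightarrow> 'v \<Rightarrow> 'v set" where
  "join_U V E u b =
     (if b = u then V - {u}
      else if b \<in> Des E u - {u} then Asc E u \<union> Des_open E b u
      else Des E u - {u})"

definition join_A :: "'v rel \<Rightarrow> 'v \<Rightarrow> 'v \<Rightarrow> 'v set" where
  "join_A E u b = (if b \<in> Des E u then path_verts E u b else Asc E u \<union> {b, u})"

definition diag_oper :: "'v set \<Rightarrow> ('v \<Rightarrow> complex) \<Rightarrow> 'v oper" where
  "diag_oper X lam =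
     {(h, \<lambda>v. lam v * h v) | h. h \<in> ell2 X \<and> (\<lambda>v. lam v * h v) \<in> ell2 X}"

definition rank_one_oper ::
    "('v \<Rightarrow> complex) set \<Rightarrow> ('v \<Rightarrow> complex) \<Rightarrow> ('v \<Rightarrow> complex) \<Rightarrow> 'v oper" where
  "rank_one_oper K x y = {(h, cinner2 h y *\<^sub>c x) | h. h \<in> K}"

text \<open>The vector \<open>\<Sum>v\<in>A. cnj \<lambda>\<^sub>u\<^sub>v e\<^sub>v\<close>, written pointwise.\<close>

definition weight_vec :: "('v \<Rightarrow> complex) \<Rightarrow> 'v set \<Rightarrow> 'v \<Rightarrow> complex" where
  "weight_vec lam A = (\<lambda>v. if v \<in> A then cnj (lam v) else 0)"

text \<open>\<open>f \<oslash> g\<close>; the function \<open>g\<close> need not be square summable, and only its values on \<open>X\<close> matter.\<close>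

definition oslash_oper ::
    "'v set \<Rightarrow> ('v \<Rightarrow> complex) \<Rightarrow> ('v \<Rightarrow> complex) \<Rightarrow> 'v oper" where
  "oslash_oper X f g =
     {(h, (\<Sum>\<^sub>\<infinity>v\<in>X. h v * cnj (g v)) *\<^sub>c f) | h.
        h \<in> ell2 X \<and> (\<lambda>v. h v * cnj (g v)) summable_on X}"

definition join_D :: "'v set \<Rightarrow> 'v rel \<Rightarrow> 'v \<Rightarrow> 'v \<Rightarrow> ('v \<Rightarrow> complex) \<Rightarrow> 'v oper" where
  "join_D V E u b lam = diag_oper (join_U V E u b) lam"

definition join_N :: "'v set \<Rightarrow> 'v rel \<Rightarrow> 'v \<Rightarrow> 'v \<Rightarrow> ('v \<Rightarrow> complex) \<Rightarrow> 'v oper" where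
  "join_N V E u b lam =
     rank_one_oper (ell2 V \<ominus>\<^sub>2 ell2 (join_U V E u b)) (basis_vec u) (weight_vec lam (join_A E u b))"

definition rank_one_ext ::
    "'v set \<Rightarrow> 'v rel \<Rightarrow> 'v \<Rightarrow> 'v \<Rightarrow> ('v \<Rightarrow> complex) \<Rightarrow> ('v \<Rightarrow> complex) \<Rightarrow> ('v \<Rightarrow> complex) \<Rightarrow> 'v oper"
  where
  "rank_one_ext V E u b lam f g =
     lower_block (join_D V E u b lam) (oslash_oper (join_U V E u b) f g) (join_N V E u b lam)"

text \<open>
  The infimum is taken in \<^typ>\<open>ereal\<close>, so that it is \<open>\<infinity>\<close> for \<open>X = {}\<close>, which occurs when \<open>u\<close> is a
  leaf and \<open>b \<notin> Des(u)\<close>.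
\<close>

definition compat_I :: "'v set \<Rightarrow> ('v \<Rightarrow> complex) \<Rightarrow> ('v \<Rightarrow> complex) \<Rightarrow> bool" where
  "compat_I X lam g \<longleftrightarrow>
     (\<exists>\<mu>\<^sub>0. (INF v\<in>X. ereal (cmod (\<mu>\<^sub>0 - lam v))) > 0 \<and>
           (\<lambda>v. (cmod (g v))\<^sup>2 / (cmod (lam v - \<mu>\<^sub>0))\<^sup>2) summable_on X)"

end

theory Submission
  imports Defs
begin

text \<open>
  Write \<open>Y = V - U\<close>, so that \<open>\<ell>\<^sup>2(V)\<close> is the orthogonal sum of \<open>\<ell>\<^sup>2(U)\<close> and \<open>\<ell>\<^sup>2(Y)\<close>.  The tree enters
  only through a few facts about \<open>U\<close> and the set \<open>A\<close> that carries the weights of \<open>N\<close>: a vertex of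
  a rooted tree has finitely many ancestors, hence \<open>A\<close> is finite and \<open>N\<close> is a rank one operator
  \<open>k \<mapsto> \<langle>k, w\<rangle> e\<^sub>u\<close> with \<open>w \<in> \<ell>\<^sup>2(Y)\<close> and \<open>\<langle>e\<^sub>u, w\<rangle> = \<lambda>\<^sub>u\<^sub>u\<close>; and \<open>Y = {u}\<close> holds exactly when \<open>b = u\<close>.
  Everything else concerns a diagonal operator on \<open>\<ell>\<^sup>2(U)\<close>, a possibly unbounded functional \<open>\<phi>\<close>
  given by \<open>g\<close>, and a rank one operator on \<open>\<ell>\<^sup>2(Y)\<close>, for arbitrary disjoint sets \<open>U\<close> and \<open>Y\<close>.

  \<^bold>\<open>Point spectrum.\<close>  \<open>N\<close> has the eigenvalue \<open>\<lambda>\<^sub>u\<^sub>u\<close>, and also \<open>0\<close> as soon as \<open>Y\<close> has a second point; for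
  all other \<open>\<mu>\<close> the operator \<open>N - \<mu>\<close> has an explicit bounded inverse.  The eigenvalues of \<open>N\<close> are
  eigenvalues of \<open>W\<close>; for any other \<open>\<lambda>\<^sub>u\<^sub>v\<close> the vector \<open>e\<^sub>v\<close> becomes an eigenvector of \<open>W\<close> after adding
  the component of \<open>\<ell>\<^sup>2(Y)\<close> that solves the second row (\<open>point_spectrum_eq\<close>).

  \<^bold>\<open>Spectrum and resolvent.\<close>  Away from the closure of the point spectrum both diagonal entries of
  \<open>W - \<mu>\<close> are invertible, so \<open>W - \<mu>\<close> is inverted by back substitution.  The result is bounded as
  soon as \<open>\<phi> (D - \<mu>)\<inverse>\<close> is a bounded functional, that is, as soon as \<open>g / (\<lambda> - \<mu>)\<close> is square summable;
  under compatibility condition I this holds for every such \<open>\<mu>\<close> (\<open>resolvent_graph\<close>,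
  \<open>resolvent_bounded\<close>).  Conversely, a bounded inverse at one \<open>\<mu>\<close>, tested on finitely supported
  vectors, bounds the partial sums of \<open>|g|\<^sup>2 / |\<lambda> - \<mu>|\<^sup>2\<close> and so yields the condition
  (\<open>bounded_inverse_imp_compat_I\<close>).

  \<^bold>\<open>Essential spectrum and index.\<close>  Under condition I, \<open>W - \<mu>\<close> is Fredholm if and only if only
  finitely many diagonal entries equal \<open>\<mu>\<close>, the other entries stay away from \<open>\<mu>\<close>, and \<open>\<mu> \<noteq> 0\<close> or \<open>Y\<close> is finite
  (\<open>fredholm_iff\<close>).  If these conditions hold, composing \<open>W - \<mu>\<close> with an injective diagonal
  multiplier that maps \<open>\<ell>\<^sup>2(V)\<close> onto its domain turns it into a nonzero scalar plus a finite rank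
  operator, for which the Fredholm alternative gives closed range and index \<open>0\<close> (locale \<open>finite_rank_perturbation\<close>).  If \<open>\<mu>\<close> were an
  accumulation point of the diagonal entries, a limit of images of finitely supported vectors
  would leave the range (\<open>closed_range_isolated\<close>).  For empty \<open>Y\<close> the same criterion describes
  \<open>D\<close> itself, and comparing the two gives the formula for the essential spectrum.
\<close>

section \<open>Square summable functions\<close>

lemma ell2_iff:
  "h \<in> ell2 X \<longleftrightarrow> (\<forall>v. v \<notin> X \<longrightarrow> h v = 0) \<and> (\<lambda>v. (cmod (h v))\<^sup>2) summable_on UNIV"
proof -
  have "(\<lambda>v. (cmod (h v))\<^sup>2) summable_on UNIV \<longleftrightarrow> (\<lambda>v. (cmod (h v))\<^sup>2) summable_on X"
    if "\<forall>v. v \<notin> X \<longrightarrow> h v = 0"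
    by (rule summable_on_cong_neutral) (use that in auto)
  then show ?thesis by (auto simp: ell2_def)
qed

lemma ell2_outside: "h \<in> ell2 X \<Longrightarrow> v \<notin> X \<Longrightarrow> h v = 0"
  by (simp add: ell2_def)

lemma ell2_mono: "X \<subseteq> Y \<Longrightarrow> h \<in> ell2 X \<Longrightarrow> h \<in> ell2 Y"
  by (auto simp: ell2_iff)

lemma norm2_nonneg [simp]: "0 \<le> norm2 h"
  by (simp add: norm2_def infsum_nonneg)

lemma norm2_power2: "(norm2 h)\<^sup>2 = (\<Sum>\<^sub>\<infinity>v. (cmod (h v))\<^sup>2)"
  by (simp add: norm2_def infsum_nonneg)

text \<open>Nearly all memberships and norm bounds below come from this comparison.\<close>

lemma ell2_dominated:
  assumes h: "h \<in> ell2 X" and le: "\<And>v. cmod (k v) \<le> C * cmod (h v)" and C: "0 \<le> C"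
    and out: "\<And>v. v \<notin> Y \<Longrightarrow> k v = 0"
  shows "k \<in> ell2 Y" "norm2 k \<le> C * norm2 h"
proof -
  have le2: "(cmod (k v))\<^sup>2 \<le> C\<^sup>2 * (cmod (h v))\<^sup>2" for v
    using power_mono[OF le, of v 2] by (simp add: power_mult_distrib)
  have sm: "(\<lambda>v. C\<^sup>2 * (cmod (h v))\<^sup>2) summable_on UNIV"
    by (intro summable_on_cmult_right summable_norm2_ell2[OF h])
  have smk: "(\<lambda>v. (cmod (k v))\<^sup>2) summable_on UNIV"
    by (rule summable_on_comparison_test[OF sm]) (use le2 in auto)
  then show "k \<in> ell2 Y" using out by (simp add: ell2_iff)
  have "(norm2 k)\<^sup>2 \<le> (\<Sum>\<^sub>\<infinity>v. C\<^sup>2 * (cmod (h v))\<^sup>2)"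
    unfolding norm2_power2 by (rule infsum_mono[OF smk sm]) (use le2 in auto)
  also have "\<dots> = (C * norm2 h)\<^sup>2"
    by (simp add: power_mult_distrib norm2_power2 infsum_cmult_right')
  finally show "norm2 k \<le> C * norm2 h"
    by (rule power2_le_imp_le) (simp add: C)
qed

lemma ell2_zero: "0 \<in> ell2 X"
  by (simp add: ell2_def)

lemma ell2_scale: "h \<in> ell2 X \<Longrightarrow> c *\<^sub>c h \<in> ell2 X"
  by (rule ell2_dominated(1)[of h X _ "cmod c"]) (auto simp: cscale_def norm_mult ell2_outside)

lemma norm2_scale_le: "h \<in> ell2 X \<Longrightarrow> norm2 (c *\<^sub>c h) \<le> cmod c * norm2 h"
  by (rule ell2_dominated(2)[of h X _ "cmod c" X]) (auto simp: cscale_def norm_mult ell2_outside)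

lemmas ell2_add = norm2_triangle(1)
lemmas norm2_add_le = norm2_triangle(2)

lemma ell2_uminus: "h \<in> ell2 X \<Longrightarrow> - h \<in> ell2 X"
  by (auto simp: ell2_def)

lemma norm2_uminus: "norm2 (- h) = norm2 h"
  by (simp add: norm2_def)

lemma ell2_diff: "h \<in> ell2 X \<Longrightarrow> k \<in> ell2 X \<Longrightarrow> h - k \<in> ell2 X"
  using ell2_add[OF _ ell2_uminus, of h X k] by simp

lemma norm2_diff_le: "h \<in> ell2 X \<Longrightarrow> k \<in> ell2 X \<Longrightarrow> norm2 (h - k) \<le> norm2 h + norm2 k"
  using norm2_add_le[OF _ ell2_uminus, of h X k] by (simp add: norm2_uminus)

lemma norm2_minus_commute: "norm2 (h - k) = norm2 (k - h)"
  using norm2_uminus[of "h - k"] by simp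

lemma ell2_restrict: "h \<in> ell2 X \<Longrightarrow> (\<lambda>v. if v \<in> A then h v else 0) \<in> ell2 (X \<inter> A)"
  by (rule ell2_dominated(1)[of h X _ 1]) (auto simp: ell2_outside)

lemma norm2_restrict_le: "h \<in> ell2 X \<Longrightarrow> norm2 (\<lambda>v. if v \<in> A then h v else 0) \<le> norm2 h"
  using ell2_dominated(2)[of h X "\<lambda>v. if v \<in> A then h v else 0" 1 X]
  by (auto simp: ell2_outside)

lemma ell2_finite_support:
  assumes "finite F" "\<And>v. v \<notin> F \<Longrightarrow> h v = 0" "F \<subseteq> X"
  shows "h \<in> ell2 X" "(norm2 h)\<^sup>2 = (\<Sum>v\<in>F. (cmod (h v))\<^sup>2)"
proof -
  have "h \<in> ell2 F" using assms by (simp add: ell2_def)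
  then show "h \<in> ell2 X" using assms(3) ell2_mono by blast
  have "(\<Sum>\<^sub>\<infinity>v. (cmod (h v))\<^sup>2) = (\<Sum>\<^sub>\<infinity>v\<in>F. (cmod (h v))\<^sup>2)"
    by (rule infsum_cong_neutral) (use assms in auto)
  then show "(norm2 h)\<^sup>2 = (\<Sum>v\<in>F. (cmod (h v))\<^sup>2)"
    using assms(1) by (simp add: norm2_power2)
qed

lemma basis_vec_ell2: "v \<in> X \<Longrightarrow> basis_vec v \<in> ell2 X"
  by (rule ell2_finite_support(1)[of "{v}"]) (auto simp: basis_vec_def)

lemma norm2_eq_0: assumes "h \<in> ell2 X" "norm2 h = 0" shows "h = 0"
  using Metric_space.zero[OF Metric_space_ell2 assms(1) ell2_zero] assms(2) by simp

lemma norm2_pos: "h \<in> ell2 X \<Longrightarrow> h \<noteq> 0 \<Longrightarrow> 0 < norm2 h"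
  using norm2_eq_0[of h X] norm2_nonneg[of h] unfolding less_le by metis

lemma Cauchy_Schwarz_abs:
  assumes h: "h \<in> ell2 X" and k: "k \<in> ell2 Y"
  shows "(\<lambda>v. cmod (h v * cnj (k v))) summable_on A"
    "(\<Sum>\<^sub>\<infinity>v. cmod (h v * cnj (k v))) \<le> norm2 h * norm2 k"
proof -
  have L2: "L2_set (\<lambda>v. cmod (h v)) F \<le> norm2 h" if "finite F" "h \<in> ell2 X" for F h and X :: "'a set"
    unfolding L2_set_def norm2_def
    by (rule real_sqrt_le_mono, rule finite_sum_le_infsum) (use summable_norm2_ell2 that in auto)
  have bound: "(\<Sum>v\<in>F. cmod (h v * cnj (k v))) \<le> norm2 h * norm2 k" if F: "finite F" for F
  proof -
    have "(\<Sum>v\<in>F. cmod (h v * cnj (k v))) = (\<Sum>v\<in>F. \<bar>cmod (h v)\<bar> * \<bar>cmod (k v)\<bar>)"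
      by (simp add: norm_mult)
    also have "\<dots> \<le> L2_set (\<lambda>v. cmod (h v)) F * L2_set (\<lambda>v. cmod (k v)) F"
      by (rule L2_set_mult_ineq)
    also have "\<dots> \<le> norm2 h * norm2 k"
      by (intro mult_mono L2[OF F h] L2[OF F k]) auto
    finally show ?thesis .
  qed
  have sm: "(\<lambda>v. cmod (h v * cnj (k v))) summable_on A" for A
    by (rule nonneg_bdd_above_summable_on) (use bound in \<open>auto simp: bdd_above_def\<close>)
  then show "(\<lambda>v. cmod (h v * cnj (k v))) summable_on A" .
  show "(\<Sum>\<^sub>\<infinity>v. cmod (h v * cnj (k v))) \<le> norm2 h * norm2 k"
    by (rule infsum_le_finite_sums[OF sm]) (rule bound)
qed

lemma ell2_mult_summable:
  "h \<in> ell2 X \<Longrightarrow> k \<in> ell2 Y \<Longrightarrow> (\<lambda>v. h v * cnj (k v)) summable_on A"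
  by (rule abs_summable_summable[OF Cauchy_Schwarz_abs(1)])

lemma Cauchy_Schwarz:
  assumes h: "h \<in> ell2 X" and k: "k \<in> ell2 Y"
  shows "cmod (cinner2 h k) \<le> norm2 h * norm2 k"
  unfolding cinner2_def
  using norm_infsum_bound[OF Cauchy_Schwarz_abs(1)[OF h k, of UNIV]] Cauchy_Schwarz_abs(2)[OF h k]
  by simp

lemma cinner2_add_left:
  "h \<in> ell2 X \<Longrightarrow> h' \<in> ell2 X' \<Longrightarrow> k \<in> ell2 Y \<Longrightarrow> cinner2 (h + h') k = cinner2 h k + cinner2 h' k"
  unfolding cinner2_def plus_fun_apply distrib_right
  by (rule infsum_add) (auto intro: ell2_mult_summable)

lemma cinner2_scale_left: "cinner2 (c *\<^sub>c h) k = c * cinner2 h k"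
  by (simp add: cinner2_def cscale_def mult.assoc infsum_cmult_right')

lemma cinner2_commute: "cinner2 h k = cnj (cinner2 k h)"
  by (simp add: cinner2_def infsum_cnj[symmetric] mult.commute del: infsum_cnj)

lemma cinner2_uminus_left: "cinner2 (- h) k = - cinner2 h k"
  by (simp add: cinner2_def infsum_uminus)

lemma cinner2_diff_left:
  "h \<in> ell2 X \<Longrightarrow> h' \<in> ell2 X' \<Longrightarrow> k \<in> ell2 Y \<Longrightarrow> cinner2 (h - h') k = cinner2 h k - cinner2 h' k"
  using cinner2_add_left[OF _ ell2_uminus, of h X h' X' k Y] by (simp add: cinner2_uminus_left)

lemma cinner2_0_left [simp]: "cinner2 0 k = 0"
  by (simp add: cinner2_def)

lemma cinner2_self_eq_0:
  assumes h: "h \<in> ell2 X" and "cinner2 h h = 0"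
  shows "h = 0"
proof -
  have "cinner2 h h = (\<Sum>\<^sub>\<infinity>v. complex_of_real ((cmod (h v))\<^sup>2))"
    by (simp add: cinner2_def complex_norm_square del: of_real_power)
  also have "\<dots> = of_real ((norm2 h)\<^sup>2)"
    unfolding norm2_power2 
    by (rule infsumI, rule has_sum_of_real_iff[THEN iffD2], rule has_sum_infsum, rule summable_norm2_ell2[OF h])
  finally show ?thesis using assms norm2_eq_0[OF h] by simp
qed

lemma cinner2_basis_right: "cinner2 h (basis_vec v) = h v"
proof -
  have "cinner2 h (basis_vec v) = (\<Sum>\<^sub>\<infinity>w\<in>{v}. h w * cnj (basis_vec v w))"
    unfolding cinner2_def by (rule infsum_cong_neutral) (auto simp: basis_vec_def)
  then show ?thesis by (simp add: basis_vec_def)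
qed

lemma cinner2_cong:
  "(\<And>v. h v * cnj (k v) = h' v * cnj (k' v)) \<Longrightarrow> cinner2 h k = cinner2 h' k'"
  by (simp add: cinner2_def)

lemma cinner2_orthogonal_disjoint:
  "h \<in> ell2 X \<Longrightarrow> k \<in> ell2 Y \<Longrightarrow> X \<inter> Y = {} \<Longrightarrow> cinner2 h k = 0"
proof -
  assume "h \<in> ell2 X" "k \<in> ell2 Y" "X \<inter> Y = {}"
  then have "h v * cnj (k v) = 0" for v
    using ell2_outside[of h X v] ell2_outside[of k Y v] by auto
  then show ?thesis unfolding cinner2_def by (intro infsum_0) blast
qed

lemma orthogonal_complement_closed:
  assumes S: "S \<subseteq> ell2 X"
  shows "closed_in2 (ell2 X) {h \<in> ell2 X. \<forall>s\<in>S. cinner2 h s = 0}"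
proof -
  interpret M: Metric_space "ell2 X" "\<lambda>x y. norm2 (x - y)" by (rule Metric_space_ell2)
  have "h \<in> {h \<in> ell2 X. \<forall>s\<in>S. cinner2 h s = 0}"
    if r: "range \<sigma> \<subseteq> {h \<in> ell2 X. \<forall>s\<in>S. cinner2 h s = 0}"
      and lim: "limitin M.mtopology \<sigma> h sequentially" for \<sigma> h
  proof -
    have h: "h \<in> ell2 X" using lim M.limitin_mspace by blast
    have "cinner2 h s = 0" if s: "s \<in> S" for s
    proof -
      have "cmod (cinner2 h s) \<le> e * norm2 s" if e: "e > 0" for e
      proof -
        obtain n where n: "\<sigma> n \<in> ell2 X" "norm2 (\<sigma> n - h) < e"
          using lim e unfolding M.limitin_metric eventually_sequentially by blast
        have "cinner2 (\<sigma> n) s = 0" using r s by blast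
        have "cinner2 (h - \<sigma> n) s = cinner2 h s"
          using cinner2_diff_left[OF h n(1), of s X] s S
            \<open>cinner2 (\<sigma> n) s = 0\<close> by (simp add: subset_iff)
        then show ?thesis
          using Cauchy_Schwarz[OF ell2_diff[OF h n(1)], of s X] s S n(2)
            mult_right_mono[of "norm2 (\<sigma> n - h)" e "norm2 s"]
          by (auto simp: norm2_minus_commute[of h])
      qed
      note le = this
      have "cmod (cinner2 h s) \<le> 0"
      proof (rule field_le_epsilon)
        fix e :: real assume "e > 0"
        have pos: "0 < norm2 s + 1" using norm2_nonneg[of s] by linarith
        have "cmod (cinner2 h s) \<le> e / (norm2 s + 1) * norm2 s"
          by (rule le) (use \<open>e > 0\<close> pos in simp)
        also have "\<dots> \<le> e" using pos \<open>e > 0\<close> by (simp add: field_simps)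
        finally show "cmod (cinner2 h s) \<le> 0 + e" by simp
      qed
      then show ?thesis by simp
    qed
    then show ?thesis using h by simp
  qed
  then show ?thesis
    unfolding closed_in2_def M.metric_closedin_iff_sequentially_closed by blast
qed

lemma closed_in2_limit:
  assumes cl: "closed_in2 (ell2 X) R" and h: "h \<in> ell2 X"
    and approx: "\<And>e. e > 0 \<Longrightarrow> \<exists>r\<in>R. norm2 (r - h) < e"
  shows "h \<in> R"
proof -
  interpret M: Metric_space "ell2 X" "\<lambda>x y. norm2 (x - y)" by (rule Metric_space_ell2)
  have R: "R \<subseteq> ell2 X" using cl closedin_subset unfolding closed_in2_def by fastforce
  show ?thesis
  proof (rule ccontr)
    assume "h \<notin> R"
    then obtain e where "e > 0" "disjnt R (M.mball h e)"
      using cl h unfolding closed_in2_def M.closedin_metric by (metis DiffI disjnt_sym)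
    moreover obtain r where "r \<in> R" "norm2 (r - h) < e" using approx \<open>e > 0\<close> by blast
    ultimately show False
      using R h by (auto simp: disjnt_iff norm2_minus_commute[of r])
  qed
qed



section \<open>Finite rank perturbations of scalar operators\<close>

lemma subspace_ell2: "cfun.subspace (ell2 X)"
  by (simp add: cfun.subspace_def ell2_zero ell2_add ell2_scale)

lemma span_ell2: "S \<subseteq> ell2 X \<Longrightarrow> cfun.span S \<subseteq> ell2 X"
  by (rule cfun.span_minimal[OF _ subspace_ell2])

lemma orthogonal_span:
  assumes h: "h \<in> ell2 X" and S: "S \<subseteq> ell2 X" and perp: "\<And>s. s \<in> S \<Longrightarrow> cinner2 h s = 0"
    and r: "r \<in> cfun.span S"
  shows "cinner2 h r = 0"
proof -
  have "cfun.subspace {r \<in> ell2 X. cinner2 r h = 0}"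
    by (auto simp: cfun.subspace_def ell2_zero ell2_add ell2_scale cinner2_scale_left
        cinner2_add_left[OF _ _ h])
  moreover have "S \<subseteq> {r \<in> ell2 X. cinner2 r h = 0}"
    using S perp by (auto simp: cinner2_commute[of _ h])
  ultimately have "r \<in> {r \<in> ell2 X. cinner2 r h = 0}"
    using cfun.span_minimal r by blast
  then show ?thesis using cinner2_commute[of h r] by simp
qed

text \<open>
  Gram-Schmidt: one generator is added at a time, and only its component orthogonal to the
  earlier ones matters.
\<close>

lemma orthogonal_projection_on_span:
  assumes "finite S" "S \<subseteq> ell2 X" "h \<in> ell2 X"
  shows "\<exists>r\<in>cfun.span S. \<forall>s\<in>cfun.span S. cinner2 (h - r) s = 0"
proof -
  have "\<exists>r\<in>cfun.span S. \<forall>s\<in>S. cinner2 (h - r) s = 0"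
    using assms
  proof (induction S arbitrary: h rule: finite_induct)
    case empty
    show ?case using cfun.span_zero by auto
  next
    case (insert y S)
    have S: "S \<subseteq> ell2 X" and y: "y \<in> ell2 X" and h: "h \<in> ell2 X" using insert.prems by auto
    obtain r where r: "r \<in> cfun.span S" "\<forall>s\<in>S. cinner2 (h - r) s = 0"
      using insert.IH[OF S h] by blast
    obtain q where q: "q \<in> cfun.span S" "\<forall>s\<in>S. cinner2 (y - q) s = 0"
      using insert.IH[OF S y] by blast
    have r2: "r \<in> ell2 X" and q2: "q \<in> ell2 X" using r q span_ell2[OF S] by auto
    define z where "z = y - q"
    define p where "p = h - r"
    have z: "z \<in> ell2 X" and p: "p \<in> ell2 X"
      using z_def p_def y q2 h r2 ell2_diff by auto
    \<comment> \<open>When \<open>y\<close> already lies in the span of \<open>S\<close>, \<open>z = 0\<close> and this coefficient is 0 by \<open>x / 0 = 0\<close>.\<close>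
    define t where "t = cinner2 p z / cinner2 z z"
    have split: "cinner2 (p - t *\<^sub>c z) s = cinner2 p s - t * cinner2 z s" if "s \<in> ell2 X" for s
      using cinner2_diff_left[OF p ell2_scale[OF z] that] by (simp add: cinner2_scale_left)
    have perpS: "cinner2 (p - t *\<^sub>c z) s = 0" if "s \<in> S" for s
      using split[of s] that S r(2) q(2) by (auto simp: p_def z_def)
    have "cinner2 (p - t *\<^sub>c z) z = 0"
    proof (cases "cinner2 z z = 0")
      case True
      then have "z = 0" by (rule cinner2_self_eq_0[OF z])
      then show ?thesis by (simp add: cinner2_def)
    next
      case False
      then show ?thesis using split[OF z] by (simp add: t_def)
    qed
    moreover have "cinner2 (p - t *\<^sub>c z) q = 0"
      by (rule orthogonal_span[OF _ S perpS q(1)]) (simp_all add: ell2_diff ell2_scale p z)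
    ultimately have "cinner2 (z + q) (p - t *\<^sub>c z) = 0"
      by (subst cinner2_add_left[OF z q2, of _ X])
        (simp_all add: ell2_diff ell2_scale p z cinner2_commute[of _ "p - t *\<^sub>c z"])
    then have perpy: "cinner2 (p - t *\<^sub>c z) y = 0"
      by (subst cinner2_commute) (simp add: z_def)
    have "r + t *\<^sub>c z \<in> cfun.span (insert y S)"
      unfolding z_def using r(1) q(1)
      by (intro cfun.span_add cfun.span_scale cfun.span_diff)
        (auto intro: cfun.span_base cfun.span_mono[THEN subsetD, of S])
    moreover have "h - (r + t *\<^sub>c z) = p - t *\<^sub>c z" by (simp add: p_def)
    ultimately show ?case using perpS perpy by (intro bexI[of _ "r + t *\<^sub>c z"]) (simp_all only: ball_simps simp_thms Ball_def, blast)
  qed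
  then obtain r where r: "r \<in> cfun.span S" "\<forall>s\<in>S. cinner2 (h - r) s = 0" by blast
  then have "\<forall>s\<in>cfun.span S. cinner2 (h - r) s = 0"
    using orthogonal_span[OF ell2_diff[OF assms(3)] assms(2)] span_ell2[OF assms(2)] by blast
  with r show ?thesis by blast
qed

text \<open>
  Linearity is demanded on a subspace only: on all functions it can fail even for
  \<open>h \<mapsto> cinner2 h k\<close>, whose defining sum may diverge and is then \<open>0\<close>.
\<close>

definition linear_on :: "('v \<Rightarrow> complex) set \<Rightarrow> (('v \<Rightarrow> complex) \<Rightarrow> ('v \<Rightarrow> complex)) \<Rightarrow> bool" where
  "linear_on A T \<longleftrightarrow> (\<forall>x\<in>A. \<forall>y\<in>A. \<forall>c. T (c *\<^sub>c x + y) = c *\<^sub>c T x + T y)"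

lemma linear_onD:
  assumes "linear_on A T" "cfun.subspace A"
  shows "T 0 = 0" "x \<in> A \<Longrightarrow> y \<in> A \<Longrightarrow> T (x + y) = T x + T y"
    "x \<in> A \<Longrightarrow> T (c *\<^sub>c x) = c *\<^sub>c T x"
proof -
  have A: "T (c *\<^sub>c x + y) = c *\<^sub>c T x + T y" if "x \<in> A" "y \<in> A" for x y c
    using that assms by (simp add: linear_on_def)
  have 0: "0 \<in> A" using assms(2) by (simp add: cfun.subspace_def)
  show T0: "T 0 = 0" using A[OF 0 0, of 1] by simp
  show "x \<in> A \<Longrightarrow> y \<in> A \<Longrightarrow> T (x + y) = T x + T y" using A[of x y 1] by simp
  show "x \<in> A \<Longrightarrow> T (c *\<^sub>c x) = c *\<^sub>c T x" using A[of x 0 c] 0 T0 by simp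
qed

lemma linear_on_image_span:
  assumes T: "linear_on A T" and A: "cfun.subspace A" and S: "S \<subseteq> A"
  shows "T ` cfun.span S = cfun.span (T ` S)"
proof
  note D = linear_onD[OF T A]
  have sp: "cfun.span S \<subseteq> A" using S A by (rule cfun.span_minimal)
  show "T ` cfun.span S \<subseteq> cfun.span (T ` S)"
  proof clarify
    fix x assume x: "x \<in> cfun.span S"
    then have "x \<in> A \<and> T x \<in> cfun.span (T ` S)"
    proof (induction rule: cfun.span_induct_alt)
      case base
      show ?case unfolding D(1) using A[unfolded cfun.subspace_def] cfun.span_zero by blast
    next
      case (step c x y)
      then have "x \<in> A" "y \<in> A" using S by auto
      then have "T (c *\<^sub>c x + y) = c *\<^sub>c T x + T y" "c *\<^sub>c x + y \<in> A"
        using T A by (simp_all add: linear_on_def cfun.subspace_def)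
      moreover have "c *\<^sub>c T x + T y \<in> cfun.span (T ` S)"
        using step by (intro cfun.span_add cfun.span_scale) (simp_all add: cfun.span_base)
      ultimately show ?case by (simp only: simp_thms)
    qed
    then show "T x \<in> cfun.span (T ` S)" ..

  qed
  have "cfun.subspace (T ` cfun.span S)"
    unfolding cfun.subspace_def
  proof (intro conjI ballI allI)
    show "0 \<in> T ` cfun.span S" using D(1) cfun.span_zero by (metis imageI)
    fix x assume "x \<in> T ` cfun.span S"
    then obtain x' where x': "x' \<in> cfun.span S" "x = T x'" by blast
    { fix c show "c *\<^sub>c x \<in> T ` cfun.span S"
        using x' D(3)[of x' c] sp cfun.span_scale by (metis imageI subsetD) }
    { fix y assume "y \<in> T ` cfun.span S"
      then obtain y' where y': "y' \<in> cfun.span S" "y = T y'" by blast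
      show "x + y \<in> T ` cfun.span S"
        using x' y' D(2)[of x' y'] sp cfun.span_add by (metis imageI subsetD) }
  qed
  then show "cfun.span (T ` S) \<subseteq> T ` cfun.span S"
    by (intro cfun.span_minimal) (auto intro: cfun.span_base)
qed

text \<open>
  The Fredholm alternative for \<open>B = c + F\<close> with \<open>F\<close> of finite rank and \<open>c \<noteq> 0\<close>, with the adjoint \<open>B'\<close>
  given in advance.  The span of \<open>S\<close> contains the ranges of \<open>F\<close> and of its adjoint; it is invariant
  under both operators and contains both kernels, so that all questions are about this finite
  dimensional space.
\<close>

locale finite_rank_perturbation =
  fixes X :: "'v set" and B B' :: "('v \<Rightarrow> complex) \<Rightarrow> ('v \<Rightarrow> complex)"
    and S :: "('v \<Rightarrow> complex) set" and c :: complex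
  assumes B: "B ` ell2 X \<subseteq> ell2 X" "linear_on (ell2 X) B"
    and B': "B' ` ell2 X \<subseteq> ell2 X" "linear_on (ell2 X) B'"
    and adj: "\<And>h k. h \<in> ell2 X \<Longrightarrow> k \<in> ell2 X \<Longrightarrow> cinner2 (B h) k = cinner2 h (B' k)"
    and S: "finite S" "S \<subseteq> ell2 X"
    and c: "c \<noteq> 0"
    and BS: "\<And>h. h \<in> ell2 X \<Longrightarrow> B h - c *\<^sub>c h \<in> cfun.span S"
    and B'S: "\<And>h. h \<in> ell2 X \<Longrightarrow> B' h - cnj c *\<^sub>c h \<in> cfun.span S"
begin

lemma swap: "finite_rank_perturbation X B' B S (cnj c)"
proof
  fix h k assume hk: "h \<in> ell2 X" "k \<in> ell2 X"
  show "cinner2 (B' h) k = cinner2 h (B k)"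
    using adj[OF hk(2,1)] by (subst (1 2) cinner2_commute) simp
qed (use B B' S c BS B'S in auto)

lemma span_in: "m \<in> cfun.span S \<Longrightarrow> m \<in> ell2 X"
  using span_ell2[OF S(2)] by auto

lemma invariant: "m \<in> cfun.span S \<Longrightarrow> B m \<in> cfun.span S"
  using cfun.span_add[OF BS[OF span_in] cfun.span_scale[of m S c], of m]
  by (simp only: diff_add_cancel)

lemma kernel_subset_span:
  assumes "h \<in> ell2 X" "B h = 0" shows "h \<in> cfun.span S"
proof -
  have "(- 1 / c) *\<^sub>c (B h - c *\<^sub>c h) \<in> cfun.span S" using BS[OF assms(1)] by (rule cfun.span_scale)
  moreover have "(- 1 / c) *\<^sub>c (B h - c *\<^sub>c h) = h"
    using c assms(2) by (simp add: cscale_def fun_eq_iff)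
  ultimately show ?thesis by simp
qed

text \<open>
  A vector of the span of \<open>S\<close> that is orthogonal to the range of \<open>B\<close> on this invariant space is
  annihilated by the adjoint, so projecting onto that range splits the span.
\<close>

lemma orthogonal_decomposition:
  assumes m: "m \<in> cfun.span S"
  obtains r p where "r \<in> B ` cfun.span S" "p \<in> cfun.span S" "B' p = 0" "cinner2 p r = 0" "m = r + p"
proof -
  interpret sw: finite_rank_perturbation X B' B S "cnj c" by (rule swap)
  have im: "B ` cfun.span S = cfun.span (B ` S)"
    by (rule linear_on_image_span[OF B(2) subspace_ell2 S(2)])
  have BSX: "B ` S \<subseteq> ell2 X" using B(1) S(2) by blast
  obtain r where r: "r \<in> cfun.span (B ` S)"
    and perp: "\<And>s. s \<in> cfun.span (B ` S) \<Longrightarrow> cinner2 (m - r) s = 0"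
    using orthogonal_projection_on_span[OF finite_imageI[OF S(1)] BSX span_in[OF m]] by blast
  have "r \<in> cfun.span S" using r invariant unfolding im[symmetric] by blast
  then have p: "m - r \<in> cfun.span S" using m cfun.span_diff by blast
  \<comment> \<open>\<open>m - r\<close> is orthogonal to the range of \<open>B\<close> on an invariant space, so its image under the
    adjoint is orthogonal to itself.\<close>
  have B'p: "B' (m - r) \<in> cfun.span S" by (rule sw.invariant[OF p])
  have "cinner2 (m - r) (B (B' (m - r))) = 0" using perp B'p unfolding im[symmetric] by blast
  then have "cinner2 (B' (m - r)) (B' (m - r)) = 0"
    using sw.adj[OF span_in[OF p] span_in[OF B'p]] by simp
  then have "B' (m - r) = 0" by (rule cinner2_self_eq_0[OF span_in[OF B'p]])
  with that[of r "m - r"] r p perp im show ?thesis by auto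
qed

text \<open>
  On the complement of the span of \<open>S\<close> the operator \<open>B\<close> is the scalar \<open>c\<close>, hence onto there;
  within the span the decomposition above applies.  Closedness of the range is a consequence,
  orthogonal complements being closed.
\<close>

lemma range_eq: "B ` ell2 X = {h \<in> ell2 X. \<forall>k\<in>{k \<in> ell2 X. B' k = 0}. cinner2 h k = 0}"
proof (intro equalityI subsetI)
  fix h assume "h \<in> B ` ell2 X"
  then obtain h' where h': "h' \<in> ell2 X" "h = B h'" by blast
  have "cinner2 h' 0 = 0" by (simp add: cinner2_def)
  then show "h \<in> {h \<in> ell2 X. \<forall>k\<in>{k \<in> ell2 X. B' k = 0}. cinner2 h k = 0}"
    using B(1) h' adj[OF h'(1)] by auto
next
  fix h assume "h \<in> {h \<in> ell2 X. \<forall>k\<in>{k \<in> ell2 X. B' k = 0}. cinner2 h k = 0}"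
  then have h: "h \<in> ell2 X" and perp: "\<And>k. k \<in> ell2 X \<Longrightarrow> B' k = 0 \<Longrightarrow> cinner2 h k = 0" by auto
  interpret sw: finite_rank_perturbation X B' B S "cnj c" by (rule swap)
  obtain m where m: "m \<in> cfun.span S" and q: "\<And>s. s \<in> cfun.span S \<Longrightarrow> cinner2 (h - m) s = 0"
    using orthogonal_projection_on_span[OF S h] by blast
  define q where "q = h - m"
  have q2: "q \<in> ell2 X" unfolding q_def by (rule ell2_diff[OF h span_in[OF m]])
  define z where "z = B q - c *\<^sub>c q"
  have z: "z \<in> cfun.span S" unfolding z_def by (rule BS[OF q2])
  \<comment> \<open>On the complement of the span, \<open>B\<close> is the scalar \<open>c\<close>.\<close>
  have "cinner2 z z = cinner2 (B q) z - c * cinner2 q z"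
    unfolding z_def[THEN arg_cong[where f = "\<lambda>y. cinner2 y z"]]
    using cinner2_diff_left[OF _ ell2_scale[OF q2] span_in[OF z], of "B q" X c] B(1) q2
    by (auto simp: cinner2_scale_left)
  also have "cinner2 (B q) z = cinner2 q (B' z)" by (rule adj[OF q2 span_in[OF z]])
  finally have "cinner2 z z = 0"
    unfolding q_def by (simp only: q[OF z] q[OF sw.invariant[OF z]] mult_zero_right diff_self)
  then have "z = 0" by (rule cinner2_self_eq_0[OF span_in[OF z]])
  then have Bq: "B ((1 / c) *\<^sub>c q) = q"
    using linear_onD(3)[OF B(2) subspace_ell2 q2, of "1 / c"] c
    by (simp add: z_def cfun.scale_scale)
  obtain r p where rp: "r \<in> B ` cfun.span S" "p \<in> cfun.span S" "B' p = 0" "cinner2 p r = 0" "m = r + p"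
    by (rule orthogonal_decomposition[OF m])
  obtain r' where r': "r' \<in> cfun.span S" "r = B r'" using rp(1) by blast
  have p2: "p \<in> ell2 X" and r2: "r \<in> ell2 X" using rp span_in r' invariant by auto
  have p_eq: "p = h - q - r" using rp(5) by (simp add: q_def)
  have "cinner2 (h - q - r) p = cinner2 h p - cinner2 q p - cinner2 r p"
    by (simp add: cinner2_diff_left[of _ X _ X _ X] ell2_diff h q2 r2 p2)
  also have "\<dots> = 0"
    using perp[OF p2 rp(3)] q[OF rp(2)] rp(4) cinner2_commute[of r p] by (simp add: q_def)
  finally have "cinner2 p p = 0" by (simp add: p_eq[symmetric])
  then have "p = 0" by (rule cinner2_self_eq_0[OF p2])
  then have "h = B ((1 / c) *\<^sub>c q) + B r'" using Bq rp(5) r' by (simp add: q_def)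
  also have "\<dots> = B ((1 / c) *\<^sub>c q + r')"
    using linear_onD(2)[OF B(2) subspace_ell2] q2 ell2_scale span_in[OF r'(1)] by metis
  finally show "h \<in> B ` ell2 X"
    using q2 ell2_scale ell2_add span_in[OF r'(1)] by (metis imageI)
qed

lemma finite_dim_kernel: "finite_dim {h \<in> ell2 X. B h = 0}"
  using kernel_subset_span S(1) unfolding finite_dim_def by blast

text \<open>
  Extend a basis \<open>C\<close> of the kernel to a basis \<open>D\<close> of the span of \<open>S\<close>.  The images of \<open>D - C\<close> span the
  range of \<open>B\<close> there, and together with the kernel of the adjoint they span everything, so that
  \<open>card D \<le> card (D - C) + dim (ker B')\<close>.  Equality of the two dimensions follows by symmetry.
\<close>

lemma dim_kernel_le: "cfun.dim {h \<in> ell2 X. B h = 0} \<le> cfun.dim {h \<in> ell2 X. B' h = 0}"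
proof -
  interpret sw: finite_rank_perturbation X B' B S "cnj c" by (rule swap)
  let ?K = "{h \<in> ell2 X. B h = 0}" and ?K' = "{h \<in> ell2 X. B' h = 0}"
  obtain C where C: "C \<subseteq> ?K" "cfun.independent C" "?K \<subseteq> cfun.span C" "card C = cfun.dim ?K"
    by (rule cfun.basis_exists)
  obtain G where G: "G \<subseteq> ?K'" "cfun.independent G" "?K' \<subseteq> cfun.span G" "card G = cfun.dim ?K'"
    by (rule cfun.basis_exists)
  have CS: "C \<subseteq> cfun.span S" using C(1) kernel_subset_span by blast
  obtain D where D: "C \<subseteq> D" "D \<subseteq> cfun.span S" "cfun.independent D" "cfun.span S \<subseteq> cfun.span D"
    using cfun.maximal_independent_subset_extend[OF CS C(2)] by blast
  have finD: "finite D" using cfun.independent_span_bound[OF S(1) D(3,2)] by blast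
  have "G \<subseteq> cfun.span S" using G(1) sw.kernel_subset_span by blast
  then have finG: "finite G" using cfun.independent_span_bound[OF S(1) G(2)] by blast
  have DX: "D \<subseteq> ell2 X" using D(2) span_in by blast
  let ?T = "B ` (D - C) \<union> G"
  have "D \<subseteq> cfun.span ?T"
  proof
    fix d assume "d \<in> D"
    then have "d \<in> cfun.span S" using D(2) by blast
    then obtain r p where rp: "r \<in> B ` cfun.span S" "p \<in> cfun.span S" "B' p = 0" "d = r + p"
      by (rule orthogonal_decomposition)
    have "B ` D \<subseteq> insert 0 (B ` (D - C))" using C(1) by blast
    then have "cfun.span (B ` D) \<subseteq> cfun.span (B ` (D - C))"
      using cfun.span_mono[of "B ` D" "insert 0 (B ` (D - C))"] by (simp only: cfun.span_insert_0)
    then have "r \<in> cfun.span (B ` (D - C))"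
      using rp(1) D(4) unfolding linear_on_image_span[OF B(2) subspace_ell2 DX, symmetric] by blast
    then have "r \<in> cfun.span ?T" using cfun.span_mono[of "B ` (D - C)" ?T] by blast
    moreover have "p \<in> cfun.span ?T"
    proof -
      have "p \<in> ?K'" using rp(2,3) span_in by simp
      then show ?thesis using G(3) cfun.span_mono[of G ?T] by blast
    qed
    ultimately show "d \<in> cfun.span ?T" unfolding rp(4) by (rule cfun.span_add)
  qed
  then have "card D \<le> card ?T"
    using cfun.independent_span_bound[OF _ D(3), of ?T] finD finG by blast
  also have "\<dots> \<le> card (D - C) + card G"
    using card_Un_le[of "B ` (D - C)" G] card_image_le[of "D - C" B] finD by force
  also have "card (D - C) = card D - card C"
    using finD D(1) by (intro card_Diff_subset) (auto intro: finite_subset)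
  finally show ?thesis using card_mono[OF finD D(1)] C(4) G(4) by linarith
qed

lemma dim_kernel_eq: "cfun.dim {h \<in> ell2 X. B h = 0} = cfun.dim {h \<in> ell2 X. B' h = 0}"
  using dim_kernel_le finite_rank_perturbation.dim_kernel_le[OF swap] by (rule antisym)

end

lemma basis_vec_independent: "cfun.independent (basis_vec ` (X :: 'v set))"
proof
  assume "cfun.dependent (basis_vec ` X)"
  then obtain v where v: "v \<in> X" and sp: "basis_vec v \<in> cfun.span (basis_vec ` X - {basis_vec v})"
    unfolding cfun.dependent_def by blast
  have "cfun.subspace {h :: 'v \<Rightarrow> complex. h v = 0}"
    by (simp add: cfun.subspace_def cscale_def)
  moreover have "basis_vec ` X - {basis_vec v} \<subseteq> {h. h v = 0}"
    by (auto simp: basis_vec_def fun_eq_iff)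
  ultimately have "cfun.span (basis_vec ` X - {basis_vec v}) \<subseteq> {h. h v = 0}"
    by (intro cfun.span_minimal)
  then have "basis_vec v \<in> {h. h v = 0}" using sp by blast
  then show False by (simp add: basis_vec_def)
qed

lemma finite_support_in_span:
  assumes "finite P"
  shows "(\<lambda>v. if v \<in> P then h v else 0) \<in> cfun.span (basis_vec ` P)"
  using assms
proof (induction P)
  case empty
  have "(\<lambda>v. if v \<in> {} then h v else 0) = 0" by (simp add: fun_eq_iff)
  then show ?case using cfun.span_zero by metis
next
  case (insert a P)
  have "(\<lambda>v. if v \<in> P then h v else 0) \<in> cfun.span (basis_vec ` insert a P)"
    using insert.IH cfun.span_mono[of "basis_vec ` P" "basis_vec ` insert a P"] by (auto simp: subset_iff)
  moreover have "h a *\<^sub>c basis_vec a \<in> cfun.span (basis_vec ` insert a P)"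
    by (intro cfun.span_scale cfun.span_base) simp
  moreover have "(\<lambda>v. if v \<in> insert a P then h v else 0)
      = h a *\<^sub>c basis_vec a + (\<lambda>v. if v \<in> P then h v else 0)"
    using insert.hyps by (auto simp: fun_eq_iff cscale_def basis_vec_def)
  ultimately show ?case by (simp only: cfun.span_add)
qed

lemma finite_dim_basis_vecs:
  assumes "finite_dim A" "basis_vec ` X \<subseteq> A"
  shows "finite X"
proof -
  obtain B where B: "finite B" "A \<subseteq> cfun.span B" using assms(1) unfolding finite_dim_def by blast
  have "finite (basis_vec ` X)"
    using cfun.independent_span_bound[OF B(1) basis_vec_independent] B(2) assms(2) by blast
  moreover have "inj_on basis_vec X"
    by (auto simp: inj_on_def basis_vec_def fun_eq_iff split: if_splits)
  ultimately show ?thesis using finite_imageD by blast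
qed

lemma finite_dim_ell2_iff: "finite_dim (ell2 X) \<longleftrightarrow> finite X"
proof
  assume "finite_dim (ell2 X)"
  then show "finite X" by (rule finite_dim_basis_vecs) (auto intro: basis_vec_ell2)
next
  assume X: "finite X"
  have "h \<in> cfun.span (basis_vec ` X)" if "h \<in> ell2 X" for h
  proof -
    have "h = (\<lambda>v. if v \<in> X then h v else 0)" using that by (auto simp: ell2_outside)
    then show ?thesis using finite_support_in_span[OF X, of h] by simp
  qed
  then show "finite_dim (ell2 X)" using X unfolding finite_dim_def by blast
qed

lemma dim_image_injective:
  assumes J: "Vector_Spaces.linear cscale cscale J" "inj J" and A: "finite_dim A"
  shows "finite_dim (J ` A)" "cfun.dim (J ` A) = cfun.dim A"
proof -
  interpret J: Vector_Spaces.linear cscale cscale J by (rule J(1))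
  obtain B where B: "B \<subseteq> A" "cfun.independent B" "A \<subseteq> cfun.span B" "card B = cfun.dim A"
    by (rule cfun.basis_exists)
  obtain B0 where B0: "finite B0" "A \<subseteq> cfun.span B0" using A unfolding finite_dim_def by blast
  have "finite B" using cfun.independent_span_bound[OF B0(1) B(2)] B(1) B0(2) by blast
  moreover have sp: "J ` A \<subseteq> cfun.span (J ` B)" using B(3) J.span_image by blast
  ultimately show "finite_dim (J ` A)" unfolding finite_dim_def by blast
  have "cfun.independent (J ` B)" using J.independent_injective_image[OF B(2) inj_on_subset[OF J(2)]] by blast
  moreover have "card (J ` B) = card B" using J(2) by (intro card_image) (auto simp: inj_def inj_on_def)
  ultimately show "cfun.dim (J ` A) = cfun.dim A"
    using cfun.dim_unique[OF _ sp] B(1,4) by auto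
qed



section \<open>Block operators with a diagonal and a rank one corner\<close>

text \<open>
  Condition I says that \<open>g / (\<lambda> - \<mu>\<^sub>0)\<close> is square summable for one \<open>\<mu>\<^sub>0\<close>.  A bounded multiplier \<open>m\<close>
  for which \<open>m (\<lambda> - \<mu>)\<close> is bounded also has \<open>m (\<lambda> - \<mu>\<^sub>0)\<close> bounded, whatever \<open>\<mu>\<close> is, so that \<open>m g\<close> is
  square summable.  This frees the condition from the particular point \<open>\<mu>\<^sub>0\<close>.
\<close>

lemma compat_I_weighted_ell2:
  assumes "compat_I U lam g"
    and m: "\<And>v. v \<in> U \<Longrightarrow> cmod (m v) \<le> C" "\<And>v. v \<in> U \<Longrightarrow> cmod (m v) * cmod (lam v - \<mu>) \<le> C'"
  shows "(\<lambda>v. if v \<in> U then m v * g v else 0) \<in> ell2 U"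
proof (cases "U = {}")
  case True
  then show ?thesis by (simp add: ell2_def)
next
  case False
  obtain \<mu>0 where inf: "(INF v\<in>U. ereal (cmod (\<mu>0 - lam v))) > 0"
    and sm: "(\<lambda>v. (cmod (g v))\<^sup>2 / (cmod (lam v - \<mu>0))\<^sup>2) summable_on U"
    using assms(1) unfolding compat_I_def by blast
  have pos: "cmod (lam v - \<mu>0) > 0" if "v \<in> U" for v
    using less_le_trans[OF inf INF_lower[OF that]] by (auto simp: norm_minus_commute)
  define q where "q = (\<lambda>v. if v \<in> U then g v / (lam v - \<mu>0) else 0)"
  have "(\<lambda>v. (cmod (q v))\<^sup>2) summable_on U \<longleftrightarrow>
      (\<lambda>v. (cmod (g v))\<^sup>2 / (cmod (lam v - \<mu>0))\<^sup>2) summable_on U"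
    by (rule summable_on_cong) (simp add: q_def norm_divide power_divide)
  then have q: "q \<in> ell2 U" using sm by (auto simp: ell2_def q_def)
  obtain v0 where "v0 \<in> U" using False by blast
  then have C: "0 \<le> C" "0 \<le> C'"
    using order_trans[OF norm_ge_zero m(1)[of v0]]
      order_trans[OF mult_nonneg_nonneg[OF norm_ge_zero norm_ge_zero] m(2)[of v0]] by auto
  show ?thesis
  proof (rule ell2_dominated(1)[OF q])
    show "cmod (if v \<in> U then m v * g v else 0) \<le> (C' + C * cmod (\<mu> - \<mu>0)) * cmod (q v)" for v
    proof (cases "v \<in> U")
      case True
      have "cmod (m v) * cmod (lam v - \<mu>0) \<le> cmod (m v) * (cmod (lam v - \<mu>) + cmod (\<mu> - \<mu>0))"
        using norm_triangle_ineq[of "lam v - \<mu>" "\<mu> - \<mu>0"] by (intro mult_left_mono) auto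
      also have "\<dots> \<le> C' + C * cmod (\<mu> - \<mu>0)"
        using m[OF True] mult_right_mono[OF m(1)[OF True], of "cmod (\<mu> - \<mu>0)"]
        by (simp add: distrib_left)
      finally have "cmod (m v) * cmod (lam v - \<mu>0) * cmod (q v) \<le> (C' + C * cmod (\<mu> - \<mu>0)) * cmod (q v)"
        by (rule mult_right_mono) simp
      moreover have "cmod (lam v - \<mu>0) * cmod (q v) = cmod (g v)"
        using True pos[OF True] by (simp add: q_def norm_divide)
      ultimately show ?thesis using True by (simp add: norm_mult mult.assoc)
    qed (use C in simp)
    show "0 \<le> C' + C * cmod (\<mu> - \<mu>0)" using C by simp
  qed simp
qed

text \<open>
  The operator matrix with diagonal entry \<open>D\<close> on \<open>\<ell>\<^sup>2(U)\<close>, corner \<open>f \<oslash> g\<close>, and a rank one operator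
  \<open>k \<mapsto> \<langle>k, w\<rangle> x\<close> on \<open>\<ell>\<^sup>2(Y)\<close>.  The vector \<open>x\<close> is left general because \<open>Y = {}\<close>, with \<open>x = 0\<close>, gives back
  the diagonal operator alone.
\<close>

locale rank_one_block =
  fixes U Y :: "'v set" and lam f g x w :: "'v \<Rightarrow> complex"
  assumes disjoint: "U \<inter> Y = {}" and f: "f \<in> ell2 Y" and x: "x \<in> ell2 Y" and w: "w \<in> ell2 Y"
begin

definition W :: "'v oper" where
  "W = lower_block (diag_oper U lam) (oslash_oper U f g) (rank_one_oper (ell2 Y) x w)"

definition dom :: "('v \<Rightarrow> complex) set" where
  "dom = {a \<in> ell2 (U \<union> Y). (\<lambda>v. if v \<in> U then lam v * a v else 0) \<in> ell2 U
     \<and> (\<lambda>v. a v * cnj (g v)) summable_on U}"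

definition functional :: "('v \<Rightarrow> complex) \<Rightarrow> complex" where
  "functional a = (\<Sum>\<^sub>\<infinity>v\<in>U. a v * cnj (g v))"

definition act :: "('v \<Rightarrow> complex) \<Rightarrow> 'v \<Rightarrow> complex" where
  "act a = (\<lambda>v. if v \<in> U then lam v * a v else functional a * f v + cinner2 a w * x v)"

definition restrict_Y :: "('v \<Rightarrow> complex) \<Rightarrow> 'v \<Rightarrow> complex" where
  "restrict_Y a = (\<lambda>v. if v \<in> Y then a v else 0)"

definition restrict_U :: "('v \<Rightarrow> complex) \<Rightarrow> 'v \<Rightarrow> complex" where
  "restrict_U a = (\<lambda>v. if v \<in> U then a v else 0)"

lemma outside_Y: "v \<notin> Y \<Longrightarrow> f v = 0" "v \<notin> Y \<Longrightarrow> x v = 0" "v \<notin> Y \<Longrightarrow> w v = 0"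
  by (erule ell2_outside[OF f] ell2_outside[OF x] ell2_outside[OF w])+

lemma on_U: "v \<in> U \<Longrightarrow> v \<notin> Y"
  using disjoint by blast

lemma restrict_Y_ell2: "a \<in> ell2 X \<Longrightarrow> restrict_Y a \<in> ell2 Y"
  unfolding restrict_Y_def using ell2_mono[OF _ ell2_restrict, of X Y Y a] by auto

lemma restrict_U_ell2: "a \<in> ell2 X \<Longrightarrow> restrict_U a \<in> ell2 U"
  unfolding restrict_U_def using ell2_mono[OF _ ell2_restrict, of X U U a] by auto

lemma restrict_split: "a \<in> ell2 (U \<union> Y) \<Longrightarrow> a = restrict_U a + restrict_Y a"
  using disjoint by (auto simp: fun_eq_iff restrict_U_def restrict_Y_def ell2_outside)

lemma ell2_Y_ell2: "a \<in> ell2 Y \<Longrightarrow> a \<in> ell2 (U \<union> Y)"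
  by (rule ell2_mono) auto

lemma ell2_U_ell2: "a \<in> ell2 U \<Longrightarrow> a \<in> ell2 (U \<union> Y)"
  by (rule ell2_mono) auto

lemma cinner2_w_restrict: "cinner2 a w = cinner2 (restrict_Y a) w"
  by (rule cinner2_cong) (auto simp: restrict_Y_def outside_Y)

text \<open>
  On \<open>\<ell>\<^sup>2(U \<union> Y)\<close> the block operator has a pointwise formula, which replaces the decomposition
  \<open>h + k\<close> in all later computations.
\<close>

lemma W_eq: "W = {(a, act a) |a. a \<in> dom}"
proof (intro equalityI subsetI)
  fix p assume "p \<in> W"
  then obtain h k where p: "p = (h + k, (\<lambda>v. lam v * h v) + ((\<Sum>\<^sub>\<infinity>v\<in>U. h v * cnj (g v)) *\<^sub>c f + cinner2 k w *\<^sub>c x))"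
    and h: "h \<in> ell2 U" "(\<lambda>v. lam v * h v) \<in> ell2 U" "(\<lambda>v. h v * cnj (g v)) summable_on U"
    and k: "k \<in> ell2 Y"
    unfolding W_def lower_block_def diag_oper_def oslash_oper_def rank_one_oper_def by blast
  have k0: "k v = 0" if "v \<in> U" for v by (rule ell2_outside[OF k on_U[OF that]])
  have h0: "h v = 0" if "v \<notin> U" for v by (rule ell2_outside[OF h(1) that])
  have fn: "functional (h + k) = (\<Sum>\<^sub>\<infinity>v\<in>U. h v * cnj (g v))"
    unfolding functional_def by (rule infsum_cong) (simp add: k0)
  have "restrict_Y (h + k) = k"
    using k h0 on_U by (auto simp: fun_eq_iff restrict_Y_def ell2_outside)
  then have inner: "cinner2 (h + k) w = cinner2 k w" by (simp add: cinner2_w_restrict[of "h + k"])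
  have sm: "(\<lambda>v. (h + k) v * cnj (g v)) summable_on U"
    using h(3) by (rule summable_on_cong[THEN iffD1, rotated]) (simp add: k0)
  have "(\<lambda>v. if v \<in> U then lam v * (h + k) v else 0) = (\<lambda>v. lam v * h v)"
    by (auto simp: fun_eq_iff h0 k0)
  then have "h + k \<in> dom"
    unfolding dom_def using h(1,2) k sm by (auto intro: ell2_add ell2_U_ell2 ell2_Y_ell2)
  moreover have "snd p = act (h + k)"
    unfolding act_def p fn inner using k0 h0 on_U outside_Y by (auto simp: fun_eq_iff cscale_def)
  ultimately show "p \<in> {(a, act a) |a. a \<in> dom}" using p by auto
next
  fix p assume "p \<in> {(a, act a) |a. a \<in> dom}"
  then obtain a where p: "p = (a, act a)" and a: "a \<in> ell2 (U \<union> Y)"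
    "(\<lambda>v. if v \<in> U then lam v * a v else 0) \<in> ell2 U" "(\<lambda>v. a v * cnj (g v)) summable_on U"
    unfolding dom_def by blast
  let ?h = "restrict_U a" and ?k = "restrict_Y a"
  have h: "?h \<in> ell2 U" and k: "?k \<in> ell2 Y"
    using a(1) restrict_U_ell2 restrict_Y_ell2 by auto
  have lh: "(\<lambda>v. lam v * ?h v) = (\<lambda>v. if v \<in> U then lam v * a v else 0)"
    by (auto simp: restrict_U_def fun_eq_iff)
  have sm: "(\<lambda>v. ?h v * cnj (g v)) summable_on U"
    using a(3) by (rule summable_on_cong[THEN iffD1, rotated]) (simp add: restrict_U_def)
  have fn: "(\<Sum>\<^sub>\<infinity>v\<in>U. ?h v * cnj (g v)) = functional a"
    unfolding functional_def by (rule infsum_cong) (simp add: restrict_U_def)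
  have "act a = (\<lambda>v. lam v * ?h v) + (functional a *\<^sub>c f + cinner2 ?k w *\<^sub>c x)"
    unfolding act_def cinner2_w_restrict[of a] using on_U outside_Y
    by (auto simp: fun_eq_iff cscale_def restrict_U_def)
  moreover have "(?h, \<lambda>v. lam v * ?h v) \<in> diag_oper U lam"
  proof -
    have "(\<lambda>v. lam v * ?h v) \<in> ell2 U" unfolding lh by (rule a(2))
    with h show ?thesis unfolding diag_oper_def by blast
  qed
  moreover have "(?h, functional a *\<^sub>c f) \<in> oslash_oper U f g"
    using h sm unfolding oslash_oper_def fn[symmetric] by blast
  moreover have "(?k, cinner2 ?k w *\<^sub>c x) \<in> rank_one_oper (ell2 Y) x w"
    using k unfolding rank_one_oper_def by blast
  ultimately show "p \<in> W"
    unfolding p W_def lower_block_def using restrict_split[OF a(1)] by blast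
qed

lemma shift_eq: "W -\<^sub>o \<mu> = {(a, act a - \<mu> *\<^sub>c a) |a. a \<in> dom}"
  unfolding op_shift_def W_eq by blast

lemma act_ell2: assumes "a \<in> dom" shows "act a \<in> ell2 (U \<union> Y)"
proof -
  have "act a = (\<lambda>v. if v \<in> U then lam v * a v else 0) + (functional a *\<^sub>c f + cinner2 a w *\<^sub>c x)"
    unfolding act_def using on_U outside_Y by (auto simp: fun_eq_iff cscale_def)
  then show ?thesis
    using assms f x unfolding dom_def
    by (auto intro!: ell2_add[OF ell2_U_ell2 ell2_Y_ell2] ell2_add[OF ell2_scale ell2_scale])
qed

lemma finite_support_dom:
  assumes F: "finite F" "F \<subseteq> U" and a: "a \<in> ell2 (U \<union> Y)" and 0: "\<And>v. v \<in> U - F \<Longrightarrow> a v = 0"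
  shows "a \<in> dom" "functional a = (\<Sum>v\<in>F. a v * cnj (g v))"
proof -
  have "(\<lambda>v. if v \<in> U then lam v * a v else 0) \<in> ell2 U"
    by (rule ell2_finite_support(1)[OF F(1)]) (use 0 F in auto)
  moreover have "(\<lambda>v. a v * cnj (g v)) summable_on U \<longleftrightarrow> (\<lambda>v. a v * cnj (g v)) summable_on F"
    by (rule summable_on_cong_neutral) (use 0 F in auto)
  ultimately show "a \<in> dom" using a F by (simp add: dom_def)
  have "functional a = (\<Sum>\<^sub>\<infinity>v\<in>F. a v * cnj (g v))"
    unfolding functional_def by (rule infsum_cong_neutral) (use 0 F in auto)
  then show "functional a = (\<Sum>v\<in>F. a v * cnj (g v))" using F by simp
qed

end


section \<open>Point spectrum, spectrum and resolvent\<close>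

text \<open>
  Now the range of \<open>N\<close> lies in the span of \<open>e\<^sub>u\<close> with \<open>u \<in> Y\<close>, and \<open>f \<noteq> 0\<close>, which makes the spectrum
  sensitive to \<open>g\<close>.
\<close>

locale pointed_rank_one_block = rank_one_block U Y lam f g "basis_vec u" w
  for U Y :: "'v set" and lam f g w :: "'v \<Rightarrow> complex" and u :: 'v +
  assumes u: "u \<in> Y" and f_nonzero: "f \<noteq> 0"
begin

abbreviation s :: complex where "s \<equiv> cinner2 (basis_vec u) w"

text \<open>
  The spectrum of \<open>N\<close>: its range lies in the span of the eigenvector \<open>e\<^sub>u\<close>, and its kernel is nonzero
  once \<open>Y\<close> has more than one point.
\<close>

definition sigma_N :: "complex set" where
  "sigma_N = (if Y = {u} then {s} else {s, 0})"

text \<open>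
  The formula for \<open>(N - \<mu>)\<inverse>\<close> off \<open>sigma_N\<close>.  For \<open>\<mu> \<noteq> 0\<close> it comes from taking the inner product of
  \<open>\<langle>k', w\<rangle> e\<^sub>u - \<mu> k' = k\<close> with \<open>w\<close>, which determines \<open>\<langle>k', w\<rangle>\<close>.  The value \<open>\<mu> = 0\<close> lies off \<open>sigma_N\<close> only if
  \<open>Y = {u}\<close>, where \<open>N\<close> is multiplication by \<open>s\<close>.
\<close>

definition N_resolvent :: "complex \<Rightarrow> ('v \<Rightarrow> complex) \<Rightarrow> 'v \<Rightarrow> complex" where
  "N_resolvent \<mu> k =
     (if \<mu> = 0 then (1 / s) *\<^sub>c k
      else (- 1 / \<mu>) *\<^sub>c k + (1 / (\<mu> * (s - \<mu>)) * cinner2 k w) *\<^sub>c basis_vec u)"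

lemma N_resolvent_ell2: assumes "k \<in> ell2 Y" shows "N_resolvent \<mu> k \<in> ell2 Y"
  unfolding N_resolvent_def
  by (split if_split) (intro conjI impI ell2_add ell2_scale basis_vec_ell2 u assms)

lemma N_resolvent_linear:
  assumes "k \<in> ell2 Y" "k' \<in> ell2 Y"
  shows "N_resolvent \<mu> (c *\<^sub>c k + k') = c *\<^sub>c N_resolvent \<mu> k + N_resolvent \<mu> k'"
proof -
  have "cinner2 (c *\<^sub>c k + k') w = c * cinner2 k w + cinner2 k' w"
    using cinner2_add_left[OF ell2_scale[OF assms(1), of c] assms(2) w] by (simp add: cinner2_scale_left)
  then show ?thesis
    unfolding N_resolvent_def
    by (simp add: fun_eq_iff cscale_def add_divide_distrib) (simp add: algebra_simps add_divide_distrib)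
qed

lemma N_resolvent_bounded: "\<exists>C\<ge>0. \<forall>k\<in>ell2 Y. norm2 (N_resolvent \<mu> k) \<le> C * norm2 k"
proof (cases "\<mu> = 0")
  case True
  show ?thesis
    by (rule exI[of _ "cmod (1 / s)"]) (simp add: N_resolvent_def True norm2_scale_le)
next
  case False
  define b where "b = 1 / (\<mu> * (s - \<mu>))"
  define C where "C = cmod (- 1 / \<mu>) + cmod b * norm2 w * norm2 (basis_vec u)"
  have "norm2 (N_resolvent \<mu> k) \<le> C * norm2 k" if k: "k \<in> ell2 Y" for k
  proof -
    have bu: "basis_vec u \<in> ell2 Y" by (rule basis_vec_ell2[OF u])
    have "norm2 (N_resolvent \<mu> k)
        \<le> norm2 ((- 1 / \<mu>) *\<^sub>c k) + norm2 ((b * cinner2 k w) *\<^sub>c basis_vec u)"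
      unfolding N_resolvent_def b_def[symmetric] using False
      by (simp del: divide_minus_left) (intro norm2_add_le[OF ell2_scale[OF k] ell2_scale[OF bu]])
    also have "\<dots> \<le> cmod (- 1 / \<mu>) * norm2 k + cmod (b * cinner2 k w) * norm2 (basis_vec u)"
      by (intro add_mono norm2_scale_le[OF k] norm2_scale_le[OF bu])
    also have "\<dots> \<le> cmod (- 1 / \<mu>) * norm2 k + cmod b * (norm2 k * norm2 w) * norm2 (basis_vec u)"
      unfolding norm_mult by (intro add_mono mult_right_mono mult_left_mono Cauchy_Schwarz[OF k w]) auto
    also have "\<dots> = C * norm2 k" by (simp add: C_def algebra_simps)
    finally show ?thesis .
  qed
  moreover have "C \<ge> 0" unfolding C_def by simp
  ultimately show ?thesis by blast
qed

lemma N_resolvent_inverse: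
  assumes \<mu>: "\<mu> \<notin> sigma_N" and k: "k \<in> ell2 Y"
  shows "cinner2 (N_resolvent \<mu> k) w *\<^sub>c basis_vec u - \<mu> *\<^sub>c N_resolvent \<mu> k = k" (is ?right)
    and "N_resolvent \<mu> (cinner2 k w *\<^sub>c basis_vec u - \<mu> *\<^sub>c k) = k" (is ?left)
proof -
  have s\<mu>: "s \<noteq> \<mu>" using \<mu> by (auto simp: sigma_N_def split: if_splits)
  have bu: "basis_vec u \<in> ell2 Y" by (rule basis_vec_ell2[OF u])
  have "?right \<and> ?left"
  proof (cases "\<mu> = 0")
    case True
    \<comment> \<open>Here \<open>Y = {u}\<close>, and \<open>N\<close> is multiplication by \<open>s\<close>.\<close>
    then have "Y = {u}" and s: "s \<noteq> 0" using \<mu> s\<mu> by (auto simp: sigma_N_def split: if_splits)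
    then have ku: "k = k u *\<^sub>c basis_vec u"
      using k by (auto simp: fun_eq_iff cscale_def basis_vec_def ell2_outside)
    have kw: "cinner2 k w = k u * s" by (subst ku) (rule cinner2_scale_left)
    have "(k u * s) *\<^sub>c basis_vec u = s *\<^sub>c k"
      by (subst (2) ku) (simp add: cfun.scale_scale mult.commute)
    then show ?thesis
      using s True by (simp add: N_resolvent_def cinner2_scale_left kw cfun.scale_scale ku[symmetric])
  next
    case False
    have "cinner2 (N_resolvent \<mu> k) w
        = (- 1 / \<mu>) * cinner2 k w + 1 / (\<mu> * (s - \<mu>)) * cinner2 k w * s"
      unfolding N_resolvent_def if_not_P[OF False]
      using cinner2_add_left[OF ell2_scale[OF k] ell2_scale[OF bu] w]
      by (simp only: cinner2_scale_left)
    then have eq: "cinner2 (N_resolvent \<mu> k) w = cinner2 k w / (s - \<mu>)"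
    proof -
      have "- 1 / \<mu> + 1 / (\<mu> * (s - \<mu>)) * s = 1 / (s - \<mu>)"
        using False s\<mu> by (simp add: divide_simps)
      then have "cinner2 k w * (- 1 / \<mu> + 1 / (\<mu> * (s - \<mu>)) * s) = cinner2 k w / (s - \<mu>)"
        by simp
      with \<open>cinner2 (N_resolvent \<mu> k) w = _\<close> show ?thesis by (simp only: distrib_left mult_ac)
    qed
    have right: ?right
    proof -
      have "\<mu> * (- 1 / \<mu>) = - 1"
        "\<mu> * (1 / (\<mu> * (s - \<mu>)) * cinner2 k w) = cinner2 k w / (s - \<mu>)"
        using False by simp_all
      then have "\<mu> *\<^sub>c N_resolvent \<mu> k
          = (- 1) *\<^sub>c k + (cinner2 k w / (s - \<mu>)) *\<^sub>c basis_vec u"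
        unfolding N_resolvent_def if_not_P[OF False]
        by (simp only: cfun.scale_right_distrib cfun.scale_scale)
      then show ?thesis unfolding eq by simp
    qed
    have "cinner2 (cinner2 k w *\<^sub>c basis_vec u - \<mu> *\<^sub>c k) w = cinner2 k w * (s - \<mu>)"
      using cinner2_diff_left[OF ell2_scale[OF bu] ell2_scale[OF k] w]
      by (simp add: cinner2_scale_left algebra_simps)
    moreover have "1 / (\<mu> * (s - \<mu>)) * (cinner2 k w * (s - \<mu>)) = cinner2 k w / \<mu>"
      using s\<mu> by simp
    ultimately have ?left
      unfolding N_resolvent_def if_not_P[OF False]
      using False by (simp only: fun_eq_iff) (simp add: cscale_def diff_divide_distrib)
    with right show ?thesis ..
  qed
  then show ?right ?left by blast+
qed

lemma N_resolvent_nonzero: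
  assumes "\<mu> \<notin> sigma_N" "k \<in> ell2 Y" "k \<noteq> 0" shows "N_resolvent \<mu> k \<noteq> 0"
  using N_resolvent_inverse(1)[OF assms(1,2)] assms(3) by auto

lemma sigma_N_eigenvector:
  assumes "\<mu> \<in> sigma_N"
  obtains k where "k \<in> ell2 Y" "k \<noteq> 0" "cinner2 k w *\<^sub>c basis_vec u = \<mu> *\<^sub>c k"
proof (cases "\<mu> = s")
  case True
  have "basis_vec u \<noteq> 0" by (auto simp: fun_eq_iff basis_vec_def)
  then show ?thesis using that[of "basis_vec u"] True basis_vec_ell2[OF u] by simp
next
  case False
  then have \<mu>: "\<mu> = 0" "Y \<noteq> {u}" using assms by (auto simp: sigma_N_def split: if_splits)
  then obtain v where v: "v \<in> Y" "v \<noteq> u" using u by blast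
  \<comment> \<open>Removing from \<open>s e\<^sub>v\<close> a multiple of \<open>e\<^sub>u\<close> makes it orthogonal to \<open>w\<close>.\<close>
  define k where "k = s *\<^sub>c basis_vec v - cinner2 (basis_vec v) w *\<^sub>c basis_vec u"
  have k: "k \<in> ell2 Y" unfolding k_def by (intro ell2_diff ell2_scale basis_vec_ell2 v u)
  have "cinner2 k w = 0"
    unfolding k_def
    by (subst cinner2_diff_left[of _ Y _ Y _ Y])
      (simp_all add: ell2_scale basis_vec_ell2 v u w cinner2_scale_left)
  moreover have "k v \<noteq> 0" using v False \<mu> by (simp add: k_def cscale_def basis_vec_def)
  moreover from this have "k \<noteq> 0" by auto
  ultimately show ?thesis by (intro that[of k] k) (simp_all add: \<mu>(1))
qed

text \<open>
  An eigenvector that does not vanish on \<open>U\<close> has a diagonal entry as its eigenvalue, and one that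
  does is an eigenvector of \<open>N\<close>.  In the other direction, if \<open>\<lambda>\<^sub>u\<^sub>v\<close> is not an eigenvalue of \<open>N\<close>, the
  vector \<open>e\<^sub>v\<close> is completed by \<open>- cnj (g v) (N - \<lambda>\<^sub>u\<^sub>v)\<inverse> f\<close>.
\<close>

lemma point_spectrum_eq: "point_spectrum W = lam ` U \<union> sigma_N"
proof (intro equalityI subsetI)
  fix \<mu> assume "\<mu> \<in> point_spectrum W"
  then obtain a where a: "a \<noteq> 0" "a \<in> dom" "act a = \<mu> *\<^sub>c a"
    unfolding point_spectrum_def W_eq by auto
  have aV: "a \<in> ell2 (U \<union> Y)" using a(2) by (simp add: dom_def)
  show "\<mu> \<in> lam ` U \<union> sigma_N"
  proof (cases "\<exists>v\<in>U. a v \<noteq> 0")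
    case True
    then obtain v where v: "v \<in> U" "a v \<noteq> 0" by blast
    then have "lam v * a v = \<mu> * a v"
      using fun_cong[OF a(3), of v] by (simp add: act_def cscale_def)
    then show ?thesis using v by auto
  next
    case False
    then have aY: "a \<in> ell2 Y" using aV by (auto simp: ell2_iff)
    have "functional a = 0" unfolding functional_def by (rule infsum_0) (use False in auto)
    then have "cinner2 a w * basis_vec u z = \<mu> * a z" for z
      using fun_cong[OF a(3), of z] False on_U[of z] outside_Y(2)[of z]
      by (cases "z \<in> U") (auto simp: act_def cscale_def)
    then have "cinner2 a w *\<^sub>c basis_vec u - \<mu> *\<^sub>c a = 0"
      by (simp add: fun_eq_iff cscale_def)
    then have "a = 0" if "\<mu> \<notin> sigma_N"
      using N_resolvent_inverse(2)[OF that aY] by (simp add: N_resolvent_def split: if_splits)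
    then show ?thesis using a(1) by blast
  qed
next
  fix \<mu> assume \<mu>: "\<mu> \<in> lam ` U \<union> sigma_N"
  show "\<mu> \<in> point_spectrum W"
  proof (cases "\<mu> \<in> sigma_N")
    case True
    then obtain k where k: "k \<in> ell2 Y" "k \<noteq> 0" "cinner2 k w *\<^sub>c basis_vec u = \<mu> *\<^sub>c k"
      by (rule sigma_N_eigenvector)
    have kU: "k v = 0" if "v \<in> U" for v by (rule ell2_outside[OF k(1) on_U[OF that]])
    have "k \<in> dom" "functional k = 0"
      using finite_support_dom[of "{}" k] k(1) ell2_Y_ell2 kU by auto
    then have "act k = \<mu> *\<^sub>c k"
      unfolding k(3)[symmetric] act_def using kU on_U outside_Y(2) by (auto simp: fun_eq_iff cscale_def)
    then show ?thesis unfolding point_spectrum_def W_eq using \<open>k \<in> dom\<close> k(2) by auto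
  next
    case False
    then obtain v where v: "v \<in> U" "\<mu> = lam v" using \<mu> by blast
    define k where "k = (- cnj (g v)) *\<^sub>c N_resolvent \<mu> f"
    have k: "k \<in> ell2 Y" unfolding k_def by (intro ell2_scale N_resolvent_ell2 f)
    have kU: "k z = 0" if "z \<in> U" for z by (rule ell2_outside[OF k on_U[OF that]])
    define a where "a = basis_vec v + k"
    have aV: "a \<in> ell2 (U \<union> Y)"
      unfolding a_def using k v by (intro ell2_add basis_vec_ell2 ell2_Y_ell2) auto
    have aU: "a z = basis_vec v z" if "z \<in> U" for z using kU[OF that] by (simp add: a_def)
    have dom: "a \<in> dom" and fn: "functional a = cnj (g v)"
      using finite_support_dom[of "{v}" a] aV v aU by (auto simp: basis_vec_def)
    have "restrict_Y a = k"
      using k v on_U by (auto simp: fun_eq_iff restrict_Y_def a_def basis_vec_def ell2_outside)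
    then have inner: "cinner2 a w = cinner2 k w" by (simp add: cinner2_w_restrict[of a])
    have "cinner2 k w *\<^sub>c basis_vec u - \<mu> *\<^sub>c k
        = (- cnj (g v)) *\<^sub>c (cinner2 (N_resolvent \<mu> f) w *\<^sub>c basis_vec u - \<mu> *\<^sub>c N_resolvent \<mu> f)"
      unfolding k_def cinner2_scale_left by (simp add: fun_eq_iff cscale_def algebra_simps)
    also have "\<dots> = (- cnj (g v)) *\<^sub>c f" by (simp add: N_resolvent_inverse(1)[OF False f])
    finally have eq: "cinner2 k w * basis_vec u z - \<mu> * k z = - cnj (g v) * f z" for z
      by (simp add: fun_eq_iff cscale_def)
    have "act a z = \<mu> * a z" for z
    proof (cases "z \<in> U")
      case True
      then have "act a z = lam z * a z" by (simp add: act_def)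
      then show ?thesis using v aU[OF True] by (auto simp: basis_vec_def split: if_splits)
    next
      case zU: False
      then have "a z = k z" using v by (auto simp: a_def basis_vec_def)
      then show ?thesis using eq[of z] zU by (simp add: act_def fn inner algebra_simps)
    qed
    then have "act a = \<mu> *\<^sub>c a" by (simp add: fun_eq_iff cscale_def)
    moreover have "a v \<noteq> 0" using aU[OF v(1)] by (simp add: basis_vec_def)
    moreover from this have "a \<noteq> 0" by auto
    ultimately show ?thesis unfolding point_spectrum_def W_eq using dom by auto
  qed
qed

lemma gap_outside_closure:
  assumes "\<mu> \<notin> closure (point_spectrum W)"
  obtains e where "e > 0" "\<And>v. v \<in> U \<Longrightarrow> e \<le> cmod (lam v - \<mu>)" "\<mu> \<notin> sigma_N"
proof -
  obtain e where e: "e > 0" "\<And>z. z \<in> point_spectrum W \<Longrightarrow> \<not> dist z \<mu> < e"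
    using assms unfolding closure_approachable by blast
  show ?thesis
    by (rule that[of e]) (use e(1) e(2)[of "lam _"] assms closure_subset[of "point_spectrum W"] in
        \<open>auto simp: point_spectrum_eq dist_norm not_less\<close>)
qed

text \<open>
  The vector representing the functional \<open>h \<mapsto> \<Sum> ((D - \<mu>)\<inverse> h)(v) cnj (g v)\<close>.
\<close>

definition coefficient :: "complex \<Rightarrow> 'v \<Rightarrow> complex" where
  "coefficient \<mu> = (\<lambda>v. if v \<in> U then g v / cnj (lam v - \<mu>) else 0)"

text \<open>
  Back substitution: \<open>(D - \<mu>)\<inverse>\<close> solves the first row, and \<open>(N - \<mu>)\<inverse>\<close> the second after moving the
  multiple of \<open>f\<close> produced by the corner to the right-hand side.
\<close>

definition resolvent :: "complex \<Rightarrow> ('v \<Rightarrow> complex) \<Rightarrow> 'v \<Rightarrow> complex" where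
  "resolvent \<mu> h = (\<lambda>v. if v \<in> U then h v / (lam v - \<mu>) else 0)
     + N_resolvent \<mu> (restrict_Y h - cinner2 h (coefficient \<mu>) *\<^sub>c f)"

lemma coefficient_ell2:
  assumes "compat_I U lam g" and e: "e > 0" "\<And>v. v \<in> U \<Longrightarrow> e \<le> cmod (lam v - \<mu>)"
  shows "coefficient \<mu> \<in> ell2 U"
proof -
  have pos: "0 < cmod (lam v - \<mu>)" if "v \<in> U" for v using e(1) e(2)[OF that] by linarith
  have "(\<lambda>v. if v \<in> U then (1 / cnj (lam v - \<mu>)) * g v else 0) \<in> ell2 U"
  proof (rule compat_I_weighted_ell2[OF assms(1), where C = "1 / e" and C' = 1 and \<mu> = \<mu>])
    show "cmod (1 / cnj (lam v - \<mu>)) \<le> 1 / e" if "v \<in> U" for v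
      using e(1) e(2)[OF that] pos[OF that] by (simp add: norm_divide frac_le del: complex_cnj_diff)
    show "cmod (1 / cnj (lam v - \<mu>)) * cmod (lam v - \<mu>) \<le> 1" if "v \<in> U" for v
      using pos[OF that] by (simp add: norm_divide del: complex_cnj_diff)
  qed
  then show ?thesis by (simp add: coefficient_def cong: if_cong)
qed

context
  fixes \<mu> :: complex and e :: real
  assumes e: "e > 0" "\<And>v. v \<in> U \<Longrightarrow> e \<le> cmod (lam v - \<mu>)"
    and \<mu>: "\<mu> \<notin> sigma_N"
    and coeff: "coefficient \<mu> \<in> ell2 U"
begin

lemma nonzero: "v \<in> U \<Longrightarrow> lam v - \<mu> \<noteq> 0"
  using e by fastforce

lemma divide_ell2:
  assumes h: "h \<in> ell2 X"
  shows "(\<lambda>v. if v \<in> U then h v / (lam v - \<mu>) else 0) \<in> ell2 U"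
    "norm2 (\<lambda>v. if v \<in> U then h v / (lam v - \<mu>) else 0) \<le> (1 / e) * norm2 h"
proof -
  have le: "cmod (if v \<in> U then h v / (lam v - \<mu>) else 0) \<le> (1 / e) * cmod (h v)" for v
  proof (cases "v \<in> U")
    case True
    have "cmod (h v) / cmod (lam v - \<mu>) \<le> cmod (h v) / e"
      using e(1) e(2)[OF True] by (intro frac_le) auto
    then show ?thesis using True by (simp add: norm_divide)
  qed (use e(1) in simp)
  show "(\<lambda>v. if v \<in> U then h v / (lam v - \<mu>) else 0) \<in> ell2 U"
    by (rule ell2_dominated(1)[OF h le]) (use e in auto)
  show "norm2 (\<lambda>v. if v \<in> U then h v / (lam v - \<mu>) else 0) \<le> (1 / e) * norm2 h"
    by (rule ell2_dominated(2)[OF h le, where Y = U]) (use e in auto)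
qed

lemma Y_part_ell2: "h \<in> ell2 X \<Longrightarrow> restrict_Y h - cinner2 h (coefficient \<mu>) *\<^sub>c f \<in> ell2 Y"
  by (intro ell2_diff ell2_scale f) (rule restrict_Y_ell2)

lemma resolvent_ell2: "h \<in> ell2 (U \<union> Y) \<Longrightarrow> resolvent \<mu> h \<in> ell2 (U \<union> Y)"
  unfolding resolvent_def
  by (intro ell2_add ell2_U_ell2 ell2_Y_ell2 divide_ell2(1) N_resolvent_ell2 Y_part_ell2)

lemma functional_quotient:
  assumes "\<And>v. v \<in> U \<Longrightarrow> a v * (lam v - \<mu>) = h v"
  shows "functional a = cinner2 h (coefficient \<mu>)"
  unfolding functional_def cinner2_def
  by (rule infsum_cong_neutral)
    (use nonzero in \<open>auto simp: coefficient_def assms[symmetric] field_simps\<close>)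

lemma resolvent_graph: "(W -\<^sub>o \<mu>)\<inverse> = {(h, resolvent \<mu> h) |h. h \<in> ell2 (U \<union> Y)}"
proof (intro equalityI subsetI)
  fix p assume "p \<in> (W -\<^sub>o \<mu>)\<inverse>"
  then obtain a where a: "a \<in> dom" and p: "p = (act a - \<mu> *\<^sub>c a, a)"
    unfolding shift_eq by blast
  define h where "h = act a - \<mu> *\<^sub>c a"
  have aV: "a \<in> ell2 (U \<union> Y)" using a by (simp add: dom_def)
  have h: "h \<in> ell2 (U \<union> Y)"
    unfolding h_def by (intro ell2_diff ell2_scale act_ell2 a aV)
  have hU: "a v * (lam v - \<mu>) = h v" if "v \<in> U" for v
    using that by (simp add: h_def act_def cscale_def algebra_simps)
  have fn: "functional a = cinner2 h (coefficient \<mu>)"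
    by (rule functional_quotient) (rule hU)
  have hY: "h v = functional a * f v + cinner2 a w * basis_vec u v - \<mu> * a v" if "v \<in> Y" for v
    using that on_U[of v] by (auto simp: h_def act_def cscale_def)
  have "restrict_Y h - cinner2 h (coefficient \<mu>) *\<^sub>c f
      = cinner2 (restrict_Y a) w *\<^sub>c basis_vec u - \<mu> *\<^sub>c restrict_Y a"
    unfolding fn[symmetric] cinner2_w_restrict[symmetric]
    using outside_Y(1,2) by (auto simp: fun_eq_iff restrict_Y_def hY cscale_def)
  then have "resolvent \<mu> h = (\<lambda>v. if v \<in> U then h v / (lam v - \<mu>) else 0) + restrict_Y a"
    unfolding resolvent_def by (simp add: N_resolvent_inverse(2)[OF \<mu> restrict_Y_ell2[OF aV]])
  also have "\<dots> = restrict_U a + restrict_Y a"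
    using nonzero by (auto simp: fun_eq_iff restrict_U_def hU[symmetric])
  finally have "resolvent \<mu> h = a" using restrict_split[OF aV] by simp
  then show "p \<in> {(h, resolvent \<mu> h) |h. h \<in> ell2 (U \<union> Y)}"
    using h p unfolding h_def[symmetric] by blast
next
  fix p assume "p \<in> {(h, resolvent \<mu> h) |h. h \<in> ell2 (U \<union> Y)}"
  then obtain h where h: "h \<in> ell2 (U \<union> Y)" and p: "p = (h, resolvent \<mu> h)" by blast
  define a where "a = resolvent \<mu> h"
  define k where "k = N_resolvent \<mu> (restrict_Y h - cinner2 h (coefficient \<mu>) *\<^sub>c f)"
  have k: "k \<in> ell2 Y" unfolding k_def by (rule N_resolvent_ell2[OF Y_part_ell2[OF h]])
  have kU: "k v = 0" if "v \<in> U" for v by (rule ell2_outside[OF k on_U[OF that]])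
  have aV: "a \<in> ell2 (U \<union> Y)" unfolding a_def by (rule resolvent_ell2[OF h])
  have aU: "a v = h v / (lam v - \<mu>)" if "v \<in> U" for v
    using that kU[OF that] by (simp add: a_def resolvent_def k_def)
  have aY: "a v = k v" if "v \<notin> U" for v
    using that by (simp add: a_def resolvent_def k_def)
  have ah: "a v * (lam v - \<mu>) = h v" if "v \<in> U" for v using aU[OF that] nonzero[OF that] by simp
  have "(\<lambda>v. if v \<in> U then lam v * a v else 0) = restrict_U h + \<mu> *\<^sub>c restrict_U a"
    by (auto simp: fun_eq_iff restrict_U_def cscale_def ah[symmetric] algebra_simps)
  then have "(\<lambda>v. if v \<in> U then lam v * a v else 0) \<in> ell2 U"
    using restrict_U_ell2[OF h] restrict_U_ell2[OF aV] ell2_add ell2_scale by metis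
  moreover have "(\<lambda>v. a v * cnj (g v)) summable_on U"
    by (rule summable_on_cong[THEN iffD1, OF _ ell2_mult_summable[OF h coeff]])
      (use nonzero in \<open>simp add: coefficient_def aU field_simps\<close>)
  ultimately have dom: "a \<in> dom" using aV by (simp add: dom_def)
  have rk: "restrict_Y a = k" using k aY on_U by (auto simp: fun_eq_iff restrict_Y_def ell2_outside)
  have fn: "functional a = cinner2 h (coefficient \<mu>)"
    by (rule functional_quotient) (rule ah)
  have eq: "cinner2 k w *\<^sub>c basis_vec u - \<mu> *\<^sub>c k = restrict_Y h - functional a *\<^sub>c f"
    unfolding k_def fn
    by (rule N_resolvent_inverse(1)[OF \<mu> Y_part_ell2[OF h]])
  have "act a v - \<mu> * a v = h v" for v
  proof (cases "v \<in> U")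
    case True
    then show ?thesis using ah[OF True] by (simp add: act_def algebra_simps)
  next
    case False
    have "h v = restrict_Y h v" using False h by (simp add: restrict_Y_def ell2_outside)
    then show ?thesis
      using fun_cong[OF eq, of v] False aY[OF False]
      by (simp add: act_def cinner2_w_restrict[of a] rk cscale_def algebra_simps)
  qed
  then have "act a - \<mu> *\<^sub>c a = h" by (simp add: fun_eq_iff cscale_def)
  then show "p \<in> (W -\<^sub>o \<mu>)\<inverse>" unfolding shift_eq p a_def[symmetric] using dom by blast
qed

lemma resolvent_linear:
  assumes h: "h \<in> ell2 (U \<union> Y)" and h': "h' \<in> ell2 (U \<union> Y)"
  shows "resolvent \<mu> (c *\<^sub>c h + h') = c *\<^sub>c resolvent \<mu> h + resolvent \<mu> h'"
proof -
  let ?k = "\<lambda>h. restrict_Y h - cinner2 h (coefficient \<mu>) *\<^sub>c f"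
  have "?k (c *\<^sub>c h + h') = c *\<^sub>c ?k h + ?k h'"
    using cinner2_add_left[OF ell2_scale[OF h] h' coeff, of c]
    by (auto simp: fun_eq_iff cscale_def restrict_Y_def cinner2_scale_left[unfolded cscale_def] algebra_simps)
  then show ?thesis
    unfolding resolvent_def
    by (simp only: N_resolvent_linear[OF Y_part_ell2[OF h] Y_part_ell2[OF h']])
      (auto simp: fun_eq_iff cscale_def add_divide_distrib algebra_simps)
qed

lemma resolvent_bounded: "bounded_on_whole (ell2 (U \<union> Y)) ((W -\<^sub>o \<mu>)\<inverse>)"
proof -
  obtain C where C: "C \<ge> 0" "\<And>k. k \<in> ell2 Y \<Longrightarrow> norm2 (N_resolvent \<mu> k) \<le> C * norm2 k"
    using N_resolvent_bounded by blast
  define D where "D = 1 / e + C * (1 + norm2 (coefficient \<mu>) * norm2 f)"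
  have bound: "norm2 (resolvent \<mu> h) \<le> D * norm2 h" if h: "h \<in> ell2 (U \<union> Y)" for h
  proof -
    let ?k = "restrict_Y h - cinner2 h (coefficient \<mu>) *\<^sub>c f"
    have "norm2 ?k \<le> norm2 (restrict_Y h) + norm2 (cinner2 h (coefficient \<mu>) *\<^sub>c f)"
      by (intro norm2_diff_le[of _ Y] restrict_Y_ell2[OF h] ell2_scale f)
    also have "\<dots> \<le> norm2 h + norm2 h * norm2 (coefficient \<mu>) * norm2 f"
      using norm2_restrict_le[OF h, of Y] norm2_scale_le[OF f, of "cinner2 h (coefficient \<mu>)"]
        mult_right_mono[OF Cauchy_Schwarz[OF h coeff] norm2_nonneg[of f]]
      unfolding restrict_Y_def by linarith
    finally have k: "norm2 ?k \<le> norm2 h + norm2 h * norm2 (coefficient \<mu>) * norm2 f" .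
    have "norm2 (resolvent \<mu> h) \<le> (1 / e) * norm2 h + norm2 (N_resolvent \<mu> ?k)"
      unfolding resolvent_def
      using norm2_add_le[OF ell2_U_ell2[OF divide_ell2(1)[OF h]]
          ell2_Y_ell2[OF N_resolvent_ell2[where \<mu> = \<mu>, OF Y_part_ell2[OF h]]]] divide_ell2(2)[OF h]
      by linarith
    also have "\<dots> \<le> (1 / e) * norm2 h + C * (norm2 h + norm2 h * norm2 (coefficient \<mu>) * norm2 f)"
      using C(2)[OF Y_part_ell2[OF h]] mult_left_mono[OF k C(1)] by linarith
    also have "\<dots> = D * norm2 h" by (simp add: D_def algebra_simps)
    finally show ?thesis .
  qed
  have z: "resolvent \<mu> 0 = 0"
    using resolvent_linear[OF ell2_zero ell2_zero, of 1] by simp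
  have "linear_oper (ell2 (U \<union> Y)) (ell2 (U \<union> Y)) ((W -\<^sub>o \<mu>)\<inverse>)"
    unfolding resolvent_graph linear_oper_def single_valued_def
    using resolvent_ell2 z ell2_zero
    by (auto simp: resolvent_linear[symmetric] intro: ell2_add ell2_scale)
  then show ?thesis
    unfolding bounded_on_whole_def using bound by (auto simp: resolvent_graph)
qed

lemma diag_resolvent_graph:
  "(diag_oper U lam -\<^sub>o \<mu>)\<inverse> = {(h, \<lambda>v. if v \<in> U then h v / (lam v - \<mu>) else 0) |h. h \<in> ell2 U}"
proof -
  have q2: "(\<lambda>v. if v \<in> U then h v / (lam v - \<mu>) else 0) \<in> ell2 U" if "h \<in> ell2 U" for h
    using that by (rule divide_ell2(1))
  show ?thesis
  proof (intro equalityI subsetI)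
    fix p assume "p \<in> (diag_oper U lam -\<^sub>o \<mu>)\<inverse>"
    then obtain a where p: "p = ((\<lambda>v. lam v * a v) - \<mu> *\<^sub>c a, a)"
      and a: "a \<in> ell2 U" "(\<lambda>v. lam v * a v) \<in> ell2 U"
      unfolding op_shift_def diag_oper_def by blast
    have "a = (\<lambda>v. if v \<in> U then ((\<lambda>v. lam v * a v) - \<mu> *\<^sub>c a) v / (lam v - \<mu>) else 0)"
      using nonzero ell2_outside[OF a(1)]
      by (auto simp: fun_eq_iff cscale_def left_diff_distrib[symmetric])
    moreover have "(\<lambda>v. lam v * a v) - \<mu> *\<^sub>c a \<in> ell2 U"
      by (intro ell2_diff ell2_scale a)
    ultimately show "p \<in> {(h, \<lambda>v. if v \<in> U then h v / (lam v - \<mu>) else 0) |h. h \<in> ell2 U}"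
      unfolding p by blast
  next
    fix p assume "p \<in> {(h, \<lambda>v. if v \<in> U then h v / (lam v - \<mu>) else 0) |h. h \<in> ell2 U}"
    then obtain h where p: "p = (h, \<lambda>v. if v \<in> U then h v / (lam v - \<mu>) else 0)" and h: "h \<in> ell2 U"
      by blast
    define a where "a = (\<lambda>v. if v \<in> U then h v / (lam v - \<mu>) else 0)"
    have a: "a \<in> ell2 U" unfolding a_def by (rule q2[OF h])
    have la: "(\<lambda>v. lam v * a v) = h + \<mu> *\<^sub>c a"
      using nonzero ell2_outside[OF h] by (auto simp: fun_eq_iff cscale_def a_def field_simps)
    have "(\<lambda>v. lam v * a v) \<in> ell2 U" unfolding la by (intro ell2_add ell2_scale a h)
    then have "(a, \<lambda>v. lam v * a v) \<in> diag_oper U lam" using a unfolding diag_oper_def by blast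
    moreover have "h = (\<lambda>v. lam v * a v) - \<mu> *\<^sub>c a" unfolding la by simp
    ultimately show "p \<in> (diag_oper U lam -\<^sub>o \<mu>)\<inverse>"
      unfolding p a_def[symmetric] op_shift_def by blast
  qed
qed

lemma oslash_resolvent_graph:
  "oslash_oper U f g \<circ>\<^sub>o (diag_oper U lam -\<^sub>o \<mu>)\<inverse>
    = {(h, cinner2 h (coefficient \<mu>) *\<^sub>c f) |h. h \<in> ell2 U}"
proof -
  define q where "q h = (\<lambda>v. if v \<in> U then h v / (lam v - \<mu>) else 0)" for h :: "'v \<Rightarrow> complex"
  have q2: "q h \<in> ell2 U" if "h \<in> ell2 U" for h
    unfolding q_def using that by (rule divide_ell2(1))
  have sm: "(\<lambda>v. q h v * cnj (g v)) summable_on U" if "h \<in> ell2 U" for h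
    by (rule summable_on_cong[THEN iffD1, OF _ ell2_mult_summable[OF that coeff]])
      (simp add: coefficient_def q_def)
  have val: "(\<Sum>\<^sub>\<infinity>v\<in>U. q h v * cnj (g v)) = cinner2 h (coefficient \<mu>)" for h
    unfolding cinner2_def by (rule infsum_cong_neutral) (auto simp: coefficient_def q_def)
  show ?thesis
    unfolding diag_resolvent_graph op_comp_def q_def[symmetric] oslash_oper_def
    using q2 sm by (auto simp: val[symmetric] relcomp_unfold)
qed

lemma N_resolvent_graph:
  "(rank_one_oper (ell2 Y) (basis_vec u) w -\<^sub>o \<mu>)\<inverse> = {(k, N_resolvent \<mu> k) |k. k \<in> ell2 Y}"
proof (intro equalityI subsetI)
  fix p assume "p \<in> (rank_one_oper (ell2 Y) (basis_vec u) w -\<^sub>o \<mu>)\<inverse>"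
  then obtain a where p: "p = (cinner2 a w *\<^sub>c basis_vec u - \<mu> *\<^sub>c a, a)" and a: "a \<in> ell2 Y"
    unfolding op_shift_def rank_one_oper_def by blast
  have "cinner2 a w *\<^sub>c basis_vec u - \<mu> *\<^sub>c a \<in> ell2 Y"
    by (intro ell2_diff ell2_scale basis_vec_ell2 u a)
  then show "p \<in> {(k, N_resolvent \<mu> k) |k. k \<in> ell2 Y}"
    unfolding p using N_resolvent_inverse(2)[OF \<mu> a] by force
next
  fix p assume "p \<in> {(k, N_resolvent \<mu> k) |k. k \<in> ell2 Y}"
  then obtain k where p: "p = (k, N_resolvent \<mu> k)" and k: "k \<in> ell2 Y" by blast
  have "(N_resolvent \<mu> k, cinner2 (N_resolvent \<mu> k) w *\<^sub>c basis_vec u - \<mu> *\<^sub>c N_resolvent \<mu> k)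
      \<in> rank_one_oper (ell2 Y) (basis_vec u) w -\<^sub>o \<mu>"
    unfolding op_shift_def rank_one_oper_def using N_resolvent_ell2[OF k] by blast
  then show "p \<in> (rank_one_oper (ell2 Y) (basis_vec u) w -\<^sub>o \<mu>)\<inverse>"
    unfolding p N_resolvent_inverse(1)[OF \<mu> k] by blast
qed

lemma resolvent_block_sum:
  assumes h: "h \<in> ell2 U" and k: "k \<in> ell2 Y"
  shows "resolvent \<mu> (h + k) = (\<lambda>v. if v \<in> U then h v / (lam v - \<mu>) else 0)
    + (- N_resolvent \<mu> (cinner2 h (coefficient \<mu>) *\<^sub>c f) + N_resolvent \<mu> k)"
proof -
  have kU: "k v = 0" if "v \<in> U" for v by (rule ell2_outside[OF k on_U[OF that]])
  have hY: "h v = 0" if "v \<in> Y" for v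
    by (rule ell2_outside[OF h]) (use that on_U in blast)
  have "cinner2 k (coefficient \<mu>) = 0"
    by (rule cinner2_orthogonal_disjoint[OF k coeff]) (use disjoint in blast)
  then have inner: "cinner2 (h + k) (coefficient \<mu>) = cinner2 h (coefficient \<mu>)"
    by (simp add: cinner2_add_left[OF h k coeff])
  have rk: "restrict_Y (h + k) = k"
    using hY by (auto simp: fun_eq_iff restrict_Y_def ell2_outside[OF k])
  define z where "z = cinner2 h (coefficient \<mu>) *\<^sub>c f"
  have z: "z \<in> ell2 Y" unfolding z_def by (rule ell2_scale[OF f])
  have "k - z = (- 1) *\<^sub>c z + k" by simp
  then have "N_resolvent \<mu> (k - z) = (- 1) *\<^sub>c N_resolvent \<mu> z + N_resolvent \<mu> k"
    by (simp only: N_resolvent_linear[OF z k])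
  moreover have "(\<lambda>v. if v \<in> U then (h + k) v / (lam v - \<mu>) else 0)
      = (\<lambda>v. if v \<in> U then h v / (lam v - \<mu>) else 0)"
    using kU by (auto simp: fun_eq_iff)
  ultimately show ?thesis
    unfolding resolvent_def inner rk z_def[symmetric] by simp
qed

lemma resolvent_lower_block:
  "(W -\<^sub>o \<mu>)\<inverse> = lower_block ((diag_oper U lam -\<^sub>o \<mu>)\<inverse>)
     (op_neg ((rank_one_oper (ell2 Y) (basis_vec u) w -\<^sub>o \<mu>)\<inverse>
        \<circ>\<^sub>o (oslash_oper U f g \<circ>\<^sub>o (diag_oper U lam -\<^sub>o \<mu>)\<inverse>)))
     ((rank_one_oper (ell2 Y) (basis_vec u) w -\<^sub>o \<mu>)\<inverse>)" (is "_ = lower_block ?A ?B ?C")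
proof -
  have comp: "?B = {(h, - N_resolvent \<mu> (cinner2 h (coefficient \<mu>) *\<^sub>c f)) |h. h \<in> ell2 U}"
    unfolding oslash_resolvent_graph N_resolvent_graph unfolding op_comp_def op_neg_def
    using ell2_scale[OF f] by (auto simp: relcomp_unfold)
  show ?thesis
    unfolding comp unfolding resolvent_graph diag_resolvent_graph N_resolvent_graph lower_block_def
  proof (intro equalityI subsetI)
    fix p assume "p \<in> {(h, resolvent \<mu> h) |h. h \<in> ell2 (U \<union> Y)}"
    then obtain h where p: "p = (h, resolvent \<mu> h)" and h: "h \<in> ell2 (U \<union> Y)" by blast
    have split: "h = restrict_U h + restrict_Y h" by (rule restrict_split[OF h])
    show "p \<in> {(h + k, a + (b + c)) |h k a b c.
        (h, a) \<in> {(h, \<lambda>v. if v \<in> U then h v / (lam v - \<mu>) else 0) |h. h \<in> ell2 U}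
        \<and> (h, b) \<in> {(h, - N_resolvent \<mu> (cinner2 h (coefficient \<mu>) *\<^sub>c f)) |h. h \<in> ell2 U}
        \<and> (k, c) \<in> {(k, N_resolvent \<mu> k) |k. k \<in> ell2 Y}}"
      using resolvent_block_sum[OF restrict_U_ell2[OF h] restrict_Y_ell2[OF h]]
        restrict_U_ell2[OF h] restrict_Y_ell2[OF h] p split by force
  next
    fix p assume "p \<in> {(h + k, a + (b + c)) |h k a b c.
        (h, a) \<in> {(h, \<lambda>v. if v \<in> U then h v / (lam v - \<mu>) else 0) |h. h \<in> ell2 U}
        \<and> (h, b) \<in> {(h, - N_resolvent \<mu> (cinner2 h (coefficient \<mu>) *\<^sub>c f)) |h. h \<in> ell2 U}
        \<and> (k, c) \<in> {(k, N_resolvent \<mu> k) |k. k \<in> ell2 Y}}"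
    then obtain h k where h: "h \<in> ell2 U" and k: "k \<in> ell2 Y" and p: "p = (h + k,
        (\<lambda>v. if v \<in> U then h v / (lam v - \<mu>) else 0)
        + (- N_resolvent \<mu> (cinner2 h (coefficient \<mu>) *\<^sub>c f) + N_resolvent \<mu> k))"
      by blast
    show "p \<in> {(h, resolvent \<mu> h) |h. h \<in> ell2 (U \<union> Y)}"
      unfolding p resolvent_block_sum[OF h k, symmetric]
      using ell2_add[OF ell2_U_ell2[OF h] ell2_Y_ell2[OF k]] by blast
  qed
qed

text \<open>
  The corner of the resolvent is \<open>h \<mapsto> \<langle>h, q\<rangle> f\<close> with \<open>q\<close> the coefficient vector, so its kernel is the
  product of \<open>f\<close> and the conjugate of \<open>q\<close>, both square summable.
\<close>

lemma hilbert_schmidt_corner: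
  "hilbert_schmidt_integral_oper U Y (oslash_oper U f g \<circ>\<^sub>o (diag_oper U lam -\<^sub>o \<mu>)\<inverse>)"
  unfolding hilbert_schmidt_integral_oper_def
proof (intro exI conjI)
  let ?k = "\<lambda>z v. f z * cnj (coefficient \<mu> v)"
  have "(norm2 (coefficient \<mu>))\<^sup>2 = (\<Sum>\<^sub>\<infinity>v\<in>U. (cmod (coefficient \<mu> v))\<^sup>2)"
    unfolding norm2_power2 by (rule infsum_cong_neutral) (auto simp: coefficient_def)
  then have sum: "((\<lambda>v. (cmod (coefficient \<mu> v))\<^sup>2) has_sum (norm2 (coefficient \<mu>))\<^sup>2) U"
    using summable_norm2_ell2[OF coeff] by simp
  have "(\<lambda>(z, v). (cmod (f z))\<^sup>2 * (cmod (coefficient \<mu> v))\<^sup>2) summable_on Y \<times> U"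
    by (rule summable_on_SigmaI[where g = "\<lambda>z. (cmod (f z))\<^sup>2 * (norm2 (coefficient \<mu>))\<^sup>2"])
      (auto intro!: has_sum_cmult_right[OF sum] summable_on_cmult_left summable_norm2_ell2[OF f])
  then show "(\<lambda>(z, v). (cmod (?k z v))\<^sup>2) summable_on Y \<times> U"
    by (simp add: norm_mult power_mult_distrib)
  have "(\<lambda>z. if z \<in> Y then \<Sum>\<^sub>\<infinity>v\<in>U. ?k z v * h v else 0) = cinner2 h (coefficient \<mu>) *\<^sub>c f" for h
  proof -
    have "(\<Sum>\<^sub>\<infinity>v\<in>U. h v * cnj (coefficient \<mu> v)) = cinner2 h (coefficient \<mu>)"
      unfolding cinner2_def by (rule infsum_cong_neutral) (auto simp: coefficient_def)
    then have "(\<Sum>\<^sub>\<infinity>v\<in>U. ?k z v * h v) = f z * cinner2 h (coefficient \<mu>)" for z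
      using infsum_cmult_right'[of "f z" "\<lambda>v. h v * cnj (coefficient \<mu> v)" U] by (simp add: mult_ac)
    then show ?thesis using outside_Y(1) by (auto simp: fun_eq_iff cscale_def)
  qed
  then show "oslash_oper U f g \<circ>\<^sub>o (diag_oper U lam -\<^sub>o \<mu>)\<inverse>
      = {(h, \<lambda>z. if z \<in> Y then \<Sum>\<^sub>\<infinity>v\<in>U. ?k z v * h v else 0) |h. h \<in> ell2 U}"
    unfolding oslash_resolvent_graph by simp
qed

end

text \<open>
  If \<open>z\<close> is an eigenvalue with eigenvector \<open>a\<close>, the inverse maps \<open>(z - \<mu>) a\<close> to \<open>a\<close>, so its bound \<open>C\<close>
  satisfies \<open>1 \<le> C |z - \<mu>|\<close> and keeps all eigenvalues at a positive distance from \<open>\<mu>\<close>.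
\<close>

lemma bounded_inverse_imp_outside_closure:
  assumes "bounded_on_whole (ell2 X) ((S -\<^sub>o \<mu>)\<inverse>)"
  shows "\<mu> \<notin> closure (point_spectrum S)"
proof
  assume cl: "\<mu> \<in> closure (point_spectrum S)"
  obtain C where lin: "linear_oper (ell2 X) (ell2 X) ((S -\<^sub>o \<mu>)\<inverse>)"
    and C: "\<And>y a. (y, a) \<in> (S -\<^sub>o \<mu>)\<inverse> \<Longrightarrow> norm2 a \<le> C * norm2 y"
    using assms unfolding bounded_on_whole_def by blast
  obtain z where z: "z \<in> point_spectrum S" "dist z \<mu> < 1 / (\<bar>C\<bar> + 1)"
    using cl unfolding closure_approachable
    by (metis abs_ge_zero add_nonneg_pos zero_less_divide_1_iff zero_less_one)
  obtain a where a: "a \<noteq> 0" "(a, z *\<^sub>c a) \<in> S" using z unfolding point_spectrum_def by blast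
  have eq: "z *\<^sub>c a - \<mu> *\<^sub>c a = (z - \<mu>) *\<^sub>c a"
    by (simp add: fun_eq_iff cscale_def algebra_simps)
  have mem: "((z - \<mu>) *\<^sub>c a, a) \<in> (S -\<^sub>o \<mu>)\<inverse>"
    using a(2) unfolding op_shift_def eq[symmetric] by blast
  then have aX: "a \<in> ell2 X" using lin unfolding linear_oper_def by blast
  have pos: "0 < norm2 a" by (rule norm2_pos[OF aX a(1)])
  have "norm2 a \<le> C * norm2 ((z - \<mu>) *\<^sub>c a)" by (rule C[OF mem])
  also have "\<dots> \<le> \<bar>C\<bar> * (cmod (z - \<mu>) * norm2 a)"
    by (intro mult_mono norm2_scale_le[OF aX]) auto
  finally have "1 \<le> \<bar>C\<bar> * cmod (z - \<mu>)" using pos by (simp add: mult.assoc[symmetric])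
  also have "\<dots> \<le> (\<bar>C\<bar> + 1) * cmod (z - \<mu>)" by (intro mult_right_mono) auto
  finally show False using z(2) by (simp add: dist_norm field_simps)
qed

text \<open>
  Let \<open>q\<close> be the coefficient vector and \<open>T = \<Sum> |q v|\<^sup>2\<close> over a finite \<open>F \<subseteq> U\<close>.  The vector \<open>q\<close> cut off
  to \<open>F\<close> has norm \<open>sqrt T\<close>, and the functional takes the value \<open>T\<close> on its image under \<open>(D - \<mu>)\<inverse>\<close>.  The
  preimage of the cut-off vector under \<open>W - \<mu>\<close> therefore has the component \<open>- T (N - \<mu>)\<inverse> f\<close> in \<open>\<ell>\<^sup>2(Y)\<close>.
  Boundedness of the inverse gives \<open>T \<le> const * sqrt T\<close>, a bound on \<open>T\<close> uniform in \<open>F\<close>, because \<open>(N - \<mu>)\<inverse> f \<noteq> 0\<close>.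
\<close>

lemma bounded_inverse_imp_compat_I:
  assumes bd: "bounded_on_whole (ell2 (U \<union> Y)) ((W -\<^sub>o \<mu>)\<inverse>)"
  shows "compat_I U lam g"
proof -
  obtain e where e: "e > 0" "\<And>v. v \<in> U \<Longrightarrow> e \<le> cmod (lam v - \<mu>)" and \<mu>: "\<mu> \<notin> sigma_N"
    using gap_outside_closure[OF bounded_inverse_imp_outside_closure[OF bd]] by blast
  have nonzero: "lam v - \<mu> \<noteq> 0" if "v \<in> U" for v using e(1) e(2)[OF that] by auto
  obtain C where C: "\<And>y a. (y, a) \<in> (W -\<^sub>o \<mu>)\<inverse> \<Longrightarrow> norm2 a \<le> C * norm2 y"
    using bd unfolding bounded_on_whole_def by blast
  define r where "r = N_resolvent \<mu> f"
  have r: "r \<in> ell2 Y" unfolding r_def by (rule N_resolvent_ell2[OF f])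
  have rpos: "0 < norm2 r"
    unfolding r_def by (intro norm2_pos[OF N_resolvent_ell2[OF f]] N_resolvent_nonzero \<mu> f f_nonzero)
  define q where "q = coefficient \<mu>"
  have bound: "(\<Sum>v\<in>F. (cmod (q v))\<^sup>2) \<le> (C / norm2 r)\<^sup>2" if F: "finite F" "F \<subseteq> U" for F
  proof -
    define T where "T = (\<Sum>v\<in>F. (cmod (q v))\<^sup>2)"
    define h where "h = (\<lambda>v. if v \<in> F then q v else 0)"
    have T: "0 \<le> T" unfolding T_def by (rule sum_nonneg) simp
    have "(norm2 h)\<^sup>2 = (\<Sum>v\<in>F. (cmod (h v))\<^sup>2)"
      by (rule ell2_finite_support(2)[of F h U]) (use F in \<open>auto simp: h_def\<close>)
    then have hT: "(norm2 h)\<^sup>2 = T" by (simp add: T_def h_def)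
    \<comment> \<open>The \<open>Y\<close>-component is chosen to cancel \<open>f\<close> times the value of the functional.\<close>
    define a where "a = (\<lambda>v. if v \<in> F then q v / (lam v - \<mu>) else 0) + (- of_real T) *\<^sub>c r"
    have rU: "r v = 0" if "v \<in> U" for v by (rule ell2_outside[OF r on_U[OF that]])
    have aU: "a v = (if v \<in> F then q v / (lam v - \<mu>) else 0)" if "v \<in> U" for v
      using rU[OF that] by (simp add: a_def cscale_def)
    have aV: "a \<in> ell2 (U \<union> Y)" unfolding a_def
      by (intro ell2_add ell2_finite_support(1)[OF F(1)] ell2_Y_ell2 ell2_scale r) (use F in auto)
    have dom: "a \<in> dom" and fn: "functional a = (\<Sum>v\<in>F. a v * cnj (g v))"
      using finite_support_dom[OF F aV] aU by auto
    have "a v * cnj (g v) = of_real ((cmod (q v))\<^sup>2)" if "v \<in> F" for v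
    proof -
      have "cnj (q v) = cnj (g v) / (lam v - \<mu>)"
        using that F by (auto simp: q_def coefficient_def)
      then show ?thesis
        using that F aU[of v] complex_norm_square[of "q v"] by (auto simp: subset_iff)
    qed
    then have fnT: "functional a = of_real T" unfolding fn T_def by simp
    have ra: "restrict_Y a = (- of_real T) *\<^sub>c r"
      using r F on_U by (auto simp: fun_eq_iff restrict_Y_def a_def cscale_def ell2_outside subset_iff)
    have "cinner2 a w *\<^sub>c basis_vec u - \<mu> *\<^sub>c restrict_Y a
        = (- of_real T) *\<^sub>c (cinner2 r w *\<^sub>c basis_vec u - \<mu> *\<^sub>c r)"
      unfolding cinner2_w_restrict[of a] ra cinner2_scale_left
      by (simp add: fun_eq_iff cscale_def algebra_simps)
    also have "\<dots> = (- of_real T) *\<^sub>c f" unfolding r_def by (simp add: N_resolvent_inverse(1)[OF \<mu> f])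
    finally have eq: "cinner2 a w * basis_vec u v - \<mu> * restrict_Y a v = - of_real T * f v" for v
      by (simp add: fun_eq_iff cscale_def)
    have "act a v - \<mu> * a v = h v" for v
    proof (cases "v \<in> U")
      case True
      then show ?thesis using aU[OF True] nonzero[OF True] by (auto simp: act_def h_def field_simps)
    next
      case False
      have "a v = restrict_Y a v" using False aV by (simp add: restrict_Y_def ell2_outside)
      then show ?thesis using eq[of v] False F by (auto simp: act_def fnT h_def algebra_simps)
    qed
    then have "act a - \<mu> *\<^sub>c a = h" by (simp add: fun_eq_iff cscale_def)
    then have "(h, a) \<in> (W -\<^sub>o \<mu>)\<inverse>" unfolding shift_eq using dom by blast
    then have "norm2 a \<le> C * norm2 h" by (rule C)
    moreover have "norm2 (restrict_Y a) \<le> norm2 a"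
      unfolding restrict_Y_def by (rule norm2_restrict_le[OF aV])
    moreover have "T * norm2 r = norm2 (restrict_Y a)"
    proof -
      have "(T * norm2 r)\<^sup>2 = (norm2 (restrict_Y a))\<^sup>2"
        unfolding ra power_mult_distrib norm2_power2
        using T by (simp add: cscale_def norm_mult power_mult_distrib infsum_cmult_right')
      then show ?thesis using T by (simp add: power2_eq_iff_nonneg)
    qed
    ultimately have le: "T * norm2 r \<le> C * norm2 h" by linarith
    show ?thesis
    proof (cases "T = 0")
      case True
      then show ?thesis using T_def by simp
    next
      case False
      then have "T > 0" using T by simp
      then have h0: "norm2 h > 0" using hT norm2_nonneg[of h] by (auto simp: less_le)
      have "(norm2 h * norm2 r) * norm2 h \<le> C * norm2 h"
        using le unfolding hT[symmetric] by (simp add: power2_eq_square algebra_simps)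
      then have "norm2 h * norm2 r \<le> C" using h0 by (simp add: mult.commute)
      then have "norm2 h \<le> C / norm2 r" using rpos by (simp add: field_simps)
      then have "(norm2 h)\<^sup>2 \<le> (C / norm2 r)\<^sup>2" by (intro power_mono) auto
      then show ?thesis using hT by (simp add: T_def)
    qed
  qed
  have sm: "(\<lambda>v. (cmod (q v))\<^sup>2) summable_on U"
    by (rule nonneg_bdd_above_summable_on) (use bound in \<open>auto simp: bdd_above_def\<close>)
  have "(\<lambda>v. (cmod (g v))\<^sup>2 / (cmod (lam v - \<mu>))\<^sup>2) summable_on U"
    using sm by (rule summable_on_cong[THEN iffD1, rotated])
      (simp add: q_def coefficient_def norm_divide power_divide complex_mod_cnj[symmetric, of "lam _ - \<mu>"]
        del: complex_mod_cnj)
  moreover have "0 < (INF v\<in>U. ereal (cmod (\<mu> - lam v)))"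
  proof (rule less_le_trans)
    show "0 < ereal e" using e(1) by simp
    show "ereal e \<le> (INF v\<in>U. ereal (cmod (\<mu> - lam v)))"
      by (rule INF_greatest) (use e(2) in \<open>simp add: norm_minus_commute\<close>)
  qed
  ultimately show ?thesis unfolding compat_I_def by blast
qed

lemma spectrum_eq:
  "op_spectrum (ell2 (U \<union> Y)) W = (if compat_I U lam g then closure (point_spectrum W) else UNIV)"
proof -
  have "bounded_on_whole (ell2 (U \<union> Y)) ((W -\<^sub>o \<mu>)\<inverse>)"
    if c: "compat_I U lam g" and cl: "\<mu> \<notin> closure (point_spectrum W)" for \<mu>
  proof -
    obtain e where e: "e > 0" "\<And>v. v \<in> U \<Longrightarrow> e \<le> cmod (lam v - \<mu>)" and \<mu>: "\<mu> \<notin> sigma_N"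
      using gap_outside_closure[OF cl] by blast
    show ?thesis by (rule resolvent_bounded[OF e \<mu> coefficient_ell2[OF c e]])
  qed
  then show ?thesis
    unfolding op_spectrum_def
    using bounded_inverse_imp_outside_closure[of "U \<union> Y" W] bounded_inverse_imp_compat_I by auto
qed

end



section \<open>Essential spectrum and index\<close>

lemma finite_superlevel:
  assumes q: "q \<in> ell2 X" and d: "d > 0"
  shows "finite {v. d \<le> cmod (q v)}"
proof (rule ccontr)
  assume inf: "infinite {v. d \<le> cmod (q v)}"
  obtain n :: nat where n: "(norm2 q)\<^sup>2 / d\<^sup>2 < real n" using reals_Archimedean2 by blast
  obtain F where F: "F \<subseteq> {v. d \<le> cmod (q v)}" "finite F" "card F = n"
    using infinite_arbitrarily_large[OF inf] by blast
  have "real n * d\<^sup>2 = (\<Sum>v\<in>F. d\<^sup>2)" using F(3) by simp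
  also have "\<dots> \<le> (\<Sum>v\<in>F. (cmod (q v))\<^sup>2)"
    using F(1) d by (intro sum_mono power_mono) auto
  also have "\<dots> \<le> (norm2 q)\<^sup>2"
    unfolding norm2_power2 by (rule finite_sum_le_infsum) (use F(2) summable_norm2_ell2[OF q] in auto)
  finally show False using n d by (simp add: field_simps)
qed

lemma cnj_cinner2: "cnj (cinner2 h k) = cinner2 k h"
  by (rule cinner2_commute[symmetric])

lemma kernel_adjoint:
  "op_ker (adjoint_in (ell2 X) S) = {y \<in> ell2 X. \<forall>r\<in>Range S. cinner2 r y = 0}"
proof -
  have "cinner2 a 0 = 0" for a :: "'a \<Rightarrow> complex" by (simp add: cinner2_def)
  then show ?thesis by (auto simp: op_ker_def adjoint_in_def ell2_zero)
qed

text \<open>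
  Passing from \<open>S\<^sup>* - cnj \<mu>\<close>, which occurs in the index, to \<open>(S - \<mu>)\<^sup>*\<close>, whose kernel is the
  orthogonal complement of the range.
\<close>

lemma kernel_adjoint_shift:
  assumes S: "S \<subseteq> ell2 X \<times> ell2 X"
  shows "op_ker (adjoint_in (ell2 X) S -\<^sub>o cnj \<mu>) = op_ker (adjoint_in (ell2 X) (S -\<^sub>o \<mu>))"
proof -
  have right: "cinner2 a (cnj \<mu> *\<^sub>c y) = \<mu> * cinner2 a y" for a y :: "'a \<Rightarrow> complex"
    by (subst cinner2_commute, subst cinner2_scale_left) (simp add: cinner2_commute[of a y])
  have "cinner2 (b - \<mu> *\<^sub>c a) y = cinner2 b y - \<mu> * cinner2 a y"
    if "(a, b) \<in> S" "y \<in> ell2 X" for a b y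
    using that S cinner2_diff_left[of b X "\<mu> *\<^sub>c a" X y X] ell2_scale[of a X \<mu>]
    by (auto simp: cinner2_scale_left)
  then have *: "cinner2 (b - \<mu> *\<^sub>c a) y = 0 \<longleftrightarrow> cinner2 b y = cinner2 a (cnj \<mu> *\<^sub>c y)"
    if "(a, b) \<in> S" "y \<in> ell2 X" for a b y
    using that by (simp add: right)
  have "op_ker (adjoint_in (ell2 X) S -\<^sub>o cnj \<mu>)
      = {y \<in> ell2 X. \<forall>(a, b)\<in>S. cinner2 b y = cinner2 a (cnj \<mu> *\<^sub>c y)}"
    unfolding op_ker_def op_shift_def adjoint_in_def by (auto simp: ell2_scale)
  also have "\<dots> = {y \<in> ell2 X. \<forall>r\<in>Range (S -\<^sub>o \<mu>). cinner2 r y = 0}"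
    unfolding op_shift_def using * by fastforce
  finally show ?thesis unfolding kernel_adjoint .
qed

context rank_one_block
begin

definition level_set :: "complex \<Rightarrow> 'v set" where
  "level_set \<mu> = {v \<in> U. lam v = \<mu>}"

text \<open>
  Isolation among the distinct diagonal entries; the multiplicity of \<open>\<mu>\<close> itself is a separate matter,
  measured by \<open>level_set\<close>.
\<close>

definition isolated :: "complex \<Rightarrow> bool" where
  "isolated \<mu> \<longleftrightarrow> (\<exists>e>0. \<forall>v\<in>U. lam v \<noteq> \<mu> \<longrightarrow> e \<le> cmod (lam v - \<mu>))"

context
  fixes \<mu> :: complex
  assumes compat: "compat_I U lam g" and level: "finite (level_set \<mu>)" and iso: "isolated \<mu>"
    and \<mu>: "\<mu> \<noteq> 0 \<or> finite Y"
begin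

text \<open>
  The definitions up to \<open>generators\<close> factor \<open>W - \<mu>\<close> as \<open>B\<close> after the inverse of an injective
  diagonal operator \<open>precond\<close>, with \<open>B\<close> equal to \<open>scalar\<close> up to finite rank.  On \<open>Y\<close> the operator
  \<open>N - \<mu>\<close> is a rank one perturbation of \<open>- \<mu>\<close>, so for infinite \<open>Y\<close> the scalar has to be \<open>- \<mu>\<close>; on
  \<open>U\<close> any nonzero scalar can be arranged by the choice of \<open>multiplier\<close>.  If \<open>\<mu> = 0\<close>, then \<open>Y\<close> is finite and the scalar \<open>1\<close> serves.
\<close>

definition scalar :: complex where
  "scalar = (if \<mu> = 0 then 1 else - \<mu>)"

definition multiplier :: "'v \<Rightarrow> complex" where
  "multiplier v = (if v \<in> U \<and> lam v \<noteq> \<mu> then scalar / (lam v - \<mu>) else 1)"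

definition precond :: "('v \<Rightarrow> complex) \<Rightarrow> 'v \<Rightarrow> complex" where
  "precond h = (\<lambda>v. multiplier v * h v)"

text \<open>
  The finitely many coordinates where, even after rescaling by \<open>multiplier\<close>, the diagonal part of
  \<open>W - \<mu>\<close> is \<open>0\<close> instead of the scalar.
\<close>

definition correction :: "'v set" where
  "correction = level_set \<mu> \<union> (if \<mu> = 0 then Y else {})"

definition coeff :: "'v \<Rightarrow> complex" where
  "coeff = (\<lambda>v. if v \<in> U then cnj (multiplier v) * g v else 0)"

definition project :: "('v \<Rightarrow> complex) \<Rightarrow> 'v \<Rightarrow> complex" where
  "project h = (\<lambda>v. if v \<in> correction then h v else 0)"

text \<open>
  The composition of \<open>W - \<mu>\<close> with \<open>precond\<close>, by \<open>act_precond\<close> below.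
\<close>

definition B :: "('v \<Rightarrow> complex) \<Rightarrow> 'v \<Rightarrow> complex" where
  "B h = scalar *\<^sub>c h + (cinner2 h coeff *\<^sub>c f + cinner2 h w *\<^sub>c x - scalar *\<^sub>c project h)"

text \<open>
  The adjoint of \<open>B\<close>.
\<close>

definition B' :: "('v \<Rightarrow> complex) \<Rightarrow> 'v \<Rightarrow> complex" where
  "B' h = cnj scalar *\<^sub>c h + (cinner2 h f *\<^sub>c coeff + cinner2 h x *\<^sub>c w - cnj scalar *\<^sub>c project h)"

definition generators :: "('v \<Rightarrow> complex) set" where
  "generators = {f, x, w, coeff} \<union> basis_vec ` correction"

lemma scalar_nonzero: "scalar \<noteq> 0"
  by (simp add: scalar_def)

lemma multiplier_nonzero: "multiplier v \<noteq> 0"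
  by (simp add: multiplier_def scalar_nonzero)

lemma correction: "finite correction" "correction \<subseteq> U \<union> Y"
  using level \<mu> by (auto simp: correction_def level_set_def)

lemma multiplier_bounded:
  obtains C where "C \<ge> 0" "\<And>v. cmod (multiplier v) \<le> C"
proof -
  obtain e where e: "e > 0" "\<And>v. v \<in> U \<Longrightarrow> lam v \<noteq> \<mu> \<Longrightarrow> e \<le> cmod (lam v - \<mu>)"
    using iso unfolding isolated_def by blast
  have "cmod (multiplier v) \<le> 1 + cmod scalar / e" for v
  proof (cases "v \<in> U \<and> lam v \<noteq> \<mu>")
    case True
    then have "cmod scalar / cmod (lam v - \<mu>) \<le> cmod scalar / e"
      using e by (intro frac_le) auto
    then show ?thesis using True by (simp add: multiplier_def norm_divide)
  next
    case False
    then have "multiplier v = 1" by (auto simp: multiplier_def)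
    then show ?thesis using e(1) by simp
  qed
  moreover have "0 \<le> 1 + cmod scalar / e" using e(1) by simp
  ultimately show ?thesis using that by blast
qed

lemma coeff_ell2: "coeff \<in> ell2 U"
proof -
  obtain C where C: "\<And>v. cmod (multiplier v) \<le> C" using multiplier_bounded by blast
  have "cmod (multiplier v) * cmod (lam v - \<mu>) \<le> cmod scalar" if "v \<in> U" for v
    using that by (simp add: multiplier_def norm_divide)
  then show ?thesis
    unfolding coeff_def by (intro compat_I_weighted_ell2[OF compat, where C = C and \<mu> = \<mu>]) (simp_all add: C)
qed

lemma precond_ell2: assumes "h \<in> ell2 X" shows "precond h \<in> ell2 X"
proof -
  obtain C where C: "C \<ge> 0" "\<And>v. cmod (multiplier v) \<le> C" using multiplier_bounded by blast
  show ?thesis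
    by (rule ell2_dominated(1)[OF assms _ C(1)])
      (use assms C(2) in \<open>auto simp: precond_def norm_mult ell2_outside intro: mult_right_mono\<close>)
qed

lemma precond_surj:
  assumes a: "a \<in> dom"
  obtains h where "h \<in> ell2 (U \<union> Y)" "a = precond h"
proof -
  define h where "h = (\<lambda>v. a v / multiplier v)"
  define la where "la = (\<lambda>v. if v \<in> U then lam v * a v else 0)"
  have aV: "a \<in> ell2 (U \<union> Y)" and la: "la \<in> ell2 U" using a by (simp_all add: dom_def la_def)
  have h_eq: "h = (\<lambda>v. if v \<in> - {v \<in> U. lam v \<noteq> \<mu>} then a v else 0)
      + (1 / scalar) *\<^sub>c (\<lambda>v. if v \<in> {v \<in> U. lam v \<noteq> \<mu>} then (la - \<mu> *\<^sub>c a) v else 0)"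
    using scalar_nonzero by (auto simp: fun_eq_iff h_def multiplier_def la_def cscale_def field_simps)
  have part1: "(\<lambda>v. if v \<in> - {v \<in> U. lam v \<noteq> \<mu>} then a v else 0) \<in> ell2 (U \<union> Y)"
    by (rule ell2_mono[OF _ ell2_restrict[OF aV]]) simp
  have "la - \<mu> *\<^sub>c a \<in> ell2 (U \<union> Y)"
    by (intro ell2_diff ell2_scale aV ell2_U_ell2 la)
  then have part2: "(\<lambda>v. if v \<in> {v \<in> U. lam v \<noteq> \<mu>} then (la - \<mu> *\<^sub>c a) v else 0) \<in> ell2 (U \<union> Y)"
    by (rule ell2_mono[OF _ ell2_restrict, rotated]) simp
  have "h \<in> ell2 (U \<union> Y)" unfolding h_eq by (intro ell2_add ell2_scale part1 part2)
  moreover have "a = precond h" using multiplier_nonzero by (simp add: fun_eq_iff precond_def h_def)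
  ultimately show ?thesis using that by blast
qed

lemma precond_dom:
  assumes h: "h \<in> ell2 (U \<union> Y)"
  shows "precond h \<in> dom" "functional (precond h) = cinner2 h coeff"
proof -
  have eq: "(\<lambda>v. if v \<in> U then lam v * precond h v else 0)
      = \<mu> *\<^sub>c restrict_U (precond h) + scalar *\<^sub>c (\<lambda>v. if v \<in> {v \<in> U. lam v \<noteq> \<mu>} then h v else 0)"
    by (auto simp: fun_eq_iff precond_def restrict_U_def multiplier_def cscale_def field_simps)
  have "(\<lambda>v. if v \<in> {v \<in> U. lam v \<noteq> \<mu>} then h v else 0) \<in> ell2 U"
    by (rule ell2_mono[OF _ ell2_restrict[OF h]]) auto
  then have "(\<lambda>v. if v \<in> U then lam v * precond h v else 0) \<in> ell2 U"
    unfolding eq by (intro ell2_add ell2_scale restrict_U_ell2[OF precond_ell2[OF h]])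
  moreover have eq: "h v * cnj (coeff v) = precond h v * cnj (g v)" if "v \<in> U" for v
    using that by (simp add: coeff_def precond_def)
  then have "(\<lambda>v. precond h v * cnj (g v)) summable_on U"
    by (intro summable_on_cong[THEN iffD1, OF _ ell2_mult_summable[OF h coeff_ell2]])
  ultimately show "precond h \<in> dom" using precond_ell2[OF h] by (simp add: dom_def)
  show "functional (precond h) = cinner2 h coeff"
    unfolding functional_def cinner2_def
    by (rule infsum_cong_neutral) (auto simp: coeff_def precond_def)
qed

lemma act_precond:
  assumes h: "h \<in> ell2 (U \<union> Y)"
  shows "act (precond h) - \<mu> *\<^sub>c precond h = B h"
proof -
  have inner: "cinner2 (precond h) w = cinner2 h w"
    by (rule cinner2_cong) (use on_U outside_Y(3) in \<open>auto simp: precond_def multiplier_def\<close>)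
  have "act (precond h) v - \<mu> * precond h v = B h v" for v
  proof (cases "v \<in> U")
    case True
    then have vY: "v \<notin> Y" by (rule on_U)
    have "(lam v - \<mu>) * multiplier v = (if lam v = \<mu> then 0 else scalar)"
      using True by (simp add: multiplier_def)
    then have "(lam v - \<mu>) * multiplier v * h v = (if lam v = \<mu> then 0 else scalar * h v)" by simp
    moreover have "act (precond h) v - \<mu> * precond h v = (lam v - \<mu>) * multiplier v * h v"
      using True by (simp add: act_def precond_def algebra_simps)
    moreover have "v \<in> correction \<longleftrightarrow> lam v = \<mu>"
      using True vY by (auto simp: correction_def level_set_def)
    ultimately show ?thesis
      using outside_Y(1,2)[OF vY] by (simp add: B_def project_def cscale_def)
  next
    case False
    then have "precond h v = h v" by (simp add: precond_def multiplier_def)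
    moreover have "act (precond h) v = cinner2 h coeff * f v + cinner2 h w * x v"
      using False by (simp add: act_def precond_dom(2)[OF h] inner)
    moreover have "v \<in> correction \<longleftrightarrow> \<mu> = 0 \<and> v \<in> Y"
      using False by (auto simp: correction_def level_set_def)
    ultimately show ?thesis
      using ell2_outside[OF h, of v] outside_Y(1,2)[of v] False
      by (auto simp: B_def project_def cscale_def scalar_def)
  qed
  then show ?thesis by (simp add: fun_eq_iff cscale_def)
qed

lemma project_ell2: "project h \<in> ell2 (U \<union> Y)"
  using correction by (intro ell2_finite_support(1)[of correction]) (auto simp: project_def)

lemma shift_precond: "W -\<^sub>o \<mu> = {(precond h, B h) |h. h \<in> ell2 (U \<union> Y)}"
proof -
  have "\<exists>h. (a, act a - \<mu> *\<^sub>c a) = (precond h, B h) \<and> h \<in> ell2 (U \<union> Y)" if "a \<in> dom" for a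
  proof -
    obtain h where h: "h \<in> ell2 (U \<union> Y)" "a = precond h" by (rule precond_surj[OF \<open>a \<in> dom\<close>])
    then show ?thesis using act_precond[OF h(1)] by auto
  qed
  moreover have "\<exists>a. (precond h, B h) = (a, act a - \<mu> *\<^sub>c a) \<and> a \<in> dom" if "h \<in> ell2 (U \<union> Y)" for h
    using act_precond[OF that] precond_dom(1)[OF that] by metis
  ultimately show ?thesis unfolding shift_eq by blast
qed

lemma generators: "finite generators" "generators \<subseteq> ell2 (U \<union> Y)"
  using correction ell2_Y_ell2 f x w ell2_U_ell2[OF coeff_ell2]
  by (auto simp: generators_def intro: basis_vec_ell2)

lemma project_span: "project h \<in> cfun.span generators"
  unfolding project_def using finite_support_in_span[OF correction(1), of h]
    cfun.span_mono[of "basis_vec ` correction" generators] by (auto simp: generators_def subset_iff)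

lemma generators_span: "f \<in> cfun.span generators" "x \<in> cfun.span generators" "w \<in> cfun.span generators" "coeff \<in> cfun.span generators"
  by (auto simp: generators_def intro: cfun.span_base)

lemma combination_linear:
  assumes "p \<in> ell2 (U \<union> Y)" "q \<in> ell2 (U \<union> Y)"
  shows "linear_on (ell2 (U \<union> Y))
    (\<lambda>h. s *\<^sub>c h + (cinner2 h p *\<^sub>c p' + cinner2 h q *\<^sub>c q' - s *\<^sub>c project h))"
  unfolding linear_on_def
proof (intro ballI allI)
  fix h k c assume h: "h \<in> ell2 (U \<union> Y)" and k: "k \<in> ell2 (U \<union> Y)"
  have "cinner2 (c *\<^sub>c h + k) r = c * cinner2 h r + cinner2 k r" if "r \<in> ell2 (U \<union> Y)" for r
    using cinner2_add_left[OF ell2_scale[OF h] k that] by (simp add: cinner2_scale_left)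
  note inner = this[OF assms(1)] this[OF assms(2)]
  show "s *\<^sub>c (c *\<^sub>c h + k) + (cinner2 (c *\<^sub>c h + k) p *\<^sub>c p' + cinner2 (c *\<^sub>c h + k) q *\<^sub>c q'
        - s *\<^sub>c project (c *\<^sub>c h + k))
      = c *\<^sub>c (s *\<^sub>c h + (cinner2 h p *\<^sub>c p' + cinner2 h q *\<^sub>c q' - s *\<^sub>c project h))
        + (s *\<^sub>c k + (cinner2 k p *\<^sub>c p' + cinner2 k q *\<^sub>c q' - s *\<^sub>c project k))"
    unfolding inner by (auto simp: fun_eq_iff cscale_def project_def algebra_simps)
qed

lemma combination_ell2:
  assumes "p' \<in> ell2 (U \<union> Y)" "q' \<in> ell2 (U \<union> Y)" "h \<in> ell2 (U \<union> Y)"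
  shows "s *\<^sub>c h + (t *\<^sub>c p' + t' *\<^sub>c q' - s *\<^sub>c project h) \<in> ell2 (U \<union> Y)"
  by (intro ell2_add ell2_diff ell2_scale assms project_ell2)

lemma combination_inner:
  assumes "p' \<in> ell2 (U \<union> Y)" "q' \<in> ell2 (U \<union> Y)" "h \<in> ell2 (U \<union> Y)" "k \<in> ell2 (U \<union> Y)"
  shows "cinner2 (s *\<^sub>c h + (t *\<^sub>c p' + t' *\<^sub>c q' - s *\<^sub>c project h)) k
    = s * cinner2 h k + (t * cinner2 p' k + t' * cinner2 q' k - s * cinner2 (project h) k)"
proof -
  note 2 = ell2_scale[OF assms(1)] ell2_scale[OF assms(2)] ell2_scale[OF assms(3)] ell2_scale[OF project_ell2]
  show ?thesis
    by (simp only: cinner2_add_left[OF 2(3) ell2_diff[OF ell2_add[OF 2(1,2)] 2(4)] assms(4)]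
        cinner2_diff_left[OF ell2_add[OF 2(1,2)] 2(4) assms(4)]
        cinner2_add_left[OF 2(1,2) assms(4)] cinner2_scale_left)
qed

lemma B_perturbation: "finite_rank_perturbation (U \<union> Y) B B' generators scalar"
proof
  note V = ell2_Y_ell2[OF f] ell2_Y_ell2[OF x] ell2_Y_ell2[OF w] ell2_U_ell2[OF coeff_ell2]
  show "B ` ell2 (U \<union> Y) \<subseteq> ell2 (U \<union> Y)" "B' ` ell2 (U \<union> Y) \<subseteq> ell2 (U \<union> Y)"
    unfolding B_def[abs_def] B'_def[abs_def] using combination_ell2 V by blast+
  show "linear_on (ell2 (U \<union> Y)) B" "linear_on (ell2 (U \<union> Y)) B'"
    unfolding B_def[abs_def] B'_def[abs_def] by (rule combination_linear; rule V)+
  show "finite generators" "generators \<subseteq> ell2 (U \<union> Y)" "scalar \<noteq> 0" using generators scalar_nonzero by auto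
  show "B h - scalar *\<^sub>c h \<in> cfun.span generators" for h
    unfolding B_def add_diff_cancel_left'
    by (intro cfun.span_diff cfun.span_add cfun.span_scale generators_span project_span)
  show "B' h - cnj scalar *\<^sub>c h \<in> cfun.span generators" for h
    unfolding B'_def add_diff_cancel_left'
    by (intro cfun.span_diff cfun.span_add cfun.span_scale generators_span project_span)
  fix h k assume h: "h \<in> ell2 (U \<union> Y)" and k: "k \<in> ell2 (U \<union> Y)"
  have "cinner2 (project h) k = cinner2 h (project k)" by (rule cinner2_cong) (simp add: project_def)
  moreover have "cinner2 h (B' k) = cnj (cinner2 (B' k) h)" by (rule cinner2_commute)
  ultimately show "cinner2 (B h) k = cinner2 h (B' k)"
    unfolding B_def B'_def combination_inner[OF V(1,2) h k] combination_inner[OF V(4,3) k h]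
    by (simp add: cnj_cinner2 mult.commute)
qed

text \<open>
  \<open>W - \<mu>\<close> and \<open>B\<close> have the same range, and \<open>precond\<close> maps the kernel of \<open>B\<close> isomorphically onto that
  of \<open>W - \<mu>\<close>.
\<close>

lemma fredholm_and_index:
  "fredholm (ell2 (U \<union> Y)) (W -\<^sub>o \<mu>)" "fredholm_index (ell2 (U \<union> Y)) W \<mu> = 0"
proof -
  interpret B: finite_rank_perturbation "U \<union> Y" B B' generators scalar by (rule B_perturbation)
  interpret Bs: finite_rank_perturbation "U \<union> Y" B' B generators "cnj scalar" by (rule B.swap)
  let ?kB = "{h \<in> ell2 (U \<union> Y). B h = 0}" and ?kB' = "{h \<in> ell2 (U \<union> Y). B' h = 0}"
  have ran: "Range (W -\<^sub>o \<mu>) = B ` ell2 (U \<union> Y)" unfolding shift_precond by auto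
  have closed: "closed_in2 (ell2 (U \<union> Y)) (Range (W -\<^sub>o \<mu>))"
    unfolding ran B.range_eq by (rule orthogonal_complement_closed) auto
  have ker: "op_ker (W -\<^sub>o \<mu>) = precond ` ?kB" unfolding op_ker_def shift_precond by auto
  have "Vector_Spaces.linear cscale cscale precond"
    by (auto simp: Vector_Spaces.linear_iff cfun.vector_space_axioms precond_def fun_eq_iff cscale_def
        algebra_simps)
  moreover have "inj precond"
    using multiplier_nonzero by (auto simp: inj_def precond_def fun_eq_iff)
  ultimately have fin: "finite_dim (op_ker (W -\<^sub>o \<mu>))"
    and dim: "cfun.dim (op_ker (W -\<^sub>o \<mu>)) = cfun.dim ?kB"
    unfolding ker using dim_image_injective[OF _ _ B.finite_dim_kernel] by auto
  have adj: "op_ker (adjoint_in (ell2 (U \<union> Y)) (W -\<^sub>o \<mu>)) = ?kB'"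
  proof -
    have "B' y = 0" if y: "y \<in> ell2 (U \<union> Y)" and perp: "\<And>h. h \<in> ell2 (U \<union> Y) \<Longrightarrow> cinner2 (B h) y = 0" for y
    proof -
      have B'y: "B' y \<in> ell2 (U \<union> Y)" using B.B'(1) y by blast
      have "cinner2 (B' y) (B' y) = 0" using B.adj[OF B'y y] perp[OF B'y] by simp
      then show ?thesis by (rule cinner2_self_eq_0[OF B'y])
    qed
    moreover have "cinner2 a 0 = 0" for a :: "'v \<Rightarrow> complex" by (simp add: cinner2_def)
    ultimately show ?thesis unfolding kernel_adjoint ran using B.adj by auto
  qed
  show "fredholm (ell2 (U \<union> Y)) (W -\<^sub>o \<mu>)"
    unfolding fredholm_def adj using closed fin Bs.finite_dim_kernel by blast
  have "W \<subseteq> ell2 (U \<union> Y) \<times> ell2 (U \<union> Y)"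
    unfolding W_eq using act_ell2 by (auto simp: dom_def)
  then show "fredholm_index (ell2 (U \<union> Y)) W \<mu> = 0"
    unfolding fredholm_index_def by (simp add: kernel_adjoint_shift adj dim B.dim_kernel_eq)
qed

end

lemma finite_support_range:
  assumes F: "finite F" "F \<subseteq> U"
  shows "(\<lambda>v. if v \<in> F then lam v - \<mu> else 0) + (\<Sum>v\<in>F. cnj (g v)) *\<^sub>c f \<in> Range (W -\<^sub>o \<mu>)"
proof -
  define a :: "'v \<Rightarrow> complex" where "a = (\<lambda>v. if v \<in> F then 1 else 0)"
  have a: "a \<in> ell2 U" by (rule ell2_finite_support(1)[OF F(1)]) (use F in \<open>auto simp: a_def\<close>)
  have dom: "a \<in> dom" and fn: "functional a = (\<Sum>v\<in>F. cnj (g v))"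
    using finite_support_dom[OF F ell2_U_ell2[OF a]] by (auto simp: a_def)
  have aval: "a v = (if v \<in> F then 1 else 0)" for v by (simp add: a_def)
  have "cinner2 a w = 0" by (rule cinner2_orthogonal_disjoint[OF a w disjoint])
  then have "act a v - \<mu> * a v
      = (if v \<in> F then lam v - \<mu> else 0) + (\<Sum>v\<in>F. cnj (g v)) * f v" for v
    using F on_U[of v] outside_Y(1)[of v] by (cases "v \<in> U") (auto simp: act_def fn aval)
  then have "act a - \<mu> *\<^sub>c a = (\<lambda>v. if v \<in> F then lam v - \<mu> else 0) + (\<Sum>v\<in>F. cnj (g v)) *\<^sub>c f"
    by (simp add: fun_eq_iff cscale_def)
  then show ?thesis unfolding shift_eq using dom by (auto simp: Range_iff intro!: exI[of _ a])
qed

text \<open>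
  For finite \<open>F \<subseteq> A\<close> the range contains the image of the indicator function of \<open>F\<close>.  Under the
  summability hypotheses these images converge, and the limit lies in the closed range.  Since
  \<open>\<lambda> - \<mu>\<close> has no zero on \<open>A\<close>, a preimage of the limit must equal \<open>1\<close> on all of \<open>A\<close>, which is square
  summable only for finite \<open>A\<close>.
\<close>

lemma closed_range_no_accumulation:
  assumes cl: "closed_in2 (ell2 (U \<union> Y)) (Range (W -\<^sub>o \<mu>))"
    and A: "A \<subseteq> U" "\<And>v. v \<in> A \<Longrightarrow> lam v \<noteq> \<mu>"
    and sm: "(\<lambda>v. (cmod (lam v - \<mu>))\<^sup>2) summable_on A" and smg: "(\<lambda>v. cnj (g v)) summable_on A"
  shows "finite A"
proof -
  define h where "h = (\<lambda>v. if v \<in> A then lam v - \<mu> else 0)"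
  have "(\<lambda>v. (cmod (h v))\<^sup>2) summable_on A"
    using sm by (rule summable_on_cong[THEN iffD1, rotated]) (simp add: h_def)
  then have hA: "h \<in> ell2 A" by (auto simp: ell2_def h_def)
  then have h: "h \<in> ell2 U" using A(1) ell2_mono by blast
  define t where "t = (\<Sum>\<^sub>\<infinity>v\<in>A. cnj (g v))"
  define y where "y = h + t *\<^sub>c f"
  have y: "y \<in> ell2 (U \<union> Y)"
    unfolding y_def by (rule ell2_add[OF ell2_U_ell2[OF h] ell2_Y_ell2[OF ell2_scale[OF f]]])
  have "y \<in> Range (W -\<^sub>o \<mu>)"
  proof (rule closed_in2_limit[OF cl y])
    fix e :: real assume e: "e > 0"
    define d where "d = e / (2 * (norm2 f + 1))"
    have nf: "0 < norm2 f + 1" using norm2_nonneg[of f] by linarith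
    have d: "d > 0" using e nf by (simp add: d_def)
    have "((\<lambda>v. (cmod (h v))\<^sup>2) has_sum (norm2 h)\<^sup>2) A"
    proof -
      have "(norm2 h)\<^sup>2 = (\<Sum>\<^sub>\<infinity>v\<in>A. (cmod (h v))\<^sup>2)"
        unfolding norm2_power2 by (rule infsum_cong_neutral) (auto simp: h_def)
      then show ?thesis using summable_norm2_ell2[OF hA] by simp
    qed
    then have "\<forall>\<^sub>F F in finite_subsets_at_top A. dist (\<Sum>v\<in>F. (cmod (h v))\<^sup>2) ((norm2 h)\<^sup>2) < (e / 2)\<^sup>2"
      using e unfolding has_sum_def by (intro tendstoD) auto
    moreover have "\<forall>\<^sub>F F in finite_subsets_at_top A. dist (\<Sum>v\<in>F. cnj (g v)) t < d"
      using has_sum_infsum[OF smg] d unfolding has_sum_def t_def by (intro tendstoD) auto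
    moreover have "\<forall>\<^sub>F F in finite_subsets_at_top A. finite F \<and> F \<subseteq> A"
      by (rule eventually_finite_subsets_at_top_weakI) simp
    ultimately have ev: "\<forall>\<^sub>F F in finite_subsets_at_top A.
        dist (\<Sum>v\<in>F. (cmod (h v))\<^sup>2) ((norm2 h)\<^sup>2) < (e / 2)\<^sup>2
        \<and> dist (\<Sum>v\<in>F. cnj (g v)) t < d \<and> finite F \<and> F \<subseteq> A"
      by eventually_elim blast
    then obtain F where F: "finite F" "F \<subseteq> A" and Fh: "dist (\<Sum>v\<in>F. (cmod (h v))\<^sup>2) ((norm2 h)\<^sup>2) < (e / 2)\<^sup>2"
      and Fg: "dist (\<Sum>v\<in>F. cnj (g v)) t < d"
      using eventually_happens'[OF finite_subsets_at_top_neq_bot ev] by blast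
    define hF where "hF = (\<lambda>v. if v \<in> F then lam v - \<mu> else 0)"
    define r where "r = hF + (\<Sum>v\<in>F. cnj (g v)) *\<^sub>c f"
    have hF: "hF \<in> ell2 U"
      by (rule ell2_finite_support(1)[OF F(1)]) (use F A in \<open>auto simp: hF_def\<close>)
    have "r \<in> Range (W -\<^sub>o \<mu>)"
      unfolding r_def hF_def using F A by (intro finite_support_range) auto
    moreover have "norm2 (r - y) < e"
    proof -
      have hn: "norm2 (hF - h) < e / 2"
      proof (rule power2_less_imp_less)
        have "(norm2 h)\<^sup>2 = (\<Sum>\<^sub>\<infinity>v. (cmod (hF v))\<^sup>2 + (cmod ((hF - h) v))\<^sup>2)"
          unfolding norm2_power2
          by (rule infsum_cong) (use F in \<open>auto simp: hF_def h_def norm_minus_commute\<close>)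
        also have "\<dots> = (norm2 hF)\<^sup>2 + (norm2 (hF - h))\<^sup>2"
          unfolding norm2_power2
          by (rule infsum_add) (intro summable_norm2_ell2[OF hF] summable_norm2_ell2[OF ell2_diff[OF hF h]])+
        also have "(norm2 hF)\<^sup>2 = (\<Sum>v\<in>F. (cmod (hF v))\<^sup>2)"
          by (rule ell2_finite_support(2)[of F hF F]) (use F in \<open>auto simp: hF_def\<close>)
        also have "\<dots> = (\<Sum>v\<in>F. (cmod (h v))\<^sup>2)"
          by (rule sum.cong) (use F in \<open>auto simp: hF_def h_def\<close>)
        finally show "(norm2 (hF - h))\<^sup>2 < (e / 2)\<^sup>2" using Fh unfolding dist_real_def by linarith
      qed (use e in simp)
      have "r - y = (hF - h) + ((\<Sum>v\<in>F. cnj (g v)) - t) *\<^sub>c f"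
        by (simp add: r_def y_def fun_eq_iff cscale_def algebra_simps)
      then have "norm2 (r - y) \<le> norm2 (hF - h) + norm2 (((\<Sum>v\<in>F. cnj (g v)) - t) *\<^sub>c f)"
        using norm2_add_le[OF ell2_U_ell2[OF ell2_diff[OF hF h]] ell2_Y_ell2[OF ell2_scale[OF f]]] by simp
      also have "\<dots> \<le> norm2 (hF - h) + d * norm2 f"
        using norm2_scale_le[OF f, of "(\<Sum>v\<in>F. cnj (g v)) - t"] Fg
          mult_right_mono[of "cmod ((\<Sum>v\<in>F. cnj (g v)) - t)" d "norm2 f"]
        by (simp add: dist_norm)
      also have "d * norm2 f \<le> e / 2" using nf e by (simp add: d_def field_simps)
      finally show ?thesis using hn by linarith
    qed
    ultimately show "\<exists>r\<in>Range (W -\<^sub>o \<mu>). norm2 (r - y) < e" by blast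
  qed
  then obtain a where a: "a \<in> dom" "y = act a - \<mu> *\<^sub>c a" unfolding shift_eq by auto
  have aV: "a \<in> ell2 (U \<union> Y)" using a(1) by (simp add: dom_def)
  have "a v = 1" if "v \<in> A" for v
  proof -
    have v: "v \<in> U" using that A by blast
    then have "(lam v - \<mu>) * a v = lam v - \<mu>"
      using fun_cong[OF a(2), of v] that on_U[OF v] outside_Y(1)[of v]
      by (simp add: y_def h_def act_def cscale_def algebra_simps)
    then show ?thesis using A(2)[OF that] by simp
  qed
  then have "A \<subseteq> {v. 1 \<le> cmod (a v)}" by auto
  then show ?thesis using finite_superlevel[OF aV, of 1] finite_subset by fastforce
qed

text \<open>
  Near \<open>\<mu>\<close>, condition I makes \<open>g\<close> square summable, so that \<open>g\<close> is small outside a finite set.  If the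
  diagonal entries accumulate at \<open>\<mu>\<close>, one can thus pick a sequence of vertices along which both
  \<open>\<lambda> - \<mu>\<close> and \<open>g\<close> decay geometrically, against the previous lemma.
\<close>

lemma closed_range_isolated:
  assumes compat: "compat_I U lam g"
    and cl: "closed_in2 (ell2 (U \<union> Y)) (Range (W -\<^sub>o \<mu>))"
  shows "isolated \<mu>"
proof (rule ccontr)
  assume not: "\<not> isolated \<mu>"
  define T where "T = {v \<in> U. lam v \<noteq> \<mu> \<and> cmod (lam v - \<mu>) < 1}"
  define gT where "gT = (\<lambda>v. if v \<in> U then (if v \<in> T then 1 else 0) * g v else 0)"
  have gT: "gT \<in> ell2 U"
    unfolding gT_def
    by (rule compat_I_weighted_ell2[OF compat, where C = 1 and C' = 1 and \<mu> = \<mu>]) (auto simp: T_def)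
  have step: "\<exists>v\<in>T. cmod (lam v - \<mu>) < e \<and> cmod (g v) < d" if e: "e > 0" and d: "d > 0" for e d
  proof -
    define R where "R = {v \<in> T. d \<le> cmod (g v)}"
    have "R \<subseteq> {v. d \<le> cmod (gT v)}" by (auto simp: R_def T_def gT_def)
    then have "finite R" using finite_superlevel[OF gT d] finite_subset by blast
    define e' where "e' = Min (insert e (insert 1 ((\<lambda>v. cmod (lam v - \<mu>)) ` R)))"
    have fin: "finite (insert e (insert 1 ((\<lambda>v. cmod (lam v - \<mu>)) ` R)))" using \<open>finite R\<close> by simp
    have "e' > 0"
      unfolding e'_def using fin e by (subst Min_gr_iff) (auto simp: R_def T_def)
    then obtain v where v: "v \<in> U" "lam v \<noteq> \<mu>" "cmod (lam v - \<mu>) < e'"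
      using not unfolding isolated_def by (auto simp: not_le)
    have le: "e' \<le> z" if "z \<in> insert e (insert 1 ((\<lambda>v. cmod (lam v - \<mu>)) ` R))" for z
      unfolding e'_def using fin that by (rule Min_le)
    have "v \<in> T" using v le[of 1] by (simp add: T_def)
    moreover have "v \<notin> R" using v(3) le[of "cmod (lam v - \<mu>)"] by auto
    ultimately show ?thesis using v(3) le[of e] by (intro bexI[of _ v]) (auto simp: R_def)
  qed
  obtain z where z: "\<And>n. z n \<in> T \<and> cmod (lam (z n) - \<mu>) < (1/2) ^ n \<and> cmod (g (z n)) < (1/2) ^ n"
    and dec: "\<And>n. cmod (lam (z (Suc n)) - \<mu>) < cmod (lam (z n) - \<mu>)"
  proof -
    have "\<exists>z. \<forall>n. (z n \<in> T \<and> cmod (lam (z n) - \<mu>) < (1/2) ^ n \<and> cmod (g (z n)) < (1/2) ^ n)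
        \<and> cmod (lam (z (Suc n)) - \<mu>) < cmod (lam (z n) - \<mu>)"
    proof (rule dependent_nat_choice)
      show "\<exists>v. v \<in> T \<and> cmod (lam v - \<mu>) < (1/2) ^ 0 \<and> cmod (g v) < (1/2) ^ 0"
        using step[of 1 1] by auto
      fix v n assume v: "v \<in> T \<and> cmod (lam v - \<mu>) < (1/2) ^ n \<and> cmod (g v) < (1/2) ^ n"
      then have "0 < min ((1/2) ^ Suc n) (cmod (lam v - \<mu>))" by (simp add: T_def)
      from step[OF this, of "(1/2) ^ Suc n"]
      show "\<exists>v'. (v' \<in> T \<and> cmod (lam v' - \<mu>) < (1/2) ^ Suc n \<and> cmod (g v') < (1/2) ^ Suc n)
          \<and> cmod (lam v' - \<mu>) < cmod (lam v - \<mu>)"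
        by auto
    qed
    then show ?thesis using that by blast
  qed
  have dec': "strict_mono (\<lambda>n. - cmod (lam (z n) - \<mu>))"
    using dec by (intro strict_monoI_Suc) simp
  have inj: "inj z"
  proof (rule injI)
    fix m n assume "z m = z n"
    then have "(\<lambda>n. - cmod (lam (z n) - \<mu>)) m = (\<lambda>n. - cmod (lam (z n) - \<mu>)) n" by simp
    then show "m = n" using strict_mono_eq[OF dec', of m n] by blast
  qed
  have geo: "(\<lambda>n. (1/2 :: real) ^ n) summable_on UNIV"
    by (subst summable_on_UNIV_nonneg_real_iff) (auto intro: summable_geometric)
  have "finite (range z)"
  proof (rule closed_range_no_accumulation[OF cl])
    show "range z \<subseteq> U" "\<And>v. v \<in> range z \<Longrightarrow> lam v \<noteq> \<mu>" using z by (auto simp: T_def)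
    have "(\<lambda>n. (cmod (lam (z n) - \<mu>))\<^sup>2) summable_on UNIV"
    proof (rule summable_on_comparison_test[OF geo])
      fix n
      have "(cmod (lam (z n) - \<mu>))\<^sup>2 \<le> ((1/2) ^ n)\<^sup>2"
        using z[of n] by (intro power_mono) auto
      also have "\<dots> \<le> (1/2) ^ n"
        using mult_right_le_one_le[of "(1/2 :: real) ^ n" "(1/2) ^ n"] by (simp add: power2_eq_square power_le_one)
      finally show "(cmod (lam (z n) - \<mu>))\<^sup>2 \<le> (1/2) ^ n" .
    qed simp
    then show "(\<lambda>v. (cmod (lam v - \<mu>))\<^sup>2) summable_on range z"
      using summable_on_reindex[OF inj, of "\<lambda>v. (cmod (lam v - \<mu>))\<^sup>2"] by (simp add: o_def)
    have "(\<lambda>n. cmod (cnj (g (z n)))) summable_on UNIV"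
      by (rule summable_on_comparison_test[OF geo]) (use z in \<open>auto intro: less_imp_le\<close>)
    then have "(\<lambda>n. cnj (g (z n))) summable_on UNIV" by (rule abs_summable_summable)
    then show "(\<lambda>v. cnj (g v)) summable_on range z"
      using summable_on_reindex[OF inj, of "\<lambda>v. cnj (g v)"] by (simp add: o_def)
  qed
  then show False using range_inj_infinite[OF inj] by blast
qed

text \<open>
  Vectors in the range vanish on the level set of \<open>\<mu>\<close>, so \<open>e\<^sub>v\<close> is orthogonal to the range for \<open>v\<close> in
  that set.  For \<open>\<mu> = 0\<close> the kernel contains the orthogonal complement of \<open>w\<close> in \<open>\<ell>\<^sup>2(Y)\<close>, which has
  codimension at most \<open>1\<close>.
\<close>

lemma fredholm_imp_finite:
  assumes fr: "fredholm (ell2 (U \<union> Y)) (W -\<^sub>o \<mu>)"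
  shows "finite (level_set \<mu>)" "\<mu> \<noteq> 0 \<or> finite Y"
proof -
  have "basis_vec ` level_set \<mu> \<subseteq> op_ker (adjoint_in (ell2 (U \<union> Y)) (W -\<^sub>o \<mu>))"
    unfolding kernel_adjoint shift_eq
    by (auto simp: level_set_def cinner2_basis_right act_def cscale_def intro!: basis_vec_ell2)
  then show "finite (level_set \<mu>)"
    using fr finite_dim_basis_vecs unfolding fredholm_def by blast
  show "\<mu> \<noteq> 0 \<or> finite Y"
  proof (rule ccontr)
    assume "\<not> (\<mu> \<noteq> 0 \<or> finite Y)"
    then have \<mu>: "\<mu> = 0" and inf: "infinite Y" by auto
    obtain G where G: "finite G" "op_ker (W -\<^sub>o \<mu>) \<subseteq> cfun.span G"
      using fr unfolding fredholm_def finite_dim_def by blast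
    have ker: "k \<in> op_ker (W -\<^sub>o \<mu>)" if k: "k \<in> ell2 Y" and perp: "cinner2 k w = 0" for k
    proof -
      have kU: "k v = 0" if "v \<in> U" for v by (rule ell2_outside[OF k on_U[OF that]])
      have "k \<in> dom" "functional k = 0"
        using finite_support_dom[of "{}" k] k ell2_Y_ell2 kU by auto
      moreover from this have "act k - \<mu> *\<^sub>c k = 0"
        using kU perp by (simp add: fun_eq_iff act_def cscale_def \<mu>)
      ultimately show ?thesis unfolding op_ker_def shift_eq by force
    qed
    have "ell2 Y \<subseteq> cfun.span (insert w G)"
    proof
      fix k assume k: "k \<in> ell2 Y"
      define t where "t = cinner2 k w / cinner2 w w"
      have "cinner2 (k - t *\<^sub>c w) w = cinner2 k w - t * cinner2 w w"
        using cinner2_diff_left[OF k ell2_scale[OF w] w] by (simp add: cinner2_scale_left)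
      also have "\<dots> = 0"
      proof (cases "cinner2 w w = 0")
        case True
        then have "w = 0" by (rule cinner2_self_eq_0[OF w])
        then show ?thesis by (simp add: cinner2_def)
      qed (simp add: t_def)
      finally have "k - t *\<^sub>c w \<in> cfun.span G"
        using ker[OF ell2_diff[OF k ell2_scale[OF w]]] G(2) by blast
      then have "k - t *\<^sub>c w \<in> cfun.span (insert w G)"
        using cfun.span_mono[of G "insert w G"] by blast
      moreover have "t *\<^sub>c w \<in> cfun.span (insert w G)"
        by (intro cfun.span_scale cfun.span_base) simp
      ultimately have "(k - t *\<^sub>c w) + t *\<^sub>c w \<in> cfun.span (insert w G)" by (rule cfun.span_add)
      then show "k \<in> cfun.span (insert w G)" by (simp only: diff_add_cancel)
    qed
    then have "finite_dim (ell2 Y)" using G(1) unfolding finite_dim_def by blast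
    then show False using inf finite_dim_ell2_iff by blast
  qed
qed

lemma fredholm_iff:
  assumes "compat_I U lam g"
  shows "fredholm (ell2 (U \<union> Y)) (W -\<^sub>o \<mu>)
    \<longleftrightarrow> finite (level_set \<mu>) \<and> isolated \<mu> \<and> (\<mu> \<noteq> 0 \<or> finite Y)"
  using fredholm_and_index(1)[OF assms] fredholm_imp_finite closed_range_isolated[OF assms]
  unfolding fredholm_def by blast

end

text \<open>
  With \<open>Y = {}\<close> the criterion \<open>fredholm_iff\<close> applies to the diagonal operator, so one analysis
  serves for both sides of the comparison of essential spectra.
\<close>

lemma diag_oper_as_block:
  "rank_one_block.W U {} lam 0 0 0 0 = diag_oper U lam" (is "?W = _")
  and diag_oper_block: "rank_one_block U {} 0 0 0"
proof -
  interpret rank_one_block U "{}" lam 0 0 0 0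
    by unfold_locales (simp_all add: ell2_zero)
  have act: "act a = (\<lambda>v. lam v * a v)" if "a \<in> dom" for a
    using that by (auto simp: fun_eq_iff act_def dom_def ell2_outside)
  have "(\<lambda>v. if v \<in> U then lam v * a v else 0) = (\<lambda>v. lam v * a v)" if "a \<in> ell2 U" for a
    using that by (auto simp: fun_eq_iff ell2_outside)
  then have dom: "a \<in> dom \<longleftrightarrow> a \<in> ell2 U \<and> (\<lambda>v. lam v * a v) \<in> ell2 U" for a
    by (auto simp: dom_def)
  have "(a, c) \<in> ?W \<longleftrightarrow> (a, c) \<in> diag_oper U lam" for a c
  proof -
    have "(a, c) \<in> ?W \<longleftrightarrow> a \<in> dom \<and> c = act a" unfolding W_eq by blast
    also have "\<dots> \<longleftrightarrow> a \<in> dom \<and> c = (\<lambda>v. lam v * a v)" using act by auto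
    also have "\<dots> \<longleftrightarrow> (a, c) \<in> diag_oper U lam" unfolding dom diag_oper_def by blast
    finally show ?thesis .
  qed
  then show "?W = diag_oper U lam" by auto
  show "rank_one_block U {} 0 0 0" by unfold_locales
qed

context rank_one_block
begin

lemma fredholm_iff_diag_fredholm:
  assumes compat: "compat_I U lam g"
  shows "fredholm (ell2 (U \<union> Y)) (W -\<^sub>o \<mu>)
    \<longleftrightarrow> fredholm (ell2 U) (diag_oper U lam -\<^sub>o \<mu>) \<and> (\<mu> \<noteq> 0 \<or> finite Y)"
proof -
  interpret D: rank_one_block U "{}" lam 0 0 0 0 by (rule diag_oper_block)
  have "compat_I U lam 0" using compat unfolding compat_I_def by auto
  then show ?thesis
    using D.fredholm_iff[of \<mu>] fredholm_iff[OF compat, of \<mu>]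
    by (simp add: diag_oper_as_block D.level_set_def level_set_def D.isolated_def isolated_def)
qed

lemma ess_spectrum_eq:
  assumes "compat_I U lam g"
  shows "ess_spectrum (ell2 (U \<union> Y)) W =
    (if finite Y then ess_spectrum (ell2 U) (diag_oper U lam)
     else ess_spectrum (ell2 U) (diag_oper U lam) \<union> {0})"
  unfolding ess_spectrum_def fredholm_iff_diag_fredholm[OF assms] by auto

lemma fredholm_index_eq_0:
  assumes compat: "compat_I U lam g" and "\<mu> \<notin> ess_spectrum (ell2 (U \<union> Y)) W"
  shows "fredholm_index (ell2 (U \<union> Y)) W \<mu> = 0"
  using assms fredholm_iff[OF compat, of \<mu>] fredholm_and_index(2)[OF compat]
  by (auto simp: ess_spectrum_def)

end



section \<open>Rooted directed trees\<close>

text \<open>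
  Every vertex is a descendant of the root, and along the path from the root each step adds a
  single ancestor, parents being unique.
\<close>

lemma rooted_tree_ancestors_finite:
  assumes T: "rooted_directed_tree V E" and v: "v \<in> V"
  shows "finite {w. (w, v) \<in> E\<^sup>*}"
proof -
  have E: "E \<subseteq> V \<times> V" and conn: "\<And>v w. v \<in> V \<Longrightarrow> w \<in> V \<Longrightarrow> (v, w) \<in> (E \<union> E\<inverse>)\<^sup>*"
    and par: "\<And>v w w'. (w, v) \<in> E \<Longrightarrow> (w', v) \<in> E \<Longrightarrow> w = w'"
    using T unfolding rooted_directed_tree_def directed_tree_def by blast+
  obtain r where r: "r \<in> V" "\<And>w. (w, r) \<notin> E"
    using T unfolding rooted_directed_tree_def by blast
  have "(r, v) \<in> E\<^sup>*" using conn[OF r(1) v]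
  proof (induction rule: rtrancl_induct)
    case (step y z)
    \<comment> \<open>Moving up from \<open>y\<close> retraces the last edge of the path from the root, parents being unique.\<close>
    show ?case
    proof (cases "(y, z) \<in> E")
      case True
      then show ?thesis using step.IH by (rule rtrancl_into_rtrancl[rotated])
    next
      case False
      then have zy: "(z, y) \<in> E" using step.hyps(2) by blast
      from step.IH show ?thesis
      proof (cases rule: rtranclE)
        case base
        then show ?thesis using zy r(2) by blast
      next
        case (step y')
        then show ?thesis using zy par by blast
      qed
    qed
  qed simp
  then show ?thesis
  proof (induction rule: rtrancl_induct)
    case base
    have "{w. (w, r) \<in> E\<^sup>*} = {r}" using r(2) by (auto elim: rtranclE)
    then show ?case by simp
  next
    case (step y z)
    have "w = z \<or> (w, y) \<in> E\<^sup>*" if "(w, z) \<in> E\<^sup>*" for w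
      using that
    proof (cases rule: rtranclE)
      case (step y')
      then show ?thesis using par \<open>(y, z) \<in> E\<close> by blast
    qed simp
    then have "{w. (w, z) \<in> E\<^sup>*} \<subseteq> insert z {w. (w, y) \<in> E\<^sup>*}" by blast
    then show ?case using step.IH finite_subset by blast
  qed
qed

lemma Asc_iff: "w \<in> Asc E u \<longleftrightarrow> (w, u) \<in> E\<^sup>+"
  by (auto simp: Asc_def trancl_power Suc_le_eq)

lemma dpath_between:
  assumes "dpath E u p v" "w \<in> set p"
  shows "(u, w) \<in> E\<^sup>*" "(w, v) \<in> E\<^sup>*"
  using assms
proof (induction p arbitrary: u w)
  case (Cons y p)
  { case 1
    then show ?case
    proof (cases "w = u \<or> p = []")
      case False
      then have "dpath E (hd p) p v" "w \<in> set p" "(u, hd p) \<in> E"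
        using 1 by (auto simp: dpath_def successively_Cons)
      then show ?thesis using Cons.IH(1)[of "hd p" w] by (auto intro: converse_rtrancl_into_rtrancl)
    qed (use 1 in \<open>auto simp: dpath_def\<close>) }
  { case 2
    then show ?case
    proof (cases "p = []")
      case False
      then have p: "dpath E (hd p) p v" "(u, hd p) \<in> E" "y = u"
        using 2 by (auto simp: dpath_def successively_Cons)
      show ?thesis
      proof (cases "w \<in> set p")
        case True
        then show ?thesis using Cons.IH(2)[OF p(1)] by blast
      next
        case False
        then have "w = u" using 2 p by auto
        moreover have "(hd p, v) \<in> E\<^sup>*" using Cons.IH(2)[OF p(1), of "hd p"] \<open>p \<noteq> []\<close> by simp
        ultimately show ?thesis using p(2) by auto
      qed
    qed (use 2 in \<open>auto simp: dpath_def\<close>) }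
qed (auto simp: dpath_def)

lemma dpath_exists:
  assumes "(u, v) \<in> E\<^sup>*" shows "\<exists>p. dpath E u p v"
  using assms
proof (induction rule: converse_rtrancl_induct)
  case base
  show ?case by (rule exI[of _ "[v]"]) (simp add: dpath_def)
next
  case (step y z)
  then obtain p where "dpath E z p v" by blast
  then have "dpath E y (y # p) v" using step.hyps(1) by (auto simp: dpath_def successively_Cons)
  then show ?case by blast
qed

lemma path_verts_subset: "path_verts E u v \<subseteq> {w. (u, w) \<in> E\<^sup>* \<and> (w, v) \<in> E\<^sup>*}"
proof
  fix w assume "w \<in> path_verts E u v"
  then obtain p where "dpath E u p v" "w \<in> set p" unfolding path_verts_def by blast
  then show "w \<in> {w. (u, w) \<in> E\<^sup>* \<and> (w, v) \<in> E\<^sup>*}" using dpath_between[of E u p v w] by simp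
qed

lemma path_verts_ends:
  assumes "v \<in> Des E u" shows "u \<in> path_verts E u v" "v \<in> path_verts E u v"
proof -
  obtain p where p: "dpath E u p v" using assms dpath_exists unfolding Des_def by fastforce
  then have "u \<in> set p" "v \<in> set p" unfolding dpath_def by (metis hd_in_set, metis last_in_set)
  with p show "u \<in> path_verts E u v" "v \<in> path_verts E u v" unfolding path_verts_def by blast+
qed

text \<open>
  The combinatorial facts about \<open>U\<close> and \<open>A\<close>.  Disjointness of \<open>A\<close> and \<open>U\<close> comes from the absence of
  circuits, which separates the ancestors of \<open>u\<close> from its descendants.
\<close>

locale rooted_join =
  fixes V :: "'v set" and E :: "'v rel" and u b :: 'v
  assumes T: "rooted_directed_tree V E" and u: "u \<in> V" and b: "b \<in> V"
begin

lemma edges: "E \<subseteq> V \<times> V"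
  using T by (simp add: rooted_directed_tree_def directed_tree_def)

lemma antisym: "(v, w) \<in> E\<^sup>* \<Longrightarrow> (w, v) \<notin> E\<^sup>+"
  using T rtrancl_trancl_trancl[of v w E v]
  by (auto simp: rooted_directed_tree_def directed_tree_def acyclic_def)

lemma Des_subset: "Des E u \<subseteq> V"
  unfolding Des_def using edges u by (auto elim: rtranclE)

lemma Asc_subset: "Asc E u \<subseteq> V"
  using edges by (auto simp: Asc_iff dest!: tranclD)

lemma Des_self: "u \<in> Des E u"
  by (simp add: Des_def)

lemma Asc_disjoint: "v \<in> Asc E u \<Longrightarrow> v \<notin> Des E u"
  using antisym by (auto simp: Asc_iff Des_def)

lemma path_verts_self: "path_verts E u u = {u}"
proof
  show "path_verts E u u \<subseteq> {u}"
  proof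
    fix w assume "w \<in> path_verts E u u"
    then have "(u, w) \<in> E\<^sup>*" "(w, u) \<in> E\<^sup>*" using path_verts_subset by fastforce+
    then show "w \<in> {u}" using antisym by (auto simp: rtrancl_eq_or_trancl)
  qed
qed (simp add: path_verts_ends(1)[OF Des_self])

lemma path_verts_Des: "path_verts E u v \<subseteq> Des E u"
  using path_verts_subset[of E u v] by (auto simp: Des_def)

lemma join_U_subset: "join_U V E u b \<subseteq> V"
  using Des_subset Asc_subset by (auto simp: join_U_def Des_open_def)

lemma join_A_subset: "join_A E u b \<subseteq> V - join_U V E u b"
  using path_verts_Des[of b] Des_subset Asc_subset Asc_disjoint u b path_verts_self Des_self
  by (auto simp: join_A_def join_U_def Des_open_def)

lemma u_in_join_A: "u \<in> join_A E u b"
  using path_verts_ends(1)[of b E u] by (auto simp: join_A_def)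

lemma b_in_join_A: "b \<in> join_A E u b"
  using path_verts_ends(2)[of b E u] by (auto simp: join_A_def)

lemma join_A_finite: "finite (join_A E u b)"
proof -
  have "finite (path_verts E u b)"
    by (rule finite_subset[OF _ rooted_tree_ancestors_finite[OF T b]]) (use path_verts_subset[of E u b] in blast)
  moreover have "finite (Asc E u)"
    by (rule finite_subset[OF _ rooted_tree_ancestors_finite[OF T u]]) (auto simp: Asc_iff)
  ultimately show ?thesis by (simp add: join_A_def)
qed

text \<open>
  Both \<open>u\<close> and \<open>b\<close> always lie in \<open>A\<close>, hence outside \<open>U\<close>.  This decides
  whether \<open>N\<close> has a kernel of its own, apart from the case \<open>\<lambda>\<^sub>u\<^sub>u = 0\<close>.
\<close>

lemma complement_eq_singleton_iff: "V - join_U V E u b = {u} \<longleftrightarrow> b = u"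
proof
  show "V - join_U V E u b = {u} \<Longrightarrow> b = u" using b_in_join_A join_A_subset by blast
  show "b = u \<Longrightarrow> V - join_U V E u b = {u}" using u by (auto simp: join_U_def)
qed

lemma insert_u_join_U:
  "insert u (join_U V E u b) =
     (if b = u then V else if b \<in> Des_open E u u then Asc E u \<union> Des_closed E b u else Des E u)"
  using u Des_self path_verts_ends(1)[of b E u]
  by (auto simp: join_U_def Des_open_def Des_closed_def path_verts_self)

lemma weight_vec_ell2: "weight_vec lam (join_A E u b) \<in> ell2 (V - join_U V E u b)"
  by (rule ell2_finite_support(1)[OF join_A_finite _ join_A_subset]) (simp add: weight_vec_def)

lemma inner_weight_vec: "cinner2 (basis_vec u) (weight_vec lam (join_A E u b)) = lam u"
  by (subst cinner2_commute) (simp add: cinner2_basis_right weight_vec_def u_in_join_A)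

end


section \<open>Rank one extensions of weighted join operators\<close>

theorem theorem4p15:
  fixes V :: "'v set" and E :: "'v rel" and u b :: 'v
    and lam f g :: "'v \<Rightarrow> complex"
    and U :: "'v set" and H K :: "('v \<Rightarrow> complex) set" and D N W :: "'v oper"
  defines "U \<equiv> join_U V E u b"
    and "H \<equiv> ell2 U"
    and "K \<equiv> ell2 V \<ominus>\<^sub>2 H"
    and "D \<equiv> join_D V E u b lam"
    and "N \<equiv> join_N V E u b lam"
    and "W \<equiv> rank_one_ext V E u b lam f g"
  assumes "rooted_directed_tree V E"
    and "countable V" and "infinite V"
    and "u \<in> V" and "b \<in> V"
    and "f \<in> K" and "f \<noteq> 0"
  shows
    "point_spectrum W =
       (if b = u then lam ` V
        else if b \<in> Des_open E u u then lam ` (Asc E u \<union> Des_closed E b u) \<union> {0}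
        else lam ` Des E u \<union> {0})
     \<and> op_spectrum (ell2 V) W = (if compat_I U lam g then closure (point_spectrum W) else UNIV)
     \<and> (compat_I U lam g \<longrightarrow>
          (\<forall>\<mu>. \<mu> \<notin> closure (point_spectrum W) \<longrightarrow>
             (let L = oslash_oper U f g \<circ>\<^sub>o (D -\<^sub>o \<mu>)\<inverse> in
                (W -\<^sub>o \<mu>)\<inverse> =
                   lower_block ((D -\<^sub>o \<mu>)\<inverse>) (op_neg ((N -\<^sub>o \<mu>)\<inverse> \<circ>\<^sub>o L)) ((N -\<^sub>o \<mu>)\<inverse>)
                \<and> hilbert_schmidt_integral_oper U (V - U) L))
          \<and> ess_spectrum (ell2 V) W =
              (if finite_dim K then ess_spectrum H D else ess_spectrum H D \<union> {0})
          \<and> (\<forall>\<mu>. \<mu> \<notin> ess_spectrum (ell2 V) W \<longrightarrow> fredholm_index (ell2 V) W \<mu> = 0))"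
proof -
  interpret rooted_join V E u b by unfold_locales fact+
  have U: "U \<subseteq> V" unfolding U_def by (rule join_U_subset)
  then have V: "U \<union> (V - U) = V" by blast
  have K: "K = ell2 (V - U)" unfolding K_def H_def by (rule ell2_ominus_ell2[OF U])
  define w where "w = weight_vec lam (join_A E u b)"
  have uY: "u \<in> V - U" using u_in_join_A join_A_subset unfolding U_def by blast
  interpret P: pointed_rank_one_block U "V - U" lam f g w u
    using assms(12,13) uY weight_vec_ell2[of lam] basis_vec_ell2[OF uY]
    by unfold_locales (auto simp: K w_def U_def)
  have D: "D = diag_oper U lam" unfolding D_def join_D_def U_def ..
  have N: "N = rank_one_oper (ell2 (V - U)) (basis_vec u) w"
    unfolding N_def join_N_def w_def U_def by (simp add: ell2_ominus_ell2[OF join_U_subset])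
  have W: "W = P.W"
    by (simp only: W_def rank_one_ext_def P.W_def D[symmetric] N[symmetric]
        D_def[symmetric] N_def[symmetric] U_def[symmetric])
  have s: "P.s = lam u" unfolding w_def by (rule inner_weight_vec)
  have union: "lam ` U \<union> P.sigma_N = lam ` insert u U \<union> (if b = u then {} else {0})"
  proof -
    have "P.sigma_N = (if b = u then {lam u} else {lam u, 0})"
      unfolding P.sigma_N_def s unfolding U_def complement_eq_singleton_iff ..
    then show ?thesis by auto
  qed
  have ps: "point_spectrum W =
       (if b = u then lam ` V
        else if b \<in> Des_open E u u then lam ` (Asc E u \<union> Des_closed E b u) \<union> {0}
        else lam ` Des E u \<union> {0})"
    unfolding W P.point_spectrum_eq union insert_u_join_U[folded U_def] by simp
  have resolvent: "(W -\<^sub>o \<mu>)\<inverse> = lower_block ((D -\<^sub>o \<mu>)\<inverse>)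
        (op_neg ((N -\<^sub>o \<mu>)\<inverse> \<circ>\<^sub>o (oslash_oper U f g \<circ>\<^sub>o (D -\<^sub>o \<mu>)\<inverse>))) ((N -\<^sub>o \<mu>)\<inverse>)
      \<and> hilbert_schmidt_integral_oper U (V - U) (oslash_oper U f g \<circ>\<^sub>o (D -\<^sub>o \<mu>)\<inverse>)"
    if c: "compat_I U lam g" and \<mu>: "\<mu> \<notin> closure (point_spectrum W)" for \<mu>
  proof -
    obtain e where e: "e > 0" "\<And>v. v \<in> U \<Longrightarrow> e \<le> cmod (lam v - \<mu>)" "\<mu> \<notin> P.sigma_N"
      using P.gap_outside_closure[OF \<mu>[unfolded W]] by blast
    have coeff: "P.coefficient \<mu> \<in> ell2 U" by (rule P.coefficient_ell2[OF c e(1,2)])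
    show ?thesis
      unfolding W D N
      using P.resolvent_lower_block[OF e coeff] P.hilbert_schmidt_corner[OF e coeff] by blast
  qed
  have ess: "ess_spectrum (ell2 V) W = (if finite_dim K then ess_spectrum H D else ess_spectrum H D \<union> {0})"
    if "compat_I U lam g"
    using P.ess_spectrum_eq[OF that, unfolded V] unfolding W K H_def D finite_dim_ell2_iff .
  have index: "fredholm_index (ell2 V) W \<mu> = 0"
    if "compat_I U lam g" "\<mu> \<notin> ess_spectrum (ell2 V) W" for \<mu>
    using P.fredholm_index_eq_0[OF that(1), unfolded V] that(2) unfolding W by blast
  show ?thesis
    unfolding Let_def using ps P.spectrum_eq[unfolded V, folded W] resolvent ess index by blast
qed

end
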